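(* Let $D\subset\mathbb{R}^n$ be a bounded domain and $m\in L^\infty(D)$ complex valued. Let $A=A_m$ represent either the operator $B_m$, or the operator $I_m^{-1}B_m$ (in the latter case assume $\Re(1+m)>\delta>0$ in $D$ for some $\delta>0$), and let $\gamma$ be a bounded rectifiable curve in the complex plane that avoids the spectrum of $A_m$. Then the spectral projection $$P_\gamma(m):=\frac{1}{2\pi i}\int_\gamma (A_m-\lambda I)^{-1}\,d\lambda,$$ viewed as an operator valued function of $m\in L^\infty(D)$ with values in the space of bounded operators $$P_\gamma: L^2(D)\oplus L^2(D)\longrightarrow H^2_0(D)\oplus L^2(D)$$ with the operator norm, is continuous at $m$ (that is, $P_\gamma(p)$ is defined for all $p\in L^\infty(D)$ sufficiently close to $m$ in $L^\infty(D)$, and $P_\gamma(p)\to P_\gamma(m)$ as $p\to m$ in $L^\infty(D)$).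
   Context: $H^2_0(D)$ is the completion of $C_0^\infty(D)$ in the norm $\|u\|_2^2=\|u\|^2+\|\Delta u\|^2$, where $\|\cdot\|$ is the $L^2(D)$ norm. $\Delta_{00}$ denotes the Laplacian with domain $H_0^2(D)$, and $\Delta_{--}$ the distributional Laplacian with domain $\{v\in L^2(D):\Delta v\in L^2(D)\}$. $B_m$ is the unbounded operator on $L^2(D)\oplus L^2(D)$ with domain $H^2_0(D)\oplus\{v\in L^2(D):\Delta v\in L^2(D)\}$ given by the matrix $\begin{pmatrix}\Delta_{00}&m\\0&\Delta_{--}\end{pmatrix}$, i.e. $B_m(u,v)=(\Delta u+mv,\ \Delta v)$. $I_m$ is the bounded operator $I_m(u,v)=((1+m)u,v)$ on $L^2(D)\oplus L^2(D)$. A bounded rectifiable curve is parametrized on a closed interval, so its image is compact. *)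

theory Defs
  imports "HOL-Analysis.Analysis" "HOL-Probability.Essential_Supremum"
begin

class complex_vector = real_vector +
  fixes scaleC :: "complex \<Rightarrow> 'a \<Rightarrow> 'a"  (infixr \<open>*\<^sub>C\<close> 75)
  assumes scaleC_add_right: "c *\<^sub>C (x + y) = c *\<^sub>C x + c *\<^sub>C y"
    and scaleC_add_left: "(c + d) *\<^sub>C x = c *\<^sub>C x + d *\<^sub>C x"
    and scaleC_scaleC: "c *\<^sub>C d *\<^sub>C x = (c * d) *\<^sub>C x"
    and scaleC_one: "1 *\<^sub>C x = x"
    and scaleR_scaleC: "r *\<^sub>R x = complex_of_real r *\<^sub>C x"

instantiation prod :: (complex_vector, complex_vector) complex_vector
begin

definition "c *\<^sub>C p = (c *\<^sub>C fst p, c *\<^sub>C snd p)"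

instance
  by standard
    (auto simp: scaleC_prod_def scaleR_prod_def scaleC_add_right scaleC_add_left scaleC_scaleC
      scaleC_one scaleR_scaleC)

end

definition L2_fun :: "('a::euclidean_space \<Rightarrow> complex) set" where
  "L2_fun = {f. f \<in> borel_measurable lebesgue \<and> integrable lebesgue (\<lambda>x. (cmod (f x))\<^sup>2)}"

lemma L2_fun_zero: "(\<lambda>_. 0) \<in> L2_fun"
  by (simp add: L2_fun_def)

lemma L2_fun_add:
  fixes f g :: "'a::euclidean_space \<Rightarrow> complex"
  assumes "f \<in> L2_fun" "g \<in> L2_fun"
  shows "(\<lambda>x. f x + g x) \<in> L2_fun"
proof -
  have [measurable]: "f \<in> borel_measurable lebesgue" "g \<in> borel_measurable lebesgue"
    using assms by (auto simp: L2_fun_def)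
  have bound: "(cmod (f x + g x))\<^sup>2 \<le> 2 * (cmod (f x))\<^sup>2 + 2 * (cmod (g x))\<^sup>2" for x
  proof -
    have "(cmod (f x + g x))\<^sup>2 \<le> (cmod (f x) + cmod (g x))\<^sup>2"
      by (intro power_mono norm_triangle_ineq) auto
    also have "\<dots> \<le> 2 * (cmod (f x))\<^sup>2 + 2 * (cmod (g x))\<^sup>2"
      using sum_squares_bound[of "cmod (f x)" "cmod (g x)"] by (simp add: power2_sum)
    finally show ?thesis .
  qed
  have "integrable lebesgue (\<lambda>x. 2 * (cmod (f x))\<^sup>2 + 2 * (cmod (g x))\<^sup>2)"
    using assms by (auto simp: L2_fun_def)
  then have "integrable lebesgue (\<lambda>x. (cmod (f x + g x))\<^sup>2)"
    by (rule Bochner_Integration.integrable_bound) (use bound in \<open>auto intro!: AE_I2\<close>)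
  then show ?thesis
    by (auto simp: L2_fun_def)
qed

lemma L2_fun_cmult:
  assumes "f \<in> L2_fun"
  shows "(\<lambda>x. c * f x) \<in> L2_fun"
  using assms by (auto simp: L2_fun_def norm_mult power_mult_distrib)

lemma L2_fun_mult_cnj_integrable:
  fixes f g :: "'a::euclidean_space \<Rightarrow> complex"
  assumes "f \<in> L2_fun" "g \<in> L2_fun"
  shows "integrable lebesgue (\<lambda>x. f x * cnj (g x))"
proof -
  have [measurable]: "f \<in> borel_measurable lebesgue" "g \<in> borel_measurable lebesgue"
    using assms by (auto simp: L2_fun_def)
  have [measurable]: "(\<lambda>x. cnj (g x)) \<in> borel_measurable lebesgue"
    by (intro borel_measurable_continuous_on[where f = cnj]) (auto intro!: continuous_intros)
  have bound: "cmod (f x * cnj (g x)) \<le> (cmod (f x))\<^sup>2 + (cmod (g x))\<^sup>2" for x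
  proof -
    have "0 \<le> cmod (f x) * cmod (g x)"
      by simp
    then show ?thesis
      using sum_squares_bound[of "cmod (f x)" "cmod (g x)"] unfolding norm_mult complex_mod_cnj
      by linarith
  qed
  have "integrable lebesgue (\<lambda>x. (cmod (f x))\<^sup>2 + (cmod (g x))\<^sup>2)"
    using assms by (auto simp: L2_fun_def)
  then show ?thesis
    by (rule Bochner_Integration.integrable_bound) (use bound in \<open>auto intro!: AE_I2\<close>)
qed

definition L2_rel :: "('a::euclidean_space \<Rightarrow> complex) \<Rightarrow> ('a \<Rightarrow> complex) \<Rightarrow> bool" where
  "L2_rel f g \<longleftrightarrow> f \<in> L2_fun \<and> g \<in> L2_fun \<and> (AE x in lebesgue. f x = g x)"

quotient_type (overloaded) 'a L2 = "'a::euclidean_space \<Rightarrow> complex" / partial: L2_rel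
proof (rule part_equivpI)
  have "L2_rel (\<lambda>_::'a. 0) (\<lambda>_. 0)"
    using L2_fun_zero by (simp add: L2_rel_def)
  then show "\<exists>f::'a \<Rightarrow> complex. L2_rel f f"
    by blast
  show "symp (L2_rel :: ('a \<Rightarrow> complex) \<Rightarrow> _)"
    by (auto simp: symp_def L2_rel_def)
  show "transp (L2_rel :: ('a \<Rightarrow> complex) \<Rightarrow> _)"
  proof (rule transpI)
    fix f g h :: "'a \<Rightarrow> complex"
    assume "L2_rel f g" "L2_rel g h"
    then show "L2_rel f h"
      unfolding L2_rel_def by (auto elim: eventually_elim2)
  qed
qed

instantiation L2 :: (euclidean_space) complex_vector
begin

lift_definition zero_L2 :: "'a L2" is "\<lambda>_. 0"
  by (simp add: L2_rel_def L2_fun_zero)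

lift_definition plus_L2 :: "'a L2 \<Rightarrow> 'a L2 \<Rightarrow> 'a L2" is "\<lambda>f g x. f x + g x"
  unfolding L2_rel_def by (auto intro: L2_fun_add elim: eventually_elim2)

lift_definition scaleC_L2 :: "complex \<Rightarrow> 'a L2 \<Rightarrow> 'a L2" is "\<lambda>c f x. c * f x"
  unfolding L2_rel_def by (auto intro: L2_fun_cmult elim: eventually_mono)

definition scaleR_L2 :: "real \<Rightarrow> 'a L2 \<Rightarrow> 'a L2" where
  "scaleR_L2 r f = complex_of_real r *\<^sub>C f"

definition uminus_L2 :: "'a L2 \<Rightarrow> 'a L2" where
  "uminus_L2 f = (- 1) *\<^sub>C f"

definition minus_L2 :: "'a L2 \<Rightarrow> 'a L2 \<Rightarrow> 'a L2" where
  "minus_L2 f g = f + - g"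

instance
proof
  fix f g h :: "'a L2" and r s :: real and c d :: complex
  show "f + g + h = f + (g + h)"
    by transfer (auto simp: L2_rel_def add.assoc intro!: L2_fun_add)
  show "f + g = g + f"
    by transfer (auto simp: L2_rel_def add.commute intro!: L2_fun_add)
  show "0 + f = f"
    by transfer (auto simp: L2_rel_def)
  show "- f + f = 0"
    unfolding uminus_L2_def
    by transfer (auto simp: L2_rel_def L2_fun_zero)
  show "f - g = f + - g"
    by (simp add: minus_L2_def)
  show add_right: "c *\<^sub>C (f + g) = c *\<^sub>C f + c *\<^sub>C g" for c :: complex and f g :: "'a L2"
    by transfer (auto simp: L2_rel_def distrib_left intro!: L2_fun_add L2_fun_cmult)
  show add_left: "(c + d) *\<^sub>C f = c *\<^sub>C f + d *\<^sub>C f" for c d :: complex and f :: "'a L2"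
    by transfer (auto simp: L2_rel_def distrib_right intro!: L2_fun_add L2_fun_cmult)
  show assoc: "c *\<^sub>C d *\<^sub>C f = (c * d) *\<^sub>C f" for c d :: complex and f :: "'a L2"
    by transfer (auto simp: L2_rel_def mult.assoc intro!: L2_fun_cmult)
  show one: "1 *\<^sub>C f = f" for f :: "'a L2"
    by transfer (auto simp: L2_rel_def)
  show "r *\<^sub>R f = complex_of_real r *\<^sub>C f"
    by (simp add: scaleR_L2_def)
  show "r *\<^sub>R (f + g) = r *\<^sub>R f + r *\<^sub>R g" "(r + s) *\<^sub>R f = r *\<^sub>R f + s *\<^sub>R f"
    "r *\<^sub>R s *\<^sub>R f = (r * s) *\<^sub>R f" "1 *\<^sub>R f = f"
    by (simp_all add: scaleR_L2_def add_right add_left assoc one)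
qed

end

text \<open>The real part of the complex inner product; it induces the usual norm of \<open>L\<^sup>2\<close>.\<close>

instantiation L2 :: (euclidean_space) real_inner
begin

lift_definition inner_L2 :: "'a L2 \<Rightarrow> 'a L2 \<Rightarrow> real" is
  "\<lambda>f g. Re (\<integral>x. f x * cnj (g x) \<partial>lebesgue)"
proof -
  fix f f' g g' :: "'a \<Rightarrow> complex"
  assume "L2_rel f f'" "L2_rel g g'"
  then have "(\<integral>x. f x * cnj (g x) \<partial>lebesgue) = (\<integral>x. f' x * cnj (g' x) \<partial>lebesgue)"
    unfolding L2_rel_def
    by (intro integral_cong_AE borel_measurable_integrable L2_fun_mult_cnj_integrable)
      (auto elim: eventually_elim2)
  then show "Re (\<integral>x. f x * cnj (g x) \<partial>lebesgue) = Re (\<integral>x. f' x * cnj (g' x) \<partial>lebesgue)"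
    by simp
qed

definition norm_L2 :: "'a L2 \<Rightarrow> real" where
  "norm_L2 f = sqrt (inner f f)"

definition dist_L2 :: "'a L2 \<Rightarrow> 'a L2 \<Rightarrow> real" where
  "dist_L2 f g = norm (f - g)"

definition sgn_L2 :: "'a L2 \<Rightarrow> 'a L2" where
  "sgn_L2 f = inverse (norm f) *\<^sub>R f"

definition uniformity_L2 :: "('a L2 \<times> 'a L2) filter" where
  "uniformity_L2 = (INF e\<in>{0<..}. principal {(f, g). dist f g < e})"

definition open_L2 :: "'a L2 set \<Rightarrow> bool" where
  "open_L2 U \<longleftrightarrow> (\<forall>f\<in>U. \<forall>\<^sub>F (f', g) in uniformity. f' = f \<longrightarrow> g \<in> U)"

instance
proof
  fix f g h :: "'a L2" and r :: real and U :: "'a L2 set"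
  show "inner f g = inner g f"
  proof transfer
    fix f g :: "'a \<Rightarrow> complex"
    have "(\<integral>x. g x * cnj (f x) \<partial>lebesgue) = (\<integral>x. cnj (f x * cnj (g x)) \<partial>lebesgue)"
      by (simp add: mult.commute)
    also have "\<dots> = cnj (\<integral>x. f x * cnj (g x) \<partial>lebesgue)"
      by (rule Bochner_Integration.integral_cnj)
    finally show "Re (\<integral>x. f x * cnj (g x) \<partial>lebesgue) = Re (\<integral>x. g x * cnj (f x) \<partial>lebesgue)"
      by simp
  qed
  show "inner (f + g) h = inner f h + inner g h"
    by transfer (simp add: L2_rel_def distrib_right L2_fun_mult_cnj_integrable)
  show "inner (r *\<^sub>R f) g = r * inner f g"
    unfolding scaleR_L2_def by transfer (simp add: mult.assoc)
  have Re_inner: "Re (\<integral>x. f x * cnj (f x) \<partial>lebesgue) = (\<integral>x. (cmod (f x))\<^sup>2 \<partial>lebesgue)"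
    for f :: "'a \<Rightarrow> complex"
    unfolding complex_norm_square[symmetric] integral_complex_of_real by simp
  show "0 \<le> inner f f"
    by transfer (simp add: Re_inner)
  show "inner f f = 0 \<longleftrightarrow> f = 0"
  proof transfer
    fix f :: "'a \<Rightarrow> complex"
    assume "L2_rel f f"
    then have "integrable lebesgue (\<lambda>x. (cmod (f x))\<^sup>2)" "f \<in> L2_fun"
      by (auto simp: L2_rel_def L2_fun_def)
    then show "Re (\<integral>x. f x * cnj (f x) \<partial>lebesgue) = 0 \<longleftrightarrow> L2_rel f (\<lambda>_. 0)"
      by (simp add: Re_inner integral_nonneg_eq_0_iff_AE L2_rel_def L2_fun_zero)
  qed
  show "norm f = sqrt (inner f f)"
    by (simp add: norm_L2_def)
  show "dist f g = norm (f - g)"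
    by (simp add: dist_L2_def)
  show "sgn f = inverse (norm f) *\<^sub>R f"
    by (simp add: sgn_L2_def)
  show "uniformity = (INF e\<in>{0<..}. principal {(f :: 'a L2, g). dist f g < e})"
    by (simp add: uniformity_L2_def)
  show "open U \<longleftrightarrow> (\<forall>f\<in>U. \<forall>\<^sub>F (f', g) in uniformity. f' = f \<longrightarrow> g \<in> U)"
    by (simp add: open_L2_def)
qed

end

text \<open>\<open>L\<^sup>2(D)\<close> is identified, by extension by zero, with the closed subspace of \<open>L\<^sup>2\<close> of the whole
  space whose elements vanish almost everywhere outside \<open>D\<close>. The function \<open>rep_L2 f\<close> is some
  representative of the class \<open>f\<close>; nothing below depends on the choice.\<close>

definition L2_on :: "'a::euclidean_space set \<Rightarrow> 'a L2 set" where
  "L2_on D = {f. AE x in lebesgue. x \<notin> D \<longrightarrow> rep_L2 f x = 0}"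

text \<open>Elements of \<open>L\<^sup>\<infinity>(D)\<close> are represented by functions, of which only the values on \<open>D\<close> matter.\<close>

definition Linf_norm :: "'a::euclidean_space set \<Rightarrow> ('a \<Rightarrow> complex) \<Rightarrow> ereal" where
  "Linf_norm D m = esssup (lebesgue_on D) (\<lambda>x. ereal (cmod (m x)))"

definition Linf :: "'a::euclidean_space set \<Rightarrow> ('a \<Rightarrow> complex) set" where
  "Linf D = {m. m \<in> borel_measurable (lebesgue_on D) \<and> Linf_norm D m < \<infinity>}"

definition mult_L2 :: "'a::euclidean_space set \<Rightarrow> ('a \<Rightarrow> complex) \<Rightarrow> 'a L2 \<Rightarrow> 'a L2" where
  "mult_L2 D m f = abs_L2 (\<lambda>x. if x \<in> D then m x * rep_L2 f x else 0)"

definition dir_deriv :: "'a::euclidean_space \<Rightarrow> ('a \<Rightarrow> complex) \<Rightarrow> 'a \<Rightarrow> complex" where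
  "dir_deriv b f x = frechet_derivative f (at x) b"

definition smooth :: "('a::euclidean_space \<Rightarrow> complex) \<Rightarrow> bool" where
  "smooth f \<longleftrightarrow> (\<forall>bs. set bs \<subseteq> Basis \<longrightarrow> (\<forall>x. foldr dir_deriv bs f differentiable (at x)))"

definition test_functions :: "'a::euclidean_space set \<Rightarrow> ('a \<Rightarrow> complex) set" where
  "test_functions D =
     {\<phi>. smooth \<phi> \<and> compact (closure {x. \<phi> x \<noteq> 0}) \<and> closure {x. \<phi> x \<noteq> 0} \<subseteq> D}"

definition laplacian :: "('a::euclidean_space \<Rightarrow> complex) \<Rightarrow> 'a \<Rightarrow> complex" where
  "laplacian f x = (\<Sum>b\<in>Basis. dir_deriv b (dir_deriv b f) x)"

definition is_distr_laplacian :: "'a::euclidean_space set \<Rightarrow> 'a L2 \<Rightarrow> 'a L2 \<Rightarrow> bool" where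
  "is_distr_laplacian D v w \<longleftrightarrow>
     (\<forall>\<phi>\<in>test_functions D.
        (\<integral>x. rep_L2 v x * laplacian \<phi> x \<partial>lebesgue) = (\<integral>x. rep_L2 w x * \<phi> x \<partial>lebesgue))"

definition lap_dom :: "'a::euclidean_space set \<Rightarrow> 'a L2 set" where
  "lap_dom D = {v \<in> L2_on D. \<exists>w\<in>L2_on D. is_distr_laplacian D v w}"

definition lap :: "'a::euclidean_space set \<Rightarrow> 'a L2 \<Rightarrow> 'a L2" where
  "lap D v = (THE w. w \<in> L2_on D \<and> is_distr_laplacian D v w)"

definition H20_norm :: "'a::euclidean_space set \<Rightarrow> 'a L2 \<Rightarrow> real" where
  "H20_norm D u = sqrt ((norm u)\<^sup>2 + (norm (lap D u))\<^sup>2)"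

text \<open>Since \<open>lap_dom D\<close> is complete in \<open>H20_norm D\<close>, the completion of the space of test functions
  in this norm is its closure in \<open>lap_dom D\<close>.\<close>

definition H20 :: "'a::euclidean_space set \<Rightarrow> 'a L2 set" where
  "H20 D = {u \<in> lap_dom D. \<exists>\<phi>. (\<forall>k::nat. \<phi> k \<in> test_functions D) \<and>
     (\<lambda>k. H20_norm D (abs_L2 (\<phi> k) - u)) \<longlonglongrightarrow> 0}"

text \<open>An unbounded operator on the closed subspace \<open>X\<close> is given by its domain \<open>V \<subseteq> X\<close> and a map \<open>A\<close>,
  whose values outside \<open>V\<close> are irrelevant.\<close>

definition resolvent ::
  "'v::{complex_vector, real_normed_vector} set \<Rightarrow> 'v set \<Rightarrow> ('v \<Rightarrow> 'v) \<Rightarrow> complex \<Rightarrow> 'v \<Rightarrow> 'v" where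
  "resolvent X V A z = (\<lambda>y\<in>X. inv_into V (\<lambda>x. A x - z *\<^sub>C x) y)"

definition resolvent_set ::
  "'v::{complex_vector, real_normed_vector} set \<Rightarrow> 'v set \<Rightarrow> ('v \<Rightarrow> 'v) \<Rightarrow> complex set" where
  "resolvent_set X V A =
     {z. bij_betw (\<lambda>x. A x - z *\<^sub>C x) V X \<and>
         (\<exists>K. \<forall>y\<in>X. norm (resolvent X V A z y) \<le> K * norm y)}"

definition spectrum_on ::
  "'v::{complex_vector, real_normed_vector} set \<Rightarrow> 'v set \<Rightarrow> ('v \<Rightarrow> 'v) \<Rightarrow> complex set" where
  "spectrum_on X V A = - resolvent_set X V A"

text \<open>Bounded operators from \<open>X\<close> to the space \<open>Y\<close> with norm \<open>N\<close>. Requiring them to be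
  \<open>undefined\<close> outside \<open>X\<close> makes equality of functions equality of operators.\<close>

definition bounded_ops ::
  "'v::{complex_vector, real_normed_vector} set \<Rightarrow> 'v set \<Rightarrow> ('v \<Rightarrow> real) \<Rightarrow> ('v \<Rightarrow> 'v) set" where
  "bounded_ops X Y N = {T \<in> X \<rightarrow>\<^sub>E Y.
     (\<forall>x\<in>X. \<forall>y\<in>X. T (x + y) = T x + T y) \<and> (\<forall>c. \<forall>x\<in>X. T (c *\<^sub>C x) = c *\<^sub>C T x) \<and>
     (\<exists>K. \<forall>x\<in>X. N (T x) \<le> K * norm x)}"

definition op_norm ::
  "'v::real_normed_vector set \<Rightarrow> ('v \<Rightarrow> real) \<Rightarrow> ('v \<Rightarrow> 'v) \<Rightarrow> real" where
  "op_norm X N T = (SUP x\<in>{x \<in> X. norm x \<le> 1}. N (T x))"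

definition is_partition :: "real \<Rightarrow> real \<Rightarrow> nat \<Rightarrow> (nat \<Rightarrow> real) \<Rightarrow> bool" where
  "is_partition a b n t \<longleftrightarrow> t 0 = a \<and> t n = b \<and> (\<forall>i<n. t i \<le> t (Suc i))"

definition rectifiable_curve :: "real \<Rightarrow> real \<Rightarrow> (real \<Rightarrow> complex) \<Rightarrow> bool" where
  "rectifiable_curve a b \<gamma> \<longleftrightarrow> continuous_on {a..b} \<gamma> \<and>
     (\<exists>L. \<forall>n t. is_partition a b n t \<longrightarrow> (\<Sum>i<n. cmod (\<gamma> (t (Suc i)) - \<gamma> (t i))) \<le> L)"

text \<open>The Riemann--Stieltjes integral of an operator-valued function along \<open>\<gamma>\<close>, as a limit of
  Riemann--Stieltjes sums in the operator norm.\<close>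

definition has_curve_integral ::
  "'v::{complex_vector, real_normed_vector} set \<Rightarrow> 'v set \<Rightarrow> ('v \<Rightarrow> real) \<Rightarrow> real \<Rightarrow> real \<Rightarrow>
     (real \<Rightarrow> complex) \<Rightarrow> (complex \<Rightarrow> 'v \<Rightarrow> 'v) \<Rightarrow> ('v \<Rightarrow> 'v) \<Rightarrow> bool" where
  "has_curve_integral X Y N a b \<gamma> F J \<longleftrightarrow>
     (\<forall>z\<in>\<gamma> ` {a..b}. F z \<in> bounded_ops X Y N) \<and> J \<in> bounded_ops X Y N \<and>
     (\<forall>\<epsilon>>0. \<exists>\<delta>>0. \<forall>n t s. is_partition a b n t \<and>
        (\<forall>i<n. t (Suc i) - t i < \<delta> \<and> s i \<in> {t i..t (Suc i)}) \<longrightarrow>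
        op_norm X N (\<lambda>x. (\<Sum>i<n. (\<gamma> (t (Suc i)) - \<gamma> (t i)) *\<^sub>C F (\<gamma> (s i)) x) - J x) < \<epsilon>)"

definition curve_integral ::
  "'v::{complex_vector, real_normed_vector} set \<Rightarrow> 'v set \<Rightarrow> ('v \<Rightarrow> real) \<Rightarrow> real \<Rightarrow> real \<Rightarrow>
     (real \<Rightarrow> complex) \<Rightarrow> (complex \<Rightarrow> 'v \<Rightarrow> 'v) \<Rightarrow> 'v \<Rightarrow> 'v" where
  "curve_integral X Y N a b \<gamma> F = (THE J. has_curve_integral X Y N a b \<gamma> F J)"

definition L2_sum :: "'a::euclidean_space set \<Rightarrow> ('a L2 \<times> 'a L2) set" where
  "L2_sum D = L2_on D \<times> L2_on D"

definition H20_sum :: "'a::euclidean_space set \<Rightarrow> ('a L2 \<times> 'a L2) set" where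
  "H20_sum D = H20 D \<times> L2_on D"

definition H20_sum_norm :: "'a::euclidean_space set \<Rightarrow> 'a L2 \<times> 'a L2 \<Rightarrow> real" where
  "H20_sum_norm D = (\<lambda>(u, v). sqrt ((H20_norm D u)\<^sup>2 + (norm v)\<^sup>2))"

definition B_dom :: "'a::euclidean_space set \<Rightarrow> ('a L2 \<times> 'a L2) set" where
  "B_dom D = H20 D \<times> lap_dom D"

definition B_op ::
  "'a::euclidean_space set \<Rightarrow> ('a \<Rightarrow> complex) \<Rightarrow> 'a L2 \<times> 'a L2 \<Rightarrow> 'a L2 \<times> 'a L2" where
  "B_op D m = (\<lambda>(u, v). (lap D u + mult_L2 D m v, lap D v))"

definition I_op ::
  "'a::euclidean_space set \<Rightarrow> ('a \<Rightarrow> complex) \<Rightarrow> 'a L2 \<times> 'a L2 \<Rightarrow> 'a L2 \<times> 'a L2" where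
  "I_op D m = (\<lambda>(u, v). (mult_L2 D (\<lambda>x. 1 + m x) u, v))"

datatype operator_kind = Op_B | Op_IB

text \<open>The operator \<open>A\<^sub>m\<close> is either \<open>B\<^sub>m\<close> or \<open>I\<^sub>m\<^sup>-\<^sup>1 B\<^sub>m\<close>; the latter makes sense only if \<open>I\<^sub>m\<close> is
  invertible. Both have the domain \<open>B_dom D\<close>.\<close>

fun A_op ::
  "operator_kind \<Rightarrow> 'a::euclidean_space set \<Rightarrow> ('a \<Rightarrow> complex) \<Rightarrow>
     'a L2 \<times> 'a L2 \<Rightarrow> 'a L2 \<times> 'a L2" where
  "A_op Op_B D m = B_op D m"
| "A_op Op_IB D m = inv_into (L2_sum D) (I_op D m) \<circ> B_op D m"

fun A_op_defined :: "operator_kind \<Rightarrow> 'a::euclidean_space set \<Rightarrow> ('a \<Rightarrow> complex) \<Rightarrow> bool" where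
  "A_op_defined Op_B D m \<longleftrightarrow> m \<in> Linf D"
| "A_op_defined Op_IB D m \<longleftrightarrow> m \<in> Linf D \<and> bij_betw (I_op D m) (L2_sum D) (L2_sum D)"

definition A_spectrum ::
  "operator_kind \<Rightarrow> 'a::euclidean_space set \<Rightarrow> ('a \<Rightarrow> complex) \<Rightarrow> complex set" where
  "A_spectrum k D m = spectrum_on (L2_sum D) (B_dom D) (A_op k D m)"

definition A_resolvent ::
  "operator_kind \<Rightarrow> 'a::euclidean_space set \<Rightarrow> ('a \<Rightarrow> complex) \<Rightarrow> complex \<Rightarrow>
     'a L2 \<times> 'a L2 \<Rightarrow> 'a L2 \<times> 'a L2" where
  "A_resolvent k D m = resolvent (L2_sum D) (B_dom D) (A_op k D m)"

definition spectral_projection ::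
  "operator_kind \<Rightarrow> 'a::euclidean_space set \<Rightarrow> real \<Rightarrow> real \<Rightarrow> (real \<Rightarrow> complex) \<Rightarrow>
     ('a \<Rightarrow> complex) \<Rightarrow> 'a L2 \<times> 'a L2 \<Rightarrow> 'a L2 \<times> 'a L2" where
  "spectral_projection k D a b \<gamma> m = (\<lambda>x\<in>L2_sum D.
     (1 / (2 * complex_of_real pi * \<i>)) *\<^sub>C
       curve_integral (L2_sum D) (H20_sum D) (H20_sum_norm D) a b \<gamma> (A_resolvent k D m) x)"

definition spectral_projection_defined ::
  "operator_kind \<Rightarrow> 'a::euclidean_space set \<Rightarrow> real \<Rightarrow> real \<Rightarrow> (real \<Rightarrow> complex) \<Rightarrow>
     ('a \<Rightarrow> complex) \<Rightarrow> bool" where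
  "spectral_projection_defined k D a b \<gamma> m \<longleftrightarrow>
     A_op_defined k D m \<and> \<gamma> ` {a..b} \<inter> A_spectrum k D m = {} \<and>
     (\<exists>J. has_curve_integral (L2_sum D) (H20_sum D) (H20_sum_norm D) a b \<gamma> (A_resolvent k D m) J)"

end

theory Submission
  imports Defs
begin

text \<open>Equality \<open>(A\<^sub>p - z) x = y\<close> means \<open>(B\<^sub>p - z C\<^sub>p) x = C\<^sub>p y\<close> with \<open>C\<^sub>p = 1\<close> or \<open>C\<^sub>p = I\<^sub>p\<close>, and the
  operators \<open>B\<^sub>p - z C\<^sub>p\<close> for different \<open>(p, z)\<close> differ by bounded operators on \<open>L\<^sup>2\<close> whose norm is controlled
  by the distance of the parameters. By Banach's fixed point theorem and compactness of the curve, they are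
  therefore invertible with a uniform bound for \<open>z\<close> on the curve and \<open>p\<close> near \<open>m\<close>. The first component of the
  equation gives \<open>\<Delta> u\<close> in terms of \<open>u\<close>, \<open>v\<close> and the right-hand side, which upgrades the bound to the norm of
  \<open>H\<^sup>2\<^sub>0 \<oplus> L\<^sup>2\<close>; in that norm the resolvent is Lipschitz in \<open>(p, z)\<close>, and integration over the curve
  preserves this.\<close>

subsection \<open>The Hilbert space \<open>L\<^sup>2\<close>\<close>

text \<open>Two obstacles shape the development. First, \<open>lap\<close> is a definite
  description, so it means something only once distributional Laplacians are unique; this needs the
  fundamental lemma of the calculus of variations and hence a supply of explicit bump functions.
  Green's identity then places the test functions in the domain of \<open>lap\<close>, which makes
  \<open>H20 D\<close> a linear space, closed in its graph norm. Second, operators form a set with a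
  real-valued \<open>op_norm\<close> and not a Banach space type, so there is no integral of
  operators to start from. For each \<open>y\<close> the integral is formed in the Banach space of
  triples \<open>(u, lap D u, v)\<close> and pulled back through the closed image of
  \<open>graph_embed\<close>; an error bound that depends only on the oscillation of the integrand
  is uniform for \<open>y\<close> in the unit ball, and this gives convergence in
  \<open>op_norm\<close>. Passing to the pencil has its own reason: it removes the inverse of
  \<open>I_op\<close>, and its dependence on the function and on the spectral parameter is
  polynomial with bounded coefficients, while the domain \<open>B_dom D\<close> stays fixed.\<close>

lemma rep_L2_in_L2_fun: "rep_L2 f \<in> L2_fun"
  using Quotient3_rep_reflp[OF Quotient3_L2, of f] by (simp add: L2_rel_def)

lemma rep_L2_measurable [measurable]: "rep_L2 f \<in> borel_measurable lebesgue"
  using rep_L2_in_L2_fun[of f] by (simp add: L2_fun_def)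

lemma rep_L2_square_integrable: "integrable lebesgue (\<lambda>x. (cmod (rep_L2 f x))\<^sup>2)"
  using rep_L2_in_L2_fun[of f] by (simp add: L2_fun_def)

lemma rep_abs_L2: "f \<in> L2_fun \<Longrightarrow> AE x in lebesgue. rep_L2 (abs_L2 f) x = f x"
  using Quotient3_rep_abs[OF Quotient3_L2, of f] by (simp add: L2_rel_def)

lemma abs_rep_L2: "abs_L2 (rep_L2 f) = f"
  using Quotient3_abs_rep[OF Quotient3_L2] .

lemma abs_L2_cong:
  assumes "f \<in> L2_fun" "g \<in> L2_fun" "AE x in lebesgue. f x = g x"
  shows "abs_L2 f = abs_L2 g"
  using Quotient3_rel_abs[OF Quotient3_L2, of f g] assms by (simp add: L2_rel_def)

lemma L2_eqI: "AE x in lebesgue. rep_L2 f x = rep_L2 g x \<Longrightarrow> f = g"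
  using abs_L2_cong[OF rep_L2_in_L2_fun rep_L2_in_L2_fun, of f g] by (simp add: abs_rep_L2)

lemma abs_L2_zero: "abs_L2 (\<lambda>_. 0) = 0"
  by (simp add: zero_L2_def)

lemma abs_L2_add:
  assumes "f \<in> L2_fun" "g \<in> L2_fun"
  shows "abs_L2 (\<lambda>x. f x + g x) = abs_L2 f + abs_L2 g"
  using assms by (simp add: plus_L2.abs_eq L2_rel_def)

lemma abs_L2_scaleC: "f \<in> L2_fun \<Longrightarrow> abs_L2 (\<lambda>x. c * f x) = c *\<^sub>C abs_L2 f"
  by (simp add: scaleC_L2.abs_eq L2_rel_def)

lemma rep_L2_zero: "AE x in lebesgue. rep_L2 0 x = 0"
  using rep_abs_L2[OF L2_fun_zero] by (simp add: abs_L2_zero)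

lemma rep_L2_add: "AE x in lebesgue. rep_L2 (f + g) x = rep_L2 f x + rep_L2 g x"
  using rep_abs_L2[OF L2_fun_add[OF rep_L2_in_L2_fun rep_L2_in_L2_fun], of f g]
  by (simp add: abs_L2_add rep_L2_in_L2_fun abs_rep_L2)

lemma rep_L2_scaleC: "AE x in lebesgue. rep_L2 (c *\<^sub>C f) x = c * rep_L2 f x"
  using rep_abs_L2[OF L2_fun_cmult[OF rep_L2_in_L2_fun], of c f]
  by (simp add: abs_L2_scaleC rep_L2_in_L2_fun abs_rep_L2)

lemma rep_L2_diff: "AE x in lebesgue. rep_L2 (f - g) x = rep_L2 f x - rep_L2 g x"
  using rep_L2_add[of f "- g"] rep_L2_scaleC[of "- 1" g]
  by (simp add: minus_L2_def uminus_L2_def) (auto elim: eventually_elim2)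

lemma rep_L2_sum: "AE x in lebesgue. rep_L2 (\<Sum>i\<in>I. f i) x = (\<Sum>i\<in>I. rep_L2 (f i) x)"
proof (induction I rule: infinite_finite_induct)
  case (insert i I)
  then show ?case
    using rep_L2_add[of "f i" "\<Sum>i\<in>I. f i"] by (auto elim: eventually_elim2)
qed (auto simp: rep_L2_zero)

lemma power2_norm_L2: "(norm f)\<^sup>2 = (\<integral>x. (cmod (rep_L2 f x))\<^sup>2 \<partial>lebesgue)"
proof -
  have "(norm f)\<^sup>2 = Re (\<integral>x. rep_L2 f x * cnj (rep_L2 f x) \<partial>lebesgue)"
    by (simp add: power2_norm_eq_inner inner_L2.rep_eq)
  then show ?thesis
    unfolding complex_norm_square[symmetric] integral_complex_of_real by simp
qed

lemma nn_integral_norm_L2: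
  "(\<integral>\<^sup>+x. ennreal ((cmod (rep_L2 f x))\<^sup>2) \<partial>lebesgue) = ennreal ((norm f)\<^sup>2)"
  by (simp add: power2_norm_L2 nn_integral_eq_integral[OF rep_L2_square_integrable])

text \<open>The two parent classes relate the norm to real scalars only, so compatibility with
  complex scalars is imposed separately. Products inherit it, which covers pairs and the triples of
  the graph embedding.\<close>

class complex_normed_vector = complex_vector + real_normed_vector +
  assumes norm_scaleC: "norm (c *\<^sub>C x) = cmod c * norm x"

instance L2 :: (euclidean_space) complex_normed_vector
proof
  fix c :: complex and f :: "'a L2"
  have "(norm (c *\<^sub>C f))\<^sup>2 = (\<integral>x. (cmod (c * rep_L2 f x))\<^sup>2 \<partial>lebesgue)"
    unfolding power2_norm_L2
    using rep_L2_scaleC[of c f] by (intro integral_cong_AE) (auto elim: eventually_mono)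
  also have "\<dots> = (cmod c * norm f)\<^sup>2"
    by (simp add: norm_mult power_mult_distrib power2_norm_L2)
  finally show "norm (c *\<^sub>C f) = cmod c * norm f"
    by (rule power2_eq_imp_eq) auto
qed

instance prod :: (complex_normed_vector, complex_normed_vector) complex_normed_vector
proof
  fix c :: complex and p :: "'a \<times> 'b"
  have "norm (c *\<^sub>C p) = sqrt ((cmod c)\<^sup>2 * ((norm (fst p))\<^sup>2 + (norm (snd p))\<^sup>2))"
    by (simp add: norm_prod_def scaleC_prod_def norm_scaleC power_mult_distrib distrib_left)
  then show "norm (c *\<^sub>C p) = cmod c * norm p"
    by (simp add: norm_prod_def real_sqrt_mult)
qed

section \<open>Algebra of complex scalar multiplication\<close>

lemma scaleC_zero_right [simp]: "c *\<^sub>C (0::'a::complex_vector) = 0"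
  using scaleC_add_right[of c "0::'a" 0] by simp

lemma scaleC_zero_left [simp]: "0 *\<^sub>C (x::'a::complex_vector) = 0"
  using scaleC_add_left[of 0 0 x] by simp

lemma scaleC_minus_right: "c *\<^sub>C (- x) = - (c *\<^sub>C x)" for x :: "'a::complex_vector"
  using scaleC_add_right[of c x "- x"] by (simp add: eq_neg_iff_add_eq_0 add.commute)

lemma scaleC_minus_left: "(- c) *\<^sub>C x = - (c *\<^sub>C x)" for x :: "'a::complex_vector"
  using scaleC_add_left[of c "- c" x] by (simp add: eq_neg_iff_add_eq_0 add.commute)

lemma scaleC_diff_right: "c *\<^sub>C (x - y) = c *\<^sub>C x - c *\<^sub>C y" for x y :: "'a::complex_vector"
  using scaleC_add_right[of c x "- y"] by (simp add: scaleC_minus_right)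

lemma scaleC_diff_left: "(c - d) *\<^sub>C x = c *\<^sub>C x - d *\<^sub>C x" for x :: "'a::complex_vector"
  using scaleC_add_left[of c "- d" x] by (simp add: scaleC_minus_left)

lemma scaleC_sum_right: "c *\<^sub>C (\<Sum>i\<in>I. f i) = (\<Sum>i\<in>I. c *\<^sub>C f i)"
  for f :: "'i \<Rightarrow> 'a::complex_vector"
  by (induction I rule: infinite_finite_induct) (auto simp: scaleC_add_right)

lemma scaleC_sum_left: "(\<Sum>i\<in>I. c i) *\<^sub>C x = (\<Sum>i\<in>I. c i *\<^sub>C x)"
  for x :: "'a::complex_vector"
  by (induction I rule: infinite_finite_induct) (auto simp: scaleC_add_left)

lemma tendsto_scaleC:
  fixes f :: "'i \<Rightarrow> 'a::complex_normed_vector"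
  assumes "(f \<longlongrightarrow> l) F"
  shows "((\<lambda>x. c *\<^sub>C f x) \<longlongrightarrow> c *\<^sub>C l) F"
proof -
  have "((\<lambda>x. cmod c * norm (f x - l)) \<longlongrightarrow> cmod c * 0) F"
    using assms by (intro tendsto_mult_left) (simp add: tendsto_norm_zero_iff LIM_zero_iff)
  then have "((\<lambda>x. norm (c *\<^sub>C f x - c *\<^sub>C l)) \<longlongrightarrow> 0) F"
    by (simp add: norm_scaleC flip: scaleC_diff_right)
  then show ?thesis
    by (simp add: tendsto_norm_zero_iff LIM_zero_iff)
qed

text \<open>The partial sums of \<open>\<Sum> |f (n + 1) - f n|\<close> are bounded in \<open>L\<^sup>2\<close>, so by monotone convergence
  the series converges almost everywhere.\<close>

lemma AE_convergent_of_summable_norm_diff: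
  fixes f :: "nat \<Rightarrow> 'a::euclidean_space L2"
  assumes "summable (\<lambda>n. norm (f (Suc n) - f n))"
  shows "AE x in lebesgue. convergent (\<lambda>n. rep_L2 (f n) x)"
proof -
  define d where "d n x = cmod (rep_L2 (f (Suc n) - f n) x)" for n x
  have [measurable]: "d n \<in> borel_measurable lebesgue" for n
    unfolding d_def by measurable
  have d_L2: "(\<lambda>x. complex_of_real (d n x)) \<in> L2_fun" for n
    using rep_L2_square_integrable[of "f (Suc n) - f n"] by (simp add: L2_fun_def d_def)
  \<comment> \<open>The moduli are lifted back to \<open>L2\<close>, so that the triangle inequality
    for \<open>norm\<close> serves as Minkowski's inequality for their partial sums.\<close>
  define g where "g n = abs_L2 (\<lambda>x. complex_of_real (d n x))" for n
  have rep_g: "AE x in lebesgue. rep_L2 (g n) x = complex_of_real (d n x)" for n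
    unfolding g_def by (rule rep_abs_L2[OF d_L2])
  have "(norm (g n))\<^sup>2 = (norm (f (Suc n) - f n))\<^sup>2" for n
    unfolding power2_norm_L2 using rep_g[of n]
    by (intro integral_cong_AE) (auto elim!: eventually_mono simp: d_def)
  then have norm_g: "norm (g n) = norm (f (Suc n) - f n)" for n
    by (simp add: power2_eq_iff_nonneg)
  define C where "C = (\<Sum>n. norm (f (Suc n) - f n))"
  have norm_sum_g: "norm (\<Sum>i<n. g i) \<le> C" for n
  proof -
    have "norm (\<Sum>i<n. g i) \<le> (\<Sum>i<n. norm (f (Suc i) - f i))"
      using norm_sum[of g "{..<n}"] by (simp add: norm_g)
    also have "\<dots> \<le> C"
      unfolding C_def by (intro sum_le_suminf assms) auto
    finally show ?thesis .
  qed
  define S where "S n x = ennreal ((\<Sum>i<n. d i x)\<^sup>2)" for n x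
  have S_le: "(\<integral>\<^sup>+x. S n x \<partial>lebesgue) \<le> ennreal (C\<^sup>2)" for n
  proof -
    have "AE x in lebesgue. \<forall>i. rep_L2 (g i) x = complex_of_real (d i x)"
      using rep_g by (simp add: AE_all_countable)
    then have "AE x in lebesgue. S n x = ennreal ((cmod (rep_L2 (\<Sum>i<n. g i) x))\<^sup>2)"
      using rep_L2_sum[of g "{..<n}"]
      by eventually_elim (simp add: S_def flip: of_real_sum)
    then have "(\<integral>\<^sup>+x. S n x \<partial>lebesgue) = ennreal ((norm (\<Sum>i<n. g i))\<^sup>2)"
      by (subst nn_integral_norm_L2[symmetric]) (rule nn_integral_cong_AE)
    also have "\<dots> \<le> ennreal (C\<^sup>2)"
      using norm_sum_g by (intro ennreal_leI power_mono) auto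
    finally show ?thesis .
  qed
  have d_nonneg: "0 \<le> d n x" for n x
    by (simp add: d_def)
  have [measurable]: "S n \<in> borel_measurable lebesgue" for n
    unfolding S_def by measurable
  have "incseq S"
    unfolding S_def by (intro incseq_SucI le_funI ennreal_leI power_mono sum_nonneg) (auto simp: d_nonneg)
  then have "(\<integral>\<^sup>+x. (SUP n. S n x) \<partial>lebesgue) = (SUP n. \<integral>\<^sup>+x. S n x \<partial>lebesgue)"
    by (intro nn_integral_monotone_convergence_SUP) auto
  also have "\<dots> \<le> ennreal (C\<^sup>2)"
    by (intro SUP_least S_le)
  finally have "(\<integral>\<^sup>+x. (SUP n. S n x) \<partial>lebesgue) \<noteq> \<infinity>"
    by (auto simp: top_unique)
  then have "AE x in lebesgue. (SUP n. S n x) \<noteq> \<infinity>"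
    by (intro nn_integral_PInf_AE) auto
  moreover have "AE x in lebesgue. \<forall>n. rep_L2 (f (Suc n) - f n) x = rep_L2 (f (Suc n)) x - rep_L2 (f n) x"
    by (simp add: AE_all_countable rep_L2_diff)
  ultimately show ?thesis
  proof eventually_elim
    case (elim x)
    then obtain B where B: "0 \<le> B" "(SUP n. S n x) = ennreal B"
      by (cases "SUP n. S n x") auto
    have "(\<Sum>i<n. d i x) \<le> sqrt B" for n
    proof -
      have "S n x \<le> ennreal B"
        unfolding B(2)[symmetric] by (rule SUP_upper) simp
      then have "(\<Sum>i<n. d i x)\<^sup>2 \<le> B"
        using B(1) by (simp add: S_def)
      then show ?thesis
        by (rule real_le_rsqrt)
    qed
    then have "summable (\<lambda>i. d i x)"
      by (intro summableI_nonneg_bounded[where x = "sqrt B"]) (auto simp: d_nonneg)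
    then have "summable (\<lambda>i. rep_L2 (f (Suc i)) x - rep_L2 (f i) x)"
      using elim(2) by (simp add: summable_norm_cancel d_def)
    then have "convergent (\<lambda>n. (\<Sum>i<n. rep_L2 (f (Suc i)) x - rep_L2 (f i) x) + rep_L2 (f 0) x)"
      by (intro convergent_add convergent_const) (simp only: summable_iff_convergent)
    then show ?case
      by (simp add: sum_lessThan_telescope[of "\<lambda>n. rep_L2 (f n) x"])
  qed
qed

text \<open>Riesz-Fischer. A rapidly convergent subsequence has a pointwise limit \<open>h\<close>
  almost everywhere. Fatou's lemma, applied to the subsequence minus a fixed \<open>X n\<close>,
  gives at once that \<open>h\<close> is square integrable and that the whole sequence converges to
  it.\<close>

instance L2 :: (euclidean_space) banach
proof
  fix X :: "nat \<Rightarrow> 'a L2"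
  assume X: "Cauchy X"
  have "\<exists>M. \<forall>m\<ge>M. \<forall>n\<ge>M. norm (X m - X n) < (1/2) ^ k" for k
    using X by (auto simp: Cauchy_def dist_norm)
  then obtain M where M: "\<And>k m n. m \<ge> M k \<Longrightarrow> n \<ge> M k \<Longrightarrow> norm (X m - X n) < (1/2) ^ k"
    by metis
  \<comment> \<open>Summing the \<open>M i\<close> gives \<open>M k \<le> r k\<close>, and the
    summand \<open>k\<close> makes \<open>r\<close> strictly increasing.\<close>
  define r where "r k = (\<Sum>i\<le>k. M i) + k" for k
  have r_M: "M k \<le> r k" for k
    unfolding r_def by (rule order_trans[OF member_le_sum[of k "{..k}" M]]) auto
  have r_Suc: "r k < r (Suc k)" for k
    by (simp add: r_def)
  then have r: "strict_mono r"
    by (rule strict_monoI_Suc)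
  define f where "f k = X (r k)" for k
  have "norm (f (Suc k) - f k) \<le> (1/2) ^ k" for k
    unfolding f_def using M[of k "r (Suc k)" "r k"] r_M[of k] r_Suc[of k] by simp
  then have "summable (\<lambda>k. norm (f (Suc k) - f k))"
    by (intro summable_comparison_test'[OF summable_geometric[of "1/2::real"]]) auto
  note AE_conv = AE_convergent_of_summable_norm_diff[OF this]
  \<comment> \<open>\<open>lim\<close> is total; its value matters only off the null set where the
    subsequence diverges.\<close>
  define h where "h x = lim (\<lambda>n. rep_L2 (f n) x)" for x
  have [measurable]: "h \<in> borel_measurable lebesgue"
    unfolding h_def by measurable
  have close: "(\<integral>\<^sup>+x. ennreal ((cmod (h x - rep_L2 (X n) x))\<^sup>2) \<partial>lebesgue) \<le> ennreal (((1/2) ^ k)\<^sup>2)"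
    if n: "n \<ge> M k" for n k
  proof -
    have "AE x in lebesgue. \<forall>j. rep_L2 (f j - X n) x = rep_L2 (f j) x - rep_L2 (X n) x"
      by (simp add: AE_all_countable rep_L2_diff)
    with AE_conv have "AE x in lebesgue. ennreal ((cmod (h x - rep_L2 (X n) x))\<^sup>2)
        = liminf (\<lambda>j. ennreal ((cmod (rep_L2 (f j - X n) x))\<^sup>2))"
    proof eventually_elim
      case (elim x)
      have "(\<lambda>j. ennreal ((cmod (rep_L2 (f j) x - rep_L2 (X n) x))\<^sup>2))
          \<longlonglongrightarrow> ennreal ((cmod (h x - rep_L2 (X n) x))\<^sup>2)"
        using elim(1) unfolding h_def
        by (intro tendsto_ennrealI tendsto_power tendsto_norm tendsto_diff tendsto_const)
          (simp add: convergent_LIMSEQ_iff)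
      then show ?case
        unfolding elim(2)[rule_format] by (intro lim_imp_Liminf[symmetric]) auto
    qed
    then have "(\<integral>\<^sup>+x. ennreal ((cmod (h x - rep_L2 (X n) x))\<^sup>2) \<partial>lebesgue)
        = (\<integral>\<^sup>+x. liminf (\<lambda>j. ennreal ((cmod (rep_L2 (f j - X n) x))\<^sup>2)) \<partial>lebesgue)"
      by (rule nn_integral_cong_AE)
    also have "\<dots> \<le> liminf (\<lambda>j. \<integral>\<^sup>+x. ennreal ((cmod (rep_L2 (f j - X n) x))\<^sup>2) \<partial>lebesgue)"
      by (intro nn_integral_liminf) measurable
    also have "\<dots> = liminf (\<lambda>j. ennreal ((norm (f j - X n))\<^sup>2))"
      by (simp add: nn_integral_norm_L2)
    also have "\<dots> \<le> limsup (\<lambda>j. ennreal ((norm (f j - X n))\<^sup>2))"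
      by (intro Liminf_le_Limsup) auto
    also have "\<dots> \<le> ennreal (((1/2) ^ k)\<^sup>2)"
    proof (intro Limsup_bounded)
      have "ennreal ((norm (f j - X n))\<^sup>2) \<le> ennreal (((1/2) ^ k)\<^sup>2)" if "j \<ge> k" for j
      proof -
        have "M k \<le> r j"
          using r_M[of k] strict_mono_mono[OF r] that by (meson monoD order_trans)
        then show ?thesis
          using M[of k "r j" n] n by (intro ennreal_leI power_mono) (auto simp: f_def)
      qed
      then show "\<forall>\<^sub>F j in sequentially. ennreal ((norm (f j - X n))\<^sup>2) \<le> ennreal (((1/2) ^ k)\<^sup>2)"
        by (rule eventually_sequentiallyI)
    qed
    finally show ?thesis .
  qed
  have diff_L2: "(\<lambda>x. h x - rep_L2 (X n) x) \<in> L2_fun" if "n \<ge> M k" for n k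
    using close[OF that] unfolding L2_fun_def
    by (auto intro!: integrableI_bounded simp: top_unique less_top[symmetric])
  have h_L2: "h \<in> L2_fun"
    using L2_fun_add[OF diff_L2[of 0 "M 0"] rep_L2_in_L2_fun[of "X (M 0)"]] by simp
  have "norm (X n - abs_L2 h) \<le> (1/2) ^ k" if "n \<ge> M k" for n k
  proof -
    have "AE x in lebesgue. ennreal ((cmod (rep_L2 (abs_L2 h - X n) x))\<^sup>2)
        = ennreal ((cmod (h x - rep_L2 (X n) x))\<^sup>2)"
      using rep_L2_diff[of "abs_L2 h" "X n"] rep_abs_L2[OF h_L2] by eventually_elim simp
    then have "ennreal ((norm (abs_L2 h - X n))\<^sup>2) \<le> ennreal (((1/2) ^ k)\<^sup>2)"
      using close[OF that] unfolding nn_integral_norm_L2[symmetric] by (simp only: nn_integral_cong_AE)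
    then have "(norm (abs_L2 h - X n))\<^sup>2 \<le> ((1/2) ^ k)\<^sup>2"
      by (simp add: ennreal_le_iff)
    then have "norm (abs_L2 h - X n) \<le> (1/2) ^ k"
      by (rule power2_le_imp_le) simp
    then show ?thesis
      by (simp add: norm_minus_commute)
  qed
  note X_close = this
  have "X \<longlonglongrightarrow> abs_L2 h"
  proof (rule metric_LIMSEQ_I)
    fix e :: real
    assume "0 < e"
    then obtain k where "(1/2::real) ^ k < e"
      using real_arch_pow_inv[of e "1/2"] by auto
    then show "\<exists>N. \<forall>n\<ge>N. dist (X n) (abs_L2 h) < e"
      using X_close[where k = k] by (intro exI[of _ "M k"]) (fastforce simp: dist_norm)
  qed
  then show "convergent X"
    by (rule convergentI)
qed

section \<open>The bilinear pairing with a square integrable function\<close>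

lemma cnj_L2_fun: "g \<in> L2_fun \<Longrightarrow> (\<lambda>x. cnj (g x)) \<in> L2_fun"
  unfolding L2_fun_def
  by (auto intro!: borel_measurable_continuous_on[where f = cnj] continuous_intros)

text \<open>The type class provides only the real part of the inner product. The imaginary part of a
  number \<open>w\<close> is the real part of \<open>- \<i> * w\<close>, so a second inner product
  with a rotated argument recovers it. Additivity and continuity of the pairing then come from those
  of \<open>inner\<close>.\<close>

lemma L2_pairing_eq:
  assumes g: "g \<in> L2_fun"
  shows "(\<integral>x. rep_L2 v x * g x \<partial>lebesgue)
    = Complex (inner v (abs_L2 (\<lambda>x. cnj (g x)))) (inner ((- \<i>) *\<^sub>C v) (abs_L2 (\<lambda>x. cnj (g x))))"
proof -
  define h where "h = abs_L2 (\<lambda>x. cnj (g x))"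
  have h: "AE x in lebesgue. rep_L2 h x = cnj (g x)"
    unfolding h_def by (rule rep_abs_L2[OF cnj_L2_fun[OF g]])
  have [measurable]: "g \<in> borel_measurable lebesgue"
    using g by (simp add: L2_fun_def)
  have 1: "inner (c *\<^sub>C v) h = Re (\<integral>x. c * (rep_L2 v x * g x) \<partial>lebesgue)" for c
  proof -
    have "(\<integral>x. rep_L2 (c *\<^sub>C v) x * cnj (rep_L2 h x) \<partial>lebesgue)
        = (\<integral>x. c * (rep_L2 v x * g x) \<partial>lebesgue)"
    proof (rule integral_cong_AE)
      show "AE x in lebesgue. rep_L2 (c *\<^sub>C v) x * cnj (rep_L2 h x) = c * (rep_L2 v x * g x)"
        using h rep_L2_scaleC[of c v] by eventually_elim (simp add: mult.assoc)
      show "(\<lambda>x. rep_L2 (c *\<^sub>C v) x * cnj (rep_L2 h x)) \<in> borel_measurable lebesgue"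
        by (rule borel_measurable_integrable[OF L2_fun_mult_cnj_integrable]) (rule rep_L2_in_L2_fun)+
    qed measurable
    then show ?thesis
      by (simp add: inner_L2.rep_eq)
  qed
  show ?thesis
    using 1[of 1] 1[of "- \<i>"] by (simp add: h_def[symmetric] scaleC_one complex_eq_iff)
qed

lemma L2_pairing_add:
  assumes "g \<in> L2_fun"
  shows "(\<integral>x. rep_L2 (v + w) x * g x \<partial>lebesgue)
    = (\<integral>x. rep_L2 v x * g x \<partial>lebesgue) + (\<integral>x. rep_L2 w x * g x \<partial>lebesgue)"
  using assms by (simp add: L2_pairing_eq complex_eq_iff inner_add_left scaleC_add_right)

lemma L2_pairing_scaleC:
  assumes "g \<in> L2_fun"
  shows "(\<integral>x. rep_L2 (c *\<^sub>C v) x * g x \<partial>lebesgue) = c * (\<integral>x. rep_L2 v x * g x \<partial>lebesgue)"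
proof -
  have "(\<integral>x. rep_L2 (c *\<^sub>C v) x * g x \<partial>lebesgue) = (\<integral>x. c * (rep_L2 v x * g x) \<partial>lebesgue)"
    using assms rep_L2_scaleC[of c v] unfolding L2_fun_def
    by (intro integral_cong_AE) (auto elim!: eventually_mono)
  then show ?thesis
    by simp
qed

lemma tendsto_L2_pairing:
  assumes "g \<in> L2_fun" "(v \<longlongrightarrow> w) F"
  shows "((\<lambda>n. \<integral>x. rep_L2 (v n) x * g x \<partial>lebesgue) \<longlongrightarrow> (\<integral>x. rep_L2 w x * g x \<partial>lebesgue)) F"
  unfolding L2_pairing_eq[OF assms(1)]
  by (intro tendsto_Complex tendsto_inner tendsto_scaleC tendsto_const assms(2))

lemma L2_pairing_abs:
  assumes "f \<in> L2_fun" "g \<in> L2_fun"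
  shows "(\<integral>x. rep_L2 (abs_L2 f) x * g x \<partial>lebesgue) = (\<integral>x. f x * g x \<partial>lebesgue)"
  using assms rep_abs_L2[OF assms(1)] unfolding L2_fun_def
  by (intro integral_cong_AE) (auto elim!: eventually_mono)

section \<open>The subspace \<open>L2_on D\<close> and multiplication operators\<close>

lemma L2_on_zero: "0 \<in> L2_on D"
  using rep_L2_zero by (auto simp: L2_on_def elim: eventually_mono)

lemma L2_on_add:
  assumes "f \<in> L2_on D" "g \<in> L2_on D"
  shows "f + g \<in> L2_on D"
  using assms[unfolded L2_on_def mem_Collect_eq] rep_L2_add[of f g]
  unfolding L2_on_def mem_Collect_eq by eventually_elim auto

lemma L2_on_scaleC:
  assumes "f \<in> L2_on D"
  shows "c *\<^sub>C f \<in> L2_on D"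
  using assms[unfolded L2_on_def mem_Collect_eq] rep_L2_scaleC[of c f]
  unfolding L2_on_def mem_Collect_eq by eventually_elim auto

lemma L2_on_diff: "f \<in> L2_on D \<Longrightarrow> g \<in> L2_on D \<Longrightarrow> f - g \<in> L2_on D"
  using L2_on_add[of f D "(- 1) *\<^sub>C g"] L2_on_scaleC[of g D "- 1"]
  by (simp add: minus_L2_def uminus_L2_def)

text \<open>A real bound in place of the extended real \<open>Linf_norm\<close>, so that it can
  enter arithmetic directly. The sign condition is imposed because the almost everywhere bound says
  nothing when \<open>D\<close> is a null set.\<close>

definition ess_bound :: "'a::euclidean_space set \<Rightarrow> ('a \<Rightarrow> complex) \<Rightarrow> real \<Rightarrow> bool" where
  "ess_bound D m M \<longleftrightarrow> m \<in> borel_measurable (lebesgue_on D) \<and> 0 \<le> M \<and>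
     (AE x in lebesgue_on D. cmod (m x) \<le> M)"

lemma ess_bound_const: "ess_bound D (\<lambda>_. c) (cmod c)"
  by (simp add: ess_bound_def)

lemma ess_bound_add:
  assumes "ess_bound D p P" "ess_bound D q Q"
  shows "ess_bound D (\<lambda>x. p x + q x) (P + Q)"
proof -
  have "AE x in lebesgue_on D. cmod (p x) \<le> P" "AE x in lebesgue_on D. cmod (q x) \<le> Q"
    using assms by (auto simp: ess_bound_def)
  then have "AE x in lebesgue_on D. cmod (p x + q x) \<le> P + Q"
    by eventually_elim (rule norm_triangle_mono)
  then show ?thesis
    using assms by (auto simp: ess_bound_def)
qed

lemma ess_bound_mono: "ess_bound D m M \<Longrightarrow> M \<le> N \<Longrightarrow> ess_bound D m N"
  unfolding ess_bound_def by (auto elim: eventually_mono)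

lemma Linf_norm_less_ess_bound:
  assumes "m \<in> borel_measurable (lebesgue_on D)" "Linf_norm D m < ereal M"
  shows "ess_bound D m (max 0 M)"
proof -
  have "AE x in lebesgue_on D. ereal (cmod (m x)) \<le> Linf_norm D m"
    unfolding Linf_norm_def by (rule esssup_AE)
  then have "AE x in lebesgue_on D. cmod (m x) \<le> max 0 M"
    using assms(2) by (auto elim!: eventually_mono dest: order.strict_trans1)
  then show ?thesis
    using assms(1) by (simp add: ess_bound_def)
qed

lemma Linf_ess_bound:
  assumes "m \<in> Linf D"
  obtains M where "ess_bound D m M"
proof -
  obtain M where "Linf_norm D m < ereal M"
    using assms less_PInf_Ex_of_nat[of "Linf_norm D m"] by (auto simp: Linf_def)
  then show ?thesis
    using that Linf_norm_less_ess_bound[of m D M] assms by (auto simp: Linf_def)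
qed

context
  fixes D :: "'a::euclidean_space set"
  assumes D: "D \<in> sets lebesgue"
begin

lemma ess_bound_AE: "ess_bound D m M \<Longrightarrow> AE x in lebesgue. x \<in> D \<longrightarrow> cmod (m x) \<le> M"
  using D by (auto simp: ess_bound_def AE_restrict_space_iff)

lemma mult_fun_L2:
  assumes m: "ess_bound D m M" and f: "f \<in> L2_fun"
  shows "(\<lambda>x. if x \<in> D then m x * f x else 0) \<in> L2_fun" (is "?g \<in> _")
proof -
  have "m \<in> borel_measurable (lebesgue_on D)" "f \<in> borel_measurable (lebesgue_on D)"
    using m f by (auto simp: ess_bound_def L2_fun_def intro: measurable_restrict_space1)
  then have [measurable]: "?g \<in> borel_measurable lebesgue"
    using borel_measurable_if[OF D, of "\<lambda>x. m x * f x"] by simp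
  have "integrable lebesgue (\<lambda>x. M\<^sup>2 * (cmod (f x))\<^sup>2)"
    using f by (simp add: L2_fun_def)
  then have "integrable lebesgue (\<lambda>x. (cmod (?g x))\<^sup>2)"
  proof (rule Bochner_Integration.integrable_bound)
    show "AE x in lebesgue. norm ((cmod (?g x))\<^sup>2) \<le> norm (M\<^sup>2 * (cmod (f x))\<^sup>2)"
      using ess_bound_AE[OF m]
      by eventually_elim (auto simp: norm_mult power_mult_distrib intro!: mult_right_mono power_mono)
  qed measurable
  then show ?thesis
    by (simp add: L2_fun_def)
qed

lemma rep_mult_L2:
  assumes "ess_bound D m M"
  shows "AE x in lebesgue. rep_L2 (mult_L2 D m f) x = (if x \<in> D then m x * rep_L2 f x else 0)"
  unfolding mult_L2_def by (rule rep_abs_L2[OF mult_fun_L2[OF assms rep_L2_in_L2_fun]])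

lemma mult_L2_in_L2_on: "ess_bound D m M \<Longrightarrow> mult_L2 D m f \<in> L2_on D"
  unfolding L2_on_def using rep_mult_L2[of m M f] by (auto elim: eventually_mono)

lemma norm_mult_L2:
  assumes m: "ess_bound D m M"
  shows "norm (mult_L2 D m f) \<le> M * norm f"
proof -
  have "0 \<le> M"
    using m by (simp add: ess_bound_def)
  have "(norm (mult_L2 D m f))\<^sup>2 \<le> (\<integral>x. M\<^sup>2 * (cmod (rep_L2 f x))\<^sup>2 \<partial>lebesgue)"
    unfolding power2_norm_L2
  proof (rule integral_mono_AE)
    show "AE x in lebesgue. (cmod (rep_L2 (mult_L2 D m f) x))\<^sup>2 \<le> M\<^sup>2 * (cmod (rep_L2 f x))\<^sup>2"
      using ess_bound_AE[OF m] rep_mult_L2[OF m, of f]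
      by eventually_elim (auto simp: norm_mult power_mult_distrib intro!: mult_right_mono power_mono)
  qed (auto intro: rep_L2_square_integrable)
  also have "\<dots> = (M * norm f)\<^sup>2"
    by (simp add: power2_norm_L2 power_mult_distrib)
  finally show ?thesis
    by (rule power2_le_imp_le) (simp add: \<open>0 \<le> M\<close>)
qed

lemma mult_L2_add:
  assumes m: "ess_bound D m M"
  shows "mult_L2 D m (f + g) = mult_L2 D m f + mult_L2 D m g"
proof (rule L2_eqI)
  show "AE x in lebesgue. rep_L2 (mult_L2 D m (f + g)) x = rep_L2 (mult_L2 D m f + mult_L2 D m g) x"
    using rep_mult_L2[OF m, of f] rep_mult_L2[OF m, of g] rep_mult_L2[OF m, of "f + g"]
      rep_L2_add[of f g] rep_L2_add[of "mult_L2 D m f" "mult_L2 D m g"]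
    by eventually_elim (auto simp: distrib_left)
qed

lemma mult_L2_scaleC:
  assumes m: "ess_bound D m M"
  shows "mult_L2 D m (c *\<^sub>C f) = c *\<^sub>C mult_L2 D m f"
proof (rule L2_eqI)
  show "AE x in lebesgue. rep_L2 (mult_L2 D m (c *\<^sub>C f)) x = rep_L2 (c *\<^sub>C mult_L2 D m f) x"
    using rep_mult_L2[OF m, of f] rep_mult_L2[OF m, of "c *\<^sub>C f"]
      rep_L2_scaleC[of c f] rep_L2_scaleC[of c "mult_L2 D m f"]
    by eventually_elim auto
qed

lemma mult_L2_add_left:
  assumes p: "ess_bound D p P" and q: "ess_bound D q Q"
  shows "mult_L2 D (\<lambda>x. p x + q x) f = mult_L2 D p f + mult_L2 D q f"
proof (rule L2_eqI)
  show "AE x in lebesgue. rep_L2 (mult_L2 D (\<lambda>x. p x + q x) f) x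
      = rep_L2 (mult_L2 D p f + mult_L2 D q f) x"
    using rep_mult_L2[OF p, of f] rep_mult_L2[OF q, of f] rep_mult_L2[OF ess_bound_add[OF p q], of f]
      rep_L2_add[of "mult_L2 D p f" "mult_L2 D q f"]
    by eventually_elim (auto simp: distrib_right)
qed

lemma mult_L2_mult_L2_cancel:
  assumes p: "ess_bound D p P" and q: "ess_bound D q Q" and f: "f \<in> L2_on D"
    and pq: "AE x in lebesgue_on D. p x * q x = 1"
  shows "mult_L2 D p (mult_L2 D q f) = f"
proof (rule L2_eqI)
  have "AE x in lebesgue. x \<in> D \<longrightarrow> p x * q x = 1"
    using pq D by (simp add: AE_restrict_space_iff)
  moreover have "AE x in lebesgue. x \<notin> D \<longrightarrow> rep_L2 f x = 0"
    using f by (simp add: L2_on_def)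
  ultimately show "AE x in lebesgue. rep_L2 (mult_L2 D p (mult_L2 D q f)) x = rep_L2 f x"
    using rep_mult_L2[OF p, of "mult_L2 D q f"] rep_mult_L2[OF q, of f]
    by eventually_elim (auto simp flip: mult.assoc)
qed

lemma mult_L2_one:
  assumes "f \<in> L2_on D"
  shows "mult_L2 D (\<lambda>_. 1) f = f"
proof (rule L2_eqI)
  show "AE x in lebesgue. rep_L2 (mult_L2 D (\<lambda>_. 1) f) x = rep_L2 f x"
    using rep_mult_L2[OF ess_bound_const[of D 1], of f] assms[unfolded L2_on_def mem_Collect_eq]
    by eventually_elim auto
qed

text \<open>Multiplication by 1 on \<open>D\<close> and by 0 elsewhere is a bounded linear map with
  values in \<open>L2_on D\<close>, and it fixes every element of \<open>L2_on D\<close>; a limit of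
  fixed points is again one.\<close>

lemma closed_L2_on: "closed (L2_on D)"
  unfolding closed_sequential_limits
proof (intro allI impI, elim conjE)
  fix f and l :: "'a L2"
  assume f: "\<forall>n. f n \<in> L2_on D" "f \<longlonglongrightarrow> l"
  interpret m: bounded_linear "mult_L2 D (\<lambda>_. 1)"
    using norm_mult_L2[OF ess_bound_const[of D 1]]
    by (intro bounded_linear_intro[where K = 1])
      (simp_all add: mult_L2_add[OF ess_bound_const] mult_L2_scaleC[OF ess_bound_const] scaleR_L2_def)
  have "(\<lambda>n. mult_L2 D (\<lambda>_. 1) (f n)) \<longlonglongrightarrow> mult_L2 D (\<lambda>_. 1) l"
    by (rule m.tendsto[OF f(2)])
  then have "f \<longlonglongrightarrow> mult_L2 D (\<lambda>_. 1) l"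
    using f(1) by (simp add: mult_L2_one)
  then have "l = mult_L2 D (\<lambda>_. 1) l"
    by (rule LIMSEQ_unique[OF f(2)])
  then show "l \<in> L2_on D"
    using mult_L2_in_L2_on[OF ess_bound_const] by metis
qed

end

subsection \<open>Riemann--Stieltjes integrals of vector-valued functions\<close>

lemma is_partition_mono:
  assumes "is_partition a b n t" "i \<le> j" "j \<le> n"
  shows "t i \<le> t j"
  using assms(2,3)
proof (induction j rule: dec_induct)
  case (step j)
  then show ?case
    using assms(1) by (auto simp: is_partition_def intro: order_trans)
qed auto

lemma is_partition_bounds:
  assumes "is_partition a b n t" "i \<le> n"
  shows "a \<le> t i" "t i \<le> b"
  using is_partition_mono[OF assms(1), of 0 i] is_partition_mono[OF assms(1), of i n] assms
  by (auto simp: is_partition_def)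

text \<open>Bundles exactly the condition on partition, mesh and tags that occurs in
  \<open>has_curve_integral\<close>, so that vector and operator integrals range over the same
  sums.\<close>

definition fine_partition ::
  "real \<Rightarrow> real \<Rightarrow> real \<Rightarrow> nat \<Rightarrow> (nat \<Rightarrow> real) \<Rightarrow> (nat \<Rightarrow> real) \<Rightarrow> bool" where
  "fine_partition a b \<delta> n t s \<longleftrightarrow>
     is_partition a b n t \<and> (\<forall>i<n. t (Suc i) - t i < \<delta> \<and> s i \<in> {t i..t (Suc i)})"

lemma fine_partition_mono: "fine_partition a b \<delta> n t s \<Longrightarrow> \<delta> \<le> \<delta>' \<Longrightarrow> fine_partition a b \<delta>' n t s"
  by (auto simp: fine_partition_def)

lemma fine_partition_tag:
  assumes "fine_partition a b \<delta> n t s" "i < n"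
  shows "s i \<in> {a..b}"
proof -
  have "a \<le> t i" "t (Suc i) \<le> b"
    using assms is_partition_bounds[of a b n t] by (auto simp: fine_partition_def)
  then show ?thesis
    using assms by (force simp: fine_partition_def)
qed

lemma fine_partition_exists:
  assumes "a \<le> b" "0 < \<delta>"
  obtains n t s where "fine_partition a b \<delta> n t s"
proof -
  obtain n :: nat where n: "(b - a) / \<delta> < real n"
    using reals_Archimedean2 by blast
  have "0 \<le> (b - a) / \<delta>"
    using assms by simp
  with n have "0 < n"
    by (metis of_nat_0_less_iff order.strict_trans1)
  define t where "t i = a + real i * ((b - a) / real n)" for i
  have step: "t (Suc i) = t i + (b - a) / real n" for i
    by (simp add: t_def distrib_right add_divide_distrib)
  have "(b - a) / real n < \<delta>" "0 \<le> (b - a) / real n"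
    using n \<open>0 < n\<close> assms by (auto simp: field_simps)
  then have "fine_partition a b \<delta> n t t"
    using \<open>0 < n\<close> by (auto simp: fine_partition_def is_partition_def step) (auto simp: t_def)
  then show ?thesis
    by (rule that)
qed

text \<open>The total variation function of \<gamma> on \<open>[a, x]\<close> has this property, and
  the increments on the right telescope over a partition to \<open>v b - v a\<close>.\<close>

definition variation_majorant :: "real \<Rightarrow> real \<Rightarrow> (real \<Rightarrow> complex) \<Rightarrow> (real \<Rightarrow> real) \<Rightarrow> bool" where
  "variation_majorant a b \<gamma> v \<longleftrightarrow>
     (\<forall>c d. a \<le> c \<and> c \<le> d \<and> d \<le> b \<longrightarrow> cmod (\<gamma> d - \<gamma> c) \<le> v d - v c)"

text \<open>Take for \<open>v c\<close> the supremum of the polygon lengths over partitions of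
  \<open>[a, c]\<close>. Appending the point \<open>d\<close> to such a partition lengthens the
  polygon by \<open>cmod (\<gamma> d - \<gamma> c)\<close> and gives a partition of
  \<open>[a, d]\<close>.\<close>

lemma rectifiable_curve_variation_majorant:
  assumes "rectifiable_curve a b \<gamma>"
  obtains v where "variation_majorant a b \<gamma> v"
proof -
  define len where "len n t = (\<Sum>i<n. cmod (\<gamma> (t (Suc i)) - \<gamma> (t i)))" for n and t :: "nat \<Rightarrow> real"
  obtain L where L: "\<And>n t. is_partition a b n t \<Longrightarrow> len n t \<le> L"
    using assms by (auto simp: rectifiable_curve_def len_def)
  have extend: "is_partition a d (Suc n) (t(Suc n := d))"
      "len (Suc n) (t(Suc n := d)) = len n t + cmod (\<gamma> d - \<gamma> c)"
    if "is_partition a c n t" "c \<le> d" for c d n t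
    using that by (auto simp: is_partition_def less_Suc_eq len_def)
  define V where "V c = {len n t |n t. is_partition a c n t}" for c
  have V_ne: "V c \<noteq> {}" if "a \<le> c" for c
  proof -
    have "is_partition a c 1 (\<lambda>i. if i = 0 then a else c)"
      using that by (simp add: is_partition_def)
    then show ?thesis
      by (auto simp: V_def)
  qed
  \<comment> \<open>Appending \<open>b\<close> makes it a partition of \<open>[a, b]\<close>, so the
    bound for the whole curve applies to its initial pieces.\<close>
  have "len n t \<le> L" if "is_partition a c n t" "c \<le> b" for c n t
    using L[OF extend(1)[OF that]] extend(2)[OF that] norm_ge_zero[of "\<gamma> b - \<gamma> c"] by linarith
  then have V_bdd: "bdd_above (V c)" if "c \<le> b" for c
    using that by (intro bdd_aboveI[of _ L]) (auto simp: V_def)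
  have "variation_majorant a b \<gamma> (\<lambda>c. Sup (V c))"
    unfolding variation_majorant_def
  proof (intro allI impI)
    fix c d
    assume cd: "a \<le> c \<and> c \<le> d \<and> d \<le> b"
    have "Sup (V c) \<le> Sup (V d) - cmod (\<gamma> d - \<gamma> c)"
    proof (rule cSup_least[OF V_ne])
      fix x
      assume "x \<in> V c"
      then obtain n t where "x = len n t" "is_partition a c n t"
        by (auto simp: V_def)
      then have "x + cmod (\<gamma> d - \<gamma> c) \<in> V d"
        using extend[of c n t d] cd unfolding V_def by (metis (mono_tags, lifting) mem_Collect_eq)
      then have "x + cmod (\<gamma> d - \<gamma> c) \<le> Sup (V d)"
        using V_bdd cd by (intro cSup_upper) auto
      then show "x \<le> Sup (V d) - cmod (\<gamma> d - \<gamma> c)"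
        by simp
    qed (use cd in auto)
    then show "cmod (\<gamma> d - \<gamma> c) \<le> Sup (V d) - Sup (V c)"
      by simp
  qed
  then show ?thesis
    by (rule that)
qed

definition rs_sum ::
  "(real \<Rightarrow> complex) \<Rightarrow> (real \<Rightarrow> 'e::complex_vector) \<Rightarrow> nat \<Rightarrow> (nat \<Rightarrow> real) \<Rightarrow> (nat \<Rightarrow> real) \<Rightarrow> 'e" where
  "rs_sum \<gamma> f n t s = (\<Sum>i<n. (\<gamma> (t (Suc i)) - \<gamma> (t i)) *\<^sub>C f (s i))"

lemma rs_sum_add: "rs_sum \<gamma> (\<lambda>x. f x + g x) n t s = rs_sum \<gamma> f n t s + rs_sum \<gamma> g n t s"
  by (simp add: rs_sum_def scaleC_add_right sum.distrib)

lemma rs_sum_scaleC: "rs_sum \<gamma> (\<lambda>x. c *\<^sub>C f x) n t s = c *\<^sub>C rs_sum \<gamma> f n t s"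
  by (simp add: rs_sum_def scaleC_sum_right scaleC_scaleC mult.commute)

lemma norm_rs_sum_le:
  fixes f :: "real \<Rightarrow> 'e::complex_normed_vector"
  assumes v: "variation_majorant a b \<gamma> v" and P: "fine_partition a b \<delta> n t s"
    and f: "\<And>x. x \<in> {a..b} \<Longrightarrow> norm (f x) \<le> B"
  shows "norm (rs_sum \<gamma> f n t s) \<le> B * (v b - v a)"
proof -
  have part: "is_partition a b n t"
    using P by (simp add: fine_partition_def)
  have "norm (rs_sum \<gamma> f n t s) \<le> (\<Sum>i<n. (v (t (Suc i)) - v (t i)) * B)"
    unfolding rs_sum_def
  proof (rule sum_norm_le)
    fix i
    assume "i \<in> {..<n}"
    then have i: "a \<le> t i" "t i \<le> t (Suc i)" "t (Suc i) \<le> b" and "norm (f (s i)) \<le> B"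
      using is_partition_bounds[OF part] part f[OF fine_partition_tag[OF P]]
      by (auto simp: is_partition_def)
    moreover have "cmod (\<gamma> (t (Suc i)) - \<gamma> (t i)) \<le> v (t (Suc i)) - v (t i)"
      using v i by (simp add: variation_majorant_def)
    ultimately show "norm ((\<gamma> (t (Suc i)) - \<gamma> (t i)) *\<^sub>C f (s i)) \<le> (v (t (Suc i)) - v (t i)) * B"
      unfolding norm_scaleC by (intro mult_mono) (auto intro: order_trans[OF norm_ge_zero] simp del: diff_ge_0_iff_ge)
  qed
  also have "\<dots> = B * (v b - v a)"
    using part unfolding sum_distrib_right[symmetric]
    by (simp add: sum_lessThan_telescope[of "\<lambda>i. v (t i)"] is_partition_def)
  finally show ?thesis .
qed

text \<open>The increment of \<open>\<gamma>\<close> over the intersection of \<open>[t\<^sub>i, t\<^sub>i\<^sub>+\<^sub>1]\<close> and \<open>[u\<^sub>j, u\<^sub>j\<^sub>+\<^sub>1]\<close> (zero if this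
  is empty) is written as an increment over a cell clamped to the other one. This replaces a common
  refinement of two partitions.\<close>

lemma clamp_increment_commute:
  fixes \<gamma> :: "real \<Rightarrow> complex"
  assumes "t \<le> t'" "u \<le> u'"
  shows "\<gamma> (max t (min t' u')) - \<gamma> (max t (min t' u)) = \<gamma> (max u (min u' t')) - \<gamma> (max u (min u' t))"
  using assms by (auto simp: max_def min_def)

text \<open>Both sums become double sums over pairs of cells with the same increments, so their
  difference has the coefficients \<open>f (s i) - f (r j)\<close>. A pair with nonzero increment
  consists of cells that meet, which puts the tags closer than \<delta> + \<delta>' to each
  other.\<close>

lemma norm_rs_sum_diff_le:
  fixes f :: "real \<Rightarrow> 'e::complex_normed_vector"
  assumes v: "variation_majorant a b \<gamma> v"
    and P: "fine_partition a b \<delta> n t s" and Q: "fine_partition a b \<delta>' m u r"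
    and osc: "\<And>x y. x \<in> {a..b} \<Longrightarrow> y \<in> {a..b} \<Longrightarrow> \<bar>x - y\<bar> < \<delta> + \<delta>' \<Longrightarrow> norm (f x - f y) \<le> \<epsilon>"
    and "0 \<le> \<epsilon>"
  shows "norm (rs_sum \<gamma> f n t s - rs_sum \<gamma> f m u r) \<le> \<epsilon> * (v b - v a)"
proof -
  have t: "is_partition a b n t" and u: "is_partition a b m u"
    using P Q by (auto simp: fine_partition_def)
  have t_le: "t i \<le> t (Suc i)" "a \<le> t i" "t (Suc i) \<le> b" if "i < n" for i
    using that is_partition_bounds[OF t] t by (auto simp: is_partition_def)
  have u_le: "u j \<le> u (Suc j)" "a \<le> u j" "u (Suc j) \<le> b" if "j < m" for j
    using that is_partition_bounds[OF u] u by (auto simp: is_partition_def)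
  define \<Delta> where "\<Delta> i j = \<gamma> (max (t i) (min (t (Suc i)) (u (Suc j))))
      - \<gamma> (max (t i) (min (t (Suc i)) (u j)))" for i j
  define W where "W i j = v (max (t i) (min (t (Suc i)) (u (Suc j))))
      - v (max (t i) (min (t (Suc i)) (u j)))" for i j
  have sum_\<Delta>: "(\<Sum>j<m. \<Delta> i j) = \<gamma> (t (Suc i)) - \<gamma> (t i)" if "i < n" for i
    unfolding \<Delta>_def sum_lessThan_telescope[of "\<lambda>j. \<gamma> (max (t i) (min (t (Suc i)) (u j)))"]
    using u t_le[OF that] by (simp add: is_partition_def max_absorb1 min_absorb2 max_absorb2 min_absorb1)
  have sum_W: "(\<Sum>j<m. W i j) = v (t (Suc i)) - v (t i)" if "i < n" for i
    unfolding W_def sum_lessThan_telescope[of "\<lambda>j. v (max (t i) (min (t (Suc i)) (u j)))"]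
    using u t_le[OF that] by (simp add: is_partition_def max_absorb1 min_absorb2 max_absorb2 min_absorb1)
  \<comment> \<open>Exchanging the roles of the two partitions turns the sum over \<open>i\<close>
    into a telescoping sum as well.\<close>
  have sum_\<Delta>': "(\<Sum>i<n. \<Delta> i j) = \<gamma> (u (Suc j)) - \<gamma> (u j)" if "j < m" for j
  proof -
    have "(\<Sum>i<n. \<Delta> i j) = (\<Sum>i<n. \<gamma> (max (u j) (min (u (Suc j)) (t (Suc i))))
        - \<gamma> (max (u j) (min (u (Suc j)) (t i))))"
      unfolding \<Delta>_def using t_le u_le[OF that] by (intro sum.cong clamp_increment_commute) auto
    also have "\<dots> = \<gamma> (u (Suc j)) - \<gamma> (u j)"
      unfolding sum_lessThan_telescope[of "\<lambda>i. \<gamma> (max (u j) (min (u (Suc j)) (t i)))"]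
      using t u_le[OF that]
      by (simp add: is_partition_def max_absorb1 min_absorb2 max_absorb2 min_absorb1)
    finally show ?thesis .
  qed
  have cell: "norm (\<Delta> i j *\<^sub>C (f (s i) - f (r j))) \<le> W i j * \<epsilon>" if "i < n" "j < m" for i j
  proof -
    note le = t_le[OF that(1)] u_le[OF that(2)]
    have \<Delta>_le: "cmod (\<Delta> i j) \<le> W i j"
      unfolding \<Delta>_def W_def using le
      by (intro v[unfolded variation_majorant_def, rule_format]) (auto simp: max_def min_def)
    \<comment> \<open>Cells that do not meet have increment zero and need only
      \<open>0 \<le> W i j\<close>; otherwise the oscillation hypothesis applies to the
      tags.\<close>
    show ?thesis
    proof (cases "\<Delta> i j = 0")
      case True
      then show ?thesis
        using \<Delta>_le \<open>0 \<le> \<epsilon>\<close> by simp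
    next
      case False
      then have "t i \<le> u (Suc j)" "u j \<le> t (Suc i)"
        using le unfolding \<Delta>_def by (auto simp: max_def min_def not_less split: if_splits)
      moreover have "t (Suc i) - t i < \<delta>" "s i \<in> {t i..t (Suc i)}"
        "u (Suc j) - u j < \<delta>'" "r j \<in> {u j..u (Suc j)}"
        using P Q that by (auto simp: fine_partition_def)
      ultimately have "\<bar>s i - r j\<bar> < \<delta> + \<delta>'"
        by auto
      then have "norm (f (s i) - f (r j)) \<le> \<epsilon>"
        using fine_partition_tag[OF P that(1)] fine_partition_tag[OF Q that(2)] by (intro osc)
      then show ?thesis
        unfolding norm_scaleC using \<Delta>_le
        by (intro mult_mono) (auto intro: order_trans[OF norm_ge_zero] simp del: diff_ge_0_iff_ge)
    qed
  qed
  have "rs_sum \<gamma> f n t s = (\<Sum>i<n. \<Sum>j<m. \<Delta> i j *\<^sub>C f (s i))"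
    by (simp add: rs_sum_def sum_\<Delta> flip: scaleC_sum_left)
  moreover have "rs_sum \<gamma> f m u r = (\<Sum>i<n. \<Sum>j<m. \<Delta> i j *\<^sub>C f (r j))"
    by (subst sum.swap) (simp add: rs_sum_def sum_\<Delta>' flip: scaleC_sum_left)
  ultimately have "rs_sum \<gamma> f n t s - rs_sum \<gamma> f m u r = (\<Sum>i<n. \<Sum>j<m. \<Delta> i j *\<^sub>C (f (s i) - f (r j)))"
    by (simp add: scaleC_diff_right sum_subtractf)
  also have "norm \<dots> \<le> (\<Sum>i<n. \<Sum>j<m. W i j * \<epsilon>)"
    by (intro sum_norm_le cell) auto
  also have "\<dots> = (\<Sum>i<n. v (t (Suc i)) - v (t i)) * \<epsilon>"
    by (simp add: sum_W flip: sum_distrib_right)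
  also have "\<dots> = \<epsilon> * (v b - v a)"
    using t by (simp add: sum_lessThan_telescope[of "\<lambda>i. v (t i)"] is_partition_def)
  finally show ?thesis .
qed

section \<open>The vector-valued integral: existence, error bound, linearity\<close>

definition has_rs_integral ::
  "real \<Rightarrow> real \<Rightarrow> (real \<Rightarrow> complex) \<Rightarrow> (real \<Rightarrow> 'e::complex_normed_vector) \<Rightarrow> 'e \<Rightarrow> bool" where
  "has_rs_integral a b \<gamma> f J \<longleftrightarrow>
     (\<forall>\<epsilon>>0. \<exists>\<delta>>0. \<forall>n t s. fine_partition a b \<delta> n t s \<longrightarrow> norm (rs_sum \<gamma> f n t s - J) < \<epsilon>)"

text \<open>Turns the \<epsilon>-\<delta> definition into a sequential limit, so that norm bounds
  and closed conditions pass from sums to the integral.\<close>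

lemma has_rs_integral_sequence:
  assumes "has_rs_integral a b \<gamma> f J" "a \<le> b"
  obtains n t s where "\<And>k::nat. fine_partition a b (1 / Suc k) (n k) (t k) (s k)"
    "(\<lambda>k. rs_sum \<gamma> f (n k) (t k) (s k)) \<longlonglongrightarrow> J"
proof -
  have "\<exists>n t s. fine_partition a b (1 / Suc k) n t s" for k :: nat
    using fine_partition_exists[OF assms(2), of "1 / Suc k"] by (metis of_nat_0_less_iff zero_less_Suc zero_less_divide_1_iff)
  then obtain n t s where fine: "\<And>k::nat. fine_partition a b (1 / Suc k) (n k) (t k) (s k)"
    by metis
  moreover have "(\<lambda>k. rs_sum \<gamma> f (n k) (t k) (s k)) \<longlonglongrightarrow> J"
  proof (rule LIMSEQ_I)
    fix e :: real
    assume "0 < e"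
    then obtain \<delta> where \<delta>: "0 < \<delta>"
      "\<And>n t s. fine_partition a b \<delta> n t s \<Longrightarrow> norm (rs_sum \<gamma> f n t s - J) < e"
      using assms(1) unfolding has_rs_integral_def by metis
    obtain K where K: "1 / Suc K < \<delta>"
      using \<delta>(1) by (metis nat_approx_posE)
    have "norm (rs_sum \<gamma> f (n k) (t k) (s k) - J) < e" if "k \<ge> K" for k
    proof (intro \<delta>(2) fine_partition_mono[OF fine])
      have "1 / Suc k \<le> 1 / Suc K"
        using that by (intro divide_left_mono) auto
      then show "1 / Suc k \<le> \<delta>"
        using K by simp
    qed
    then show "\<exists>no. \<forall>k\<ge>no. norm (rs_sum \<gamma> f (n k) (t k) (s k) - J) < e"
      by blast
  qed
  ultimately show ?thesis
    by (rule that)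
qed

lemma has_rs_integral_exists:
  fixes f :: "real \<Rightarrow> 'e::{complex_normed_vector, banach}"
  assumes v: "variation_majorant a b \<gamma> v" and "a \<le> b" and f: "continuous_on {a..b} f"
  obtains J where "has_rs_integral a b \<gamma> f J"
proof -
  have "0 \<le> v b - v a"
    using v \<open>a \<le> b\<close> unfolding variation_majorant_def by (meson norm_ge_zero order_refl order_trans)
  \<comment> \<open>The two meshes are kept separate, since later one of them is \<delta> and the
    other runs through \<open>1 / Suc k\<close>.\<close>
  have unif: "\<exists>\<delta>>0. \<forall>\<delta>1 \<delta>2 n t s m u r. fine_partition a b \<delta>1 n t s \<and> fine_partition a b \<delta>2 m u r \<and>
      \<delta>1 \<le> \<delta> \<and> \<delta>2 \<le> \<delta> \<longrightarrow> norm (rs_sum \<gamma> f n t s - rs_sum \<gamma> f m u r) < \<epsilon>" if "0 < \<epsilon>" for \<epsilon>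
  proof -
    \<comment> \<open>The summand 1 keeps the denominator positive for a constant curve and makes
      the final inequality strict.\<close>
    define \<eta> where "\<eta> = \<epsilon> / (v b - v a + 1)"
    have \<eta>: "0 < \<eta>" "\<eta> * (v b - v a) < \<epsilon>"
      using \<open>0 < \<epsilon>\<close> \<open>0 \<le> v b - v a\<close> by (auto simp: \<eta>_def field_simps)
    have "uniformly_continuous_on {a..b} f"
      by (intro compact_uniformly_continuous f) auto
    then obtain d where d: "0 < d" "\<And>x y. x \<in> {a..b} \<Longrightarrow> y \<in> {a..b} \<Longrightarrow> \<bar>x - y\<bar> < d \<Longrightarrow> norm (f x - f y) < \<eta>"
      using \<open>0 < \<eta>\<close> unfolding uniformly_continuous_on_def dist_norm real_norm_def by metis
    show ?thesis
    proof (intro exI conjI allI impI; (elim conjE)?)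
      \<comment> \<open>Tags from two partitions may differ by the sum of the two meshes, hence half
        of \<open>d\<close> for each.\<close>
      show "0 < d / 2"
        using d by simp
      fix \<delta>1 \<delta>2 n t s m u r
      assume "fine_partition a b \<delta>1 n t s" "fine_partition a b \<delta>2 m u r" "\<delta>1 \<le> d / 2" "\<delta>2 \<le> d / 2"
      then have "norm (rs_sum \<gamma> f n t s - rs_sum \<gamma> f m u r) \<le> \<eta> * (v b - v a)"
        using d(2) \<eta>(1) by (intro norm_rs_sum_diff_le[OF v]) (auto intro: less_imp_le)
      then show "norm (rs_sum \<gamma> f n t s - rs_sum \<gamma> f m u r) < \<epsilon>"
        using \<eta>(2) by simp
    qed
  qed
  have "\<exists>n t s. fine_partition a b (1 / Suc k) n t s" for k :: nat
    using fine_partition_exists[OF \<open>a \<le> b\<close>, of "1 / Suc k"] by (metis of_nat_0_less_iff zero_less_Suc zero_less_divide_1_iff)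
  then obtain n t s where fine: "\<And>k::nat. fine_partition a b (1 / Suc k) (n k) (t k) (s k)"
    by metis
  define S where "S k = rs_sum \<gamma> f (n k) (t k) (s k)" for k
  have small: "\<exists>K. \<forall>k\<ge>K. 1 / Suc k \<le> \<delta>" if "0 < \<delta>" for \<delta> :: real
  proof -
    obtain K where "1 / Suc K < \<delta>"
      using \<open>0 < \<delta>\<close> by (metis nat_approx_posE)
    then have "1 / Suc k \<le> \<delta>" if "k \<ge> K" for k
      using that by (intro order_trans[OF divide_left_mono[of "real (Suc K)" "real (Suc k)" 1]]) auto
    then show ?thesis
      by blast
  qed
  have "Cauchy S"
  proof (rule CauchyI)
    fix \<epsilon> :: real
    assume "0 < \<epsilon>"
    then obtain \<delta> where \<delta>: "0 < \<delta>" "\<And>\<delta>1 \<delta>2 n t s m u r. fine_partition a b \<delta>1 n t s \<Longrightarrow>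
        fine_partition a b \<delta>2 m u r \<Longrightarrow> \<delta>1 \<le> \<delta> \<Longrightarrow> \<delta>2 \<le> \<delta> \<Longrightarrow>
        norm (rs_sum \<gamma> f n t s - rs_sum \<gamma> f m u r) < \<epsilon>"
      using unif by metis
    then show "\<exists>M. \<forall>m\<ge>M. \<forall>n\<ge>M. norm (S m - S n) < \<epsilon>"
      using small[OF \<delta>(1)] \<delta>(2)[OF fine fine] unfolding S_def by metis
  qed
  then obtain J where J: "S \<longlonglongrightarrow> J"
    using Cauchy_convergent convergent_def by blast
  have "has_rs_integral a b \<gamma> f J"
    unfolding has_rs_integral_def
  proof (intro allI impI)
    fix \<epsilon> :: real
    assume "0 < \<epsilon>"
    then obtain \<delta> where \<delta>: "0 < \<delta>" "\<And>\<delta>1 \<delta>2 n t s m u r. fine_partition a b \<delta>1 n t s \<Longrightarrow>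
        fine_partition a b \<delta>2 m u r \<Longrightarrow> \<delta>1 \<le> \<delta> \<Longrightarrow> \<delta>2 \<le> \<delta> \<Longrightarrow>
        norm (rs_sum \<gamma> f n t s - rs_sum \<gamma> f m u r) < \<epsilon> / 2"
      using unif[of "\<epsilon> / 2"] by (metis half_gt_zero)
    obtain K where K: "\<And>k. k \<ge> K \<Longrightarrow> 1 / Suc k \<le> \<delta>"
      using small[OF \<delta>(1)] by blast
    have "norm (rs_sum \<gamma> f n' t' s' - J) < \<epsilon>" if "fine_partition a b \<delta> n' t' s'" for n' t' s'
    proof -
      have "norm (rs_sum \<gamma> f n' t' s' - J) \<le> \<epsilon> / 2"
      proof (rule tendsto_upperbound)
        show "(\<lambda>k. norm (rs_sum \<gamma> f n' t' s' - S k)) \<longlonglongrightarrow> norm (rs_sum \<gamma> f n' t' s' - J)"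
          by (intro tendsto_intros J)
        have "norm (rs_sum \<gamma> f n' t' s' - S k) \<le> \<epsilon> / 2" if "k \<ge> K" for k
          unfolding S_def using \<delta>(2)[OF \<open>fine_partition a b \<delta> n' t' s'\<close> fine _ K[OF that]]
          by (simp add: less_imp_le)
        then show "\<forall>\<^sub>F k in sequentially. norm (rs_sum \<gamma> f n' t' s' - S k) \<le> \<epsilon> / 2"
          by (rule eventually_sequentiallyI)
      qed simp
      then show ?thesis
        using \<open>0 < \<epsilon>\<close> by simp
    qed
    then show "\<exists>\<delta>>0. \<forall>n t s. fine_partition a b \<delta> n t s \<longrightarrow> norm (rs_sum \<gamma> f n t s - J) < \<epsilon>"
      using \<delta>(1) by blast
  qed
  then show ?thesis
    by (rule that)
qed

text \<open>The error at mesh \<delta> depends on \<open>f\<close> only through its oscillation at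
  scale 2\<delta>. A family of integrands with a common modulus of continuity therefore converges
  uniformly, which later yields convergence in the operator norm. The proof lets the second
  partition in \<open>norm_rs_sum_diff_le\<close> become arbitrarily fine.\<close>

lemma has_rs_integral_error:
  assumes v: "variation_majorant a b \<gamma> v" and J: "has_rs_integral a b \<gamma> f J" and "a \<le> b"
    and P: "fine_partition a b \<delta> n t s" "0 < \<delta>"
    and osc: "\<And>x y. x \<in> {a..b} \<Longrightarrow> y \<in> {a..b} \<Longrightarrow> \<bar>x - y\<bar> < 2 * \<delta> \<Longrightarrow> norm (f x - f y) \<le> \<epsilon>"
    and "0 \<le> \<epsilon>"
  shows "norm (rs_sum \<gamma> f n t s - J) \<le> \<epsilon> * (v b - v a)"
proof -
  obtain m u r where Q: "\<And>k::nat. fine_partition a b (1 / Suc k) (m k) (u k) (r k)"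
    "(\<lambda>k. rs_sum \<gamma> f (m k) (u k) (r k)) \<longlonglongrightarrow> J"
    using has_rs_integral_sequence[OF J \<open>a \<le> b\<close>] by metis
  obtain K where K: "1 / Suc K < \<delta>"
    using P(2) by (metis nat_approx_posE)
  show ?thesis
  proof (rule tendsto_upperbound)
    show "(\<lambda>k. norm (rs_sum \<gamma> f n t s - rs_sum \<gamma> f (m k) (u k) (r k))) \<longlonglongrightarrow> norm (rs_sum \<gamma> f n t s - J)"
      by (intro tendsto_intros Q)
    have "norm (rs_sum \<gamma> f n t s - rs_sum \<gamma> f (m k) (u k) (r k)) \<le> \<epsilon> * (v b - v a)" if "k \<ge> K" for k
    proof (rule norm_rs_sum_diff_le[OF v P(1) fine_partition_mono[OF Q(1)]])
      show "1 / Suc k \<le> \<delta>"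
        using that K by (intro order_trans[OF divide_left_mono[of "real (Suc K)" "real (Suc k)" 1]]) auto
    qed (use osc \<open>0 \<le> \<epsilon>\<close> in auto)
    then show "\<forall>\<^sub>F k in sequentially. norm (rs_sum \<gamma> f n t s - rs_sum \<gamma> f (m k) (u k) (r k)) \<le> \<epsilon> * (v b - v a)"
      by (rule eventually_sequentiallyI)
  qed simp
qed

lemma has_rs_integral_unique:
  assumes "has_rs_integral a b \<gamma> f J" "has_rs_integral a b \<gamma> f J'" "a \<le> b"
  shows "J = J'"
proof (rule ccontr)
  assume "J \<noteq> J'"
  then have e: "0 < norm (J - J') / 2"
    by simp
  obtain \<delta> \<delta>' where \<delta>: "0 < \<delta>" "0 < \<delta>'"
    "\<And>n t s. fine_partition a b \<delta> n t s \<Longrightarrow> norm (rs_sum \<gamma> f n t s - J) < norm (J - J') / 2"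
    "\<And>n t s. fine_partition a b \<delta>' n t s \<Longrightarrow> norm (rs_sum \<gamma> f n t s - J') < norm (J - J') / 2"
    using assms(1,2) e unfolding has_rs_integral_def by metis
  obtain n t s where P: "fine_partition a b (min \<delta> \<delta>') n t s"
    using fine_partition_exists[OF \<open>a \<le> b\<close>, of "min \<delta> \<delta>'"] \<delta> by auto
  have "norm (rs_sum \<gamma> f n t s - J) < norm (J - J') / 2" "norm (rs_sum \<gamma> f n t s - J') < norm (J - J') / 2"
    using \<delta> fine_partition_mono[OF P] by auto
  then show False
    using norm_triangle_ineq4[of "rs_sum \<gamma> f n t s - J" "rs_sum \<gamma> f n t s - J'"]
    by (simp add: norm_minus_commute)
qed

lemma has_rs_integral_scaleC:
  assumes "has_rs_integral a b \<gamma> f J"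
  shows "has_rs_integral a b \<gamma> (\<lambda>x. c *\<^sub>C f x) (c *\<^sub>C J)"
  unfolding has_rs_integral_def
proof (intro allI impI)
  fix \<epsilon> :: real
  assume "0 < \<epsilon>"
  then have "0 < \<epsilon> / (cmod c + 1)"
    by (simp add: add_nonneg_pos)
  then obtain \<delta> where \<delta>: "0 < \<delta>"
    "\<And>n t s. fine_partition a b \<delta> n t s \<Longrightarrow> norm (rs_sum \<gamma> f n t s - J) < \<epsilon> / (cmod c + 1)"
    using assms unfolding has_rs_integral_def by metis
  have "norm (rs_sum \<gamma> (\<lambda>x. c *\<^sub>C f x) n t s - c *\<^sub>C J) < \<epsilon>" if "fine_partition a b \<delta> n t s" for n t s
  proof -
    have "norm (rs_sum \<gamma> (\<lambda>x. c *\<^sub>C f x) n t s - c *\<^sub>C J) = cmod c * norm (rs_sum \<gamma> f n t s - J)"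
      by (simp add: rs_sum_scaleC norm_scaleC flip: scaleC_diff_right)
    also have "\<dots> \<le> cmod c * (\<epsilon> / (cmod c + 1))"
      using \<delta>(2)[OF that] by (intro mult_left_mono) auto
    also have "\<dots> < \<epsilon>"
    proof -
      have "cmod c * \<epsilon> < \<epsilon> * (cmod c + 1)"
        using \<open>0 < \<epsilon>\<close> by (simp add: distrib_left mult.commute)
      then show ?thesis
        by (simp add: pos_divide_less_eq add_nonneg_pos)
    qed
    finally show ?thesis .
  qed
  then show "\<exists>\<delta>>0. \<forall>n t s. fine_partition a b \<delta> n t s \<longrightarrow>
      norm (rs_sum \<gamma> (\<lambda>x. c *\<^sub>C f x) n t s - c *\<^sub>C J) < \<epsilon>"
    using \<delta>(1) by blast
qed

lemma has_rs_integral_add: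
  assumes "has_rs_integral a b \<gamma> f J" "has_rs_integral a b \<gamma> g K"
  shows "has_rs_integral a b \<gamma> (\<lambda>x. f x + g x) (J + K)"
  unfolding has_rs_integral_def
proof (intro allI impI)
  fix \<epsilon> :: real
  assume "0 < \<epsilon>"
  then have "0 < \<epsilon> / 2"
    by simp
  then obtain \<delta> \<delta>' where \<delta>: "0 < \<delta>" "0 < \<delta>'"
    "\<And>n t s. fine_partition a b \<delta> n t s \<Longrightarrow> norm (rs_sum \<gamma> f n t s - J) < \<epsilon> / 2"
    "\<And>n t s. fine_partition a b \<delta>' n t s \<Longrightarrow> norm (rs_sum \<gamma> g n t s - K) < \<epsilon> / 2"
    using assms unfolding has_rs_integral_def by metis
  have "norm (rs_sum \<gamma> (\<lambda>x. f x + g x) n t s - (J + K)) < \<epsilon>"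
    if P: "fine_partition a b (min \<delta> \<delta>') n t s" for n t s
  proof -
    have "norm (rs_sum \<gamma> f n t s - J) < \<epsilon> / 2" "norm (rs_sum \<gamma> g n t s - K) < \<epsilon> / 2"
      using \<delta> fine_partition_mono[OF P] by auto
    then show ?thesis
      unfolding rs_sum_add using norm_diff_triangle_less[of _ _ "\<epsilon> / 2"]
      by (smt (verit, ccfv_SIG) add_diff_add field_sum_of_halves norm_triangle_ineq)
  qed
  then show "\<exists>\<delta>>0. \<forall>n t s. fine_partition a b \<delta> n t s \<longrightarrow>
      norm (rs_sum \<gamma> (\<lambda>x. f x + g x) n t s - (J + K)) < \<epsilon>"
    using \<delta> by (intro exI[of _ "min \<delta> \<delta>'"]) auto
qed

lemma has_rs_integral_diff:
  assumes "has_rs_integral a b \<gamma> f J" "has_rs_integral a b \<gamma> g K"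
  shows "has_rs_integral a b \<gamma> (\<lambda>x. f x - g x) (J - K)"
  using has_rs_integral_add[OF assms(1) has_rs_integral_scaleC[OF assms(2), of "- 1"]]
  by (simp add: scaleC_minus_left scaleC_one)

lemma has_rs_integral_bound:
  assumes "variation_majorant a b \<gamma> v" "has_rs_integral a b \<gamma> f J" "a \<le> b"
    and "\<And>x. x \<in> {a..b} \<Longrightarrow> norm (f x) \<le> B"
  shows "norm J \<le> B * (v b - v a)"
proof -
  obtain m u r where Q: "\<And>k::nat. fine_partition a b (1 / Suc k) (m k) (u k) (r k)"
    "(\<lambda>k. rs_sum \<gamma> f (m k) (u k) (r k)) \<longlonglongrightarrow> J"
    using has_rs_integral_sequence[OF assms(2,3)] by metis
  show ?thesis
    by (rule tendsto_upperbound[OF tendsto_norm[OF Q(2)]])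
      (use norm_rs_sum_le[OF assms(1) Q(1) assms(4)] in auto)
qed

lemma has_rs_integral_closed:
  assumes "has_rs_integral a b \<gamma> f J" "a \<le> b" "closed S"
    and "\<And>\<delta> n t s. fine_partition a b \<delta> n t s \<Longrightarrow> rs_sum \<gamma> f n t s \<in> S"
  shows "J \<in> S"
proof -
  obtain m u r where Q: "\<And>k::nat. fine_partition a b (1 / Suc k) (m k) (u k) (r k)"
    "(\<lambda>k. rs_sum \<gamma> f (m k) (u k) (r k)) \<longlonglongrightarrow> J"
    using has_rs_integral_sequence[OF assms(1,2)] by metis
  show ?thesis
    by (rule closed_sequentially[OF assms(3) _ Q(2)]) (rule assms(4)[OF Q(1)])
qed

subsection \<open>Test functions\<close>

lemma dir_deriv_eq: "(f has_derivative f') (at x) \<Longrightarrow> dir_deriv b f x = f' b"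
  unfolding dir_deriv_def by (simp flip: frechet_derivative_at)

lemma differentiable_has_derivative:
  "f differentiable (at x) \<Longrightarrow> (f has_derivative (\<lambda>b. dir_deriv b f x)) (at x)"
  unfolding dir_deriv_def by (rule frechet_derivative_works[THEN iffD1])

lemma dir_deriv_add:
  assumes "f differentiable (at x)" "g differentiable (at x)"
  shows "dir_deriv b (\<lambda>x. f x + g x) x = dir_deriv b f x + dir_deriv b g x"
  by (rule dir_deriv_eq) (intro has_derivative_add differentiable_has_derivative assms)

lemma dir_deriv_diff:
  assumes "f differentiable (at x)" "g differentiable (at x)"
  shows "dir_deriv b (\<lambda>x. f x - g x) x = dir_deriv b f x - dir_deriv b g x"
  by (rule dir_deriv_eq) (intro has_derivative_diff differentiable_has_derivative assms)

lemma dir_deriv_mult: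
  assumes "f differentiable (at x)" "g differentiable (at x)"
  shows "dir_deriv b (\<lambda>x. f x * g x) x = f x * dir_deriv b g x + dir_deriv b f x * g x"
  by (rule dir_deriv_eq) (intro has_derivative_mult differentiable_has_derivative assms)

lemma dir_deriv_cmult:
  assumes "f differentiable (at x)"
  shows "dir_deriv b (\<lambda>x. c * f x) x = c * dir_deriv b f x"
  by (rule dir_deriv_eq) (intro has_derivative_mult_right differentiable_has_derivative assms)

lemma dir_deriv_eq_0:
  assumes "closed K" "\<And>x. x \<notin> K \<Longrightarrow> f x = 0" "x \<notin> K"
  shows "dir_deriv b f x = 0"
proof -
  have "((\<lambda>_. 0) has_derivative (\<lambda>_. 0)) (at x)"
    by simp
  then have "(f has_derivative (\<lambda>_. 0)) (at x)"
    by (rule has_derivative_transform_within_open[of _ _ _ _ "- K"]) (use assms in auto)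
  then show ?thesis
    by (rule dir_deriv_eq)
qed

lemma smooth_differentiable: "smooth f \<Longrightarrow> f differentiable (at x)"
  unfolding smooth_def by (drule spec[of _ "[]"]) simp

lemma smooth_continuous: "smooth f \<Longrightarrow> continuous_on S f"
  by (meson continuous_at_imp_continuous_on differentiable_imp_continuous_within smooth_differentiable)

lemma smooth_dir_deriv:
  assumes "smooth f" "b \<in> Basis"
  shows "smooth (dir_deriv b f)"
  unfolding smooth_def
proof (intro allI impI)
  fix bs :: "'a list" and x
  assume "set bs \<subseteq> Basis"
  then have "foldr dir_deriv (bs @ [b]) f differentiable (at x)"
    using assms unfolding smooth_def by (metis Un_subset_iff empty_subsetI insert_subset list.set set_append)
  then show "foldr dir_deriv bs (dir_deriv b f) differentiable (at x)"
    by simp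
qed

lemma smooth_add:
  assumes f: "smooth f" and g: "smooth g"
  shows "smooth (\<lambda>x. f x + g x)"
proof -
  \<comment> \<open>Higher derivatives differentiate the previous one as a function, so the identity
    is needed at all points and not only at \<open>x\<close>.\<close>
  have eq: "foldr dir_deriv bs (\<lambda>x. f x + g x) = (\<lambda>x. foldr dir_deriv bs f x + foldr dir_deriv bs g x)"
    if "set bs \<subseteq> Basis" for bs
    using that
  proof (induction bs)
    case (Cons b bs)
    then have "foldr dir_deriv bs f differentiable (at x)" "foldr dir_deriv bs g differentiable (at x)" for x
      using f g by (auto simp: smooth_def)
    then show ?case
      using Cons by (auto simp: dir_deriv_add)
  qed simp
  show ?thesis
    unfolding smooth_def
  proof (intro allI impI)
    fix bs :: "'a list" and x
    assume "set bs \<subseteq> Basis"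
    then show "foldr dir_deriv bs (\<lambda>x. f x + g x) differentiable (at x)"
      using f g unfolding eq[OF \<open>set bs \<subseteq> Basis\<close>] smooth_def by (intro differentiable_add) auto
  qed
qed

lemma smooth_cmult:
  assumes f: "smooth f"
  shows "smooth (\<lambda>x. c * f x)"
proof -
  have eq: "foldr dir_deriv bs (\<lambda>x. c * f x) = (\<lambda>x. c * foldr dir_deriv bs f x)"
    if "set bs \<subseteq> Basis" for bs
    using that
  proof (induction bs)
    case (Cons b bs)
    then have "foldr dir_deriv bs f differentiable (at x)" for x
      using f by (auto simp: smooth_def)
    then show ?case
      using Cons by (auto simp: dir_deriv_cmult)
  qed simp
  show ?thesis
    unfolding smooth_def
  proof (intro allI impI)
    fix bs :: "'a list" and x
    assume "set bs \<subseteq> Basis"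
    then show "foldr dir_deriv bs (\<lambda>x. c * f x) differentiable (at x)"
      using f unfolding eq[OF \<open>set bs \<subseteq> Basis\<close>] smooth_def by (intro differentiable_mult) auto
  qed
qed

section \<open>Test functions and integration by parts\<close>

lemma test_functionsE:
  assumes "\<phi> \<in> test_functions D"
  obtains K where "smooth \<phi>" "compact K" "K \<subseteq> D" "\<And>x. x \<notin> K \<Longrightarrow> \<phi> x = 0"
  using assms unfolding test_functions_def
  by (metis (mono_tags, lifting) closure_subset mem_Collect_eq subsetD)

lemma test_functionsI:
  assumes "smooth \<phi>" "compact K" "K \<subseteq> D" "\<And>x. x \<notin> K \<Longrightarrow> \<phi> x = 0"
  shows "\<phi> \<in> test_functions D"
proof -
  have "closure {x. \<phi> x \<noteq> 0} \<subseteq> K"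
    using assms by (intro closure_minimal compact_imp_closed) auto
  moreover from this have "compact (closure {x. \<phi> x \<noteq> 0})"
    using compact_Int_closed[OF assms(2) closed_closure] by (metis inf.absorb2)
  ultimately show ?thesis
    using assms unfolding test_functions_def by blast
qed

lemma test_functions_add:
  assumes "\<phi> \<in> test_functions D" "\<psi> \<in> test_functions D"
  shows "(\<lambda>x. \<phi> x + \<psi> x) \<in> test_functions D"
proof -
  obtain K L where "smooth \<phi>" "compact K" "K \<subseteq> D" "\<And>x. x \<notin> K \<Longrightarrow> \<phi> x = 0"
    "smooth \<psi>" "compact L" "L \<subseteq> D" "\<And>x. x \<notin> L \<Longrightarrow> \<psi> x = 0"
    using assms by (metis test_functionsE)
  then show ?thesis
    by (intro test_functionsI[of _ "K \<union> L"] smooth_add compact_Un) auto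
qed

lemma test_functions_cmult: "\<phi> \<in> test_functions D \<Longrightarrow> (\<lambda>x. c * \<phi> x) \<in> test_functions D"
  by (erule test_functionsE) (auto intro: test_functionsI smooth_cmult)

lemma compactly_supported_bounded:
  fixes f :: "'a::euclidean_space \<Rightarrow> complex"
  assumes "continuous_on UNIV f" "compact K" "\<And>x. x \<notin> K \<Longrightarrow> f x = 0"
  obtains B where "0 \<le> B" "\<And>x. cmod (f x) \<le> B"
proof -
  have "bounded (f ` K)"
    using assms by (intro compact_imp_bounded compact_continuous_image) (auto intro: continuous_on_subset)
  then obtain B where B: "\<And>x. x \<in> K \<Longrightarrow> cmod (f x) \<le> B"
    by (auto simp: bounded_iff)
  have "cmod (f x) \<le> max B 0" for x
    using B[of x] assms(3)[of x] by (cases "x \<in> K") auto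
  then show ?thesis
    using that[of "max B 0"] by auto
qed

lemma continuous_borel_measurable_lebesgue:
  "continuous_on UNIV f \<Longrightarrow> f \<in> borel_measurable lebesgue"
  by (intro measurable_completion) (simp add: borel_measurable_continuous_onI)

lemma compactly_supported_integrable:
  fixes f :: "'a::euclidean_space \<Rightarrow> complex"
  assumes "continuous_on UNIV f" "compact K" "\<And>x. x \<notin> K \<Longrightarrow> f x = 0"
  shows "integrable lebesgue f"
proof -
  obtain B where B: "0 \<le> B" "\<And>x. cmod (f x) \<le> B"
    using compactly_supported_bounded assms by metis
  have "integrable lebesgue (\<lambda>x. B * indicat_real K x)"
    using lmeasurable_compact[OF assms(2)] by (simp add: lmeasurable_iff_integrable)
  then show ?thesis
    by (rule Bochner_Integration.integrable_bound)
      (use assms B in \<open>auto intro!: AE_I2 continuous_borel_measurable_lebesgue simp: indicator_def\<close>)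
qed

lemma compactly_supported_L2_fun:
  fixes f :: "'a::euclidean_space \<Rightarrow> complex"
  assumes "continuous_on UNIV f" "compact K" "\<And>x. x \<notin> K \<Longrightarrow> f x = 0"
  shows "f \<in> L2_fun"
proof -
  have "integrable lebesgue (\<lambda>x. complex_of_real ((cmod (f x))\<^sup>2))"
    using assms by (intro compactly_supported_integrable[of _ K] continuous_intros) auto
  then have "integrable lebesgue (\<lambda>x. (cmod (f x))\<^sup>2)"
    using integrable_Re by fastforce
  then show ?thesis
    using assms by (simp add: L2_fun_def continuous_borel_measurable_lebesgue)
qed

lemma integral_lebesgue_translate:
  fixes f :: "'a::euclidean_space \<Rightarrow> complex"
  assumes "continuous_on UNIV f"
  shows "(\<integral>x. f (c + x) \<partial>lebesgue) = (\<integral>x. f x \<partial>lebesgue)"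
proof -
  have f: "f \<in> borel_measurable borel"
    using assms by (rule borel_measurable_continuous_onI)
  have "(\<integral>x. f x \<partial>lborel) = (\<integral>x. f x \<partial>distr lborel borel ((+) c))"
    by (simp add: lborel_distr_plus)
  also have "\<dots> = (\<integral>x. f (c + x) \<partial>lborel)"
    using f by (intro integral_distr) auto
  finally show ?thesis
    using f by (simp add: integral_completion)
qed

text \<open>The integrals of \<open>x \<mapsto> f (x + h b)\<close> do not depend on \<open>h\<close>; differentiate at \<open>h = 0\<close>.\<close>

lemma integral_dir_deriv_eq_0:
  fixes f :: "'a::euclidean_space \<Rightarrow> complex"
  assumes diff: "\<And>x. f differentiable (at x)" and cont: "continuous_on UNIV (dir_deriv b f)"
    and K: "compact K" "\<And>x. x \<notin> K \<Longrightarrow> f x = 0"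
  shows "(\<integral>x. dir_deriv b f x \<partial>lebesgue) = 0"
proof -
  have f_cont: "continuous_on UNIV f"
    by (intro continuous_at_imp_continuous_on ballI differentiable_imp_continuous_within diff)
  obtain B where B: "0 \<le> B" "\<And>x. cmod (dir_deriv b f x) \<le> B"
    using compactly_supported_bounded[OF cont K(1) dir_deriv_eq_0[OF compact_imp_closed[OF K(1)] K(2)]]
    by blast
  obtain R where R: "\<And>x. x \<in> K \<Longrightarrow> norm x \<le> R"
    using compact_imp_bounded[OF K(1)] by (auto simp: bounded_iff)
  define h where "h n = 1 / real (Suc n)" for n
  have h: "0 < h n" "h n \<le> 1" for n
    by (auto simp: h_def)
  have h_lim: "h \<longlonglongrightarrow> 0"
    unfolding h_def by (rule LIMSEQ_Suc[OF lim_1_over_n])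
  define q where "q n x = (f (h n *\<^sub>R b + x) - f x) /\<^sub>R h n" for n x
  have deriv: "((\<lambda>t. f (t *\<^sub>R b + x)) has_vector_derivative dir_deriv b f (t *\<^sub>R b + x)) (at t within S)"
    for t x S
  proof -
    have "((\<lambda>t. f (t *\<^sub>R b + x)) has_derivative (\<lambda>s. dir_deriv (s *\<^sub>R b + 0) f (t *\<^sub>R b + x))) (at t within S)"
      by (rule has_derivative_compose[of "\<lambda>t. t *\<^sub>R b + x", OF _ differentiable_has_derivative[OF diff]])
        (auto intro!: derivative_eq_intros)
    moreover have "dir_deriv (s *\<^sub>R b) f y = s *\<^sub>R dir_deriv b f y" for s y
      using linear_cmul[OF has_derivative_linear[OF differentiable_has_derivative[OF diff[of y]]]] .
    ultimately show ?thesis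
      by (simp add: has_vector_derivative_def)
  qed
  \<comment> \<open>On the large ball this is the mean value inequality along the segment. Outside
    it both evaluation points miss \<open>K\<close>, because \<open>h n \<le> 1\<close> shifts by at
    most \<open>norm b\<close>.\<close>
  have bound: "cmod (q n x) \<le> B * indicat_real (cball 0 (R + norm b)) x" for n x
  proof (cases "x \<in> cball 0 (R + norm b)")
    case True
    have "norm (f (h n *\<^sub>R b + x) - f (0 *\<^sub>R b + x)) \<le> B * norm (h n - 0)"
    proof (rule differentiable_bound[of "{0..h n}"])
      show "((\<lambda>t. f (t *\<^sub>R b + x)) has_derivative (\<lambda>s. s *\<^sub>R dir_deriv b f (t *\<^sub>R b + x)))
          (at t within {0..h n})" for t
        using deriv by (simp add: has_vector_derivative_def)
      show "onorm (\<lambda>s. s *\<^sub>R dir_deriv b f (t *\<^sub>R b + x)) \<le> B" for t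
        using B(2)[of "t *\<^sub>R b + x"]
        by (intro onorm_le) (simp add: mult.commute[of _ "cmod _"] mult_right_mono)
    qed (use h[of n] in auto)
    then have "cmod (f (h n *\<^sub>R b + x) - f x) \<le> h n * B"
      using h[of n] by (simp add: mult.commute)
    then show ?thesis
      using True h[of n] by (simp add: q_def divide_simps mult.commute)
  next
    case False
    have "norm x \<le> norm (h n *\<^sub>R b + x) + norm (h n *\<^sub>R b)"
      using norm_triangle_ineq4[of "h n *\<^sub>R b + x" "h n *\<^sub>R b"] by simp
    moreover have "norm (h n *\<^sub>R b) \<le> norm b"
      using h[of n] by (simp add: mult_left_le_one_le)
    moreover have "R + norm b < norm x"
      using False by simp
    ultimately have "R < norm (h n *\<^sub>R b + x)" "R < norm x"
      using norm_ge_zero[of b] by linarith+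
    then have "f (h n *\<^sub>R b + x) = 0" "f x = 0"
      using K(2) R by (meson leD)+
    then show ?thesis
      using B by (simp add: q_def)
  qed
  have "(\<lambda>n. \<integral>x. q n x \<partial>lebesgue) \<longlonglongrightarrow> (\<integral>x. dir_deriv b f x \<partial>lebesgue)"
  proof (rule integral_dominated_convergence)
    show "integrable lebesgue (\<lambda>x. B * indicat_real (cball 0 (R + norm b)) x)"
      by (intro integrable_mult_right) (simp flip: lmeasurable_iff_integrable)
    show "AE x in lebesgue. (\<lambda>n. q n x) \<longlonglongrightarrow> dir_deriv b f x"
    proof (rule AE_I2)
      fix x
      have "((\<lambda>t. cmod (f (t *\<^sub>R b + x) - f x - t *\<^sub>R dir_deriv b f x) / \<bar>t\<bar>) \<longlongrightarrow> 0) (at 0)"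
        using deriv[of x 0 UNIV] by (simp add: has_vector_derivative_def has_derivative_iff_norm)
      then have "((\<lambda>t. cmod ((f (t *\<^sub>R b + x) - f x) /\<^sub>R t - dir_deriv b f x)) \<longlongrightarrow> 0) (at 0)"
      proof (rule Lim_transform_eventually)
        have "cmod (f (t *\<^sub>R b + x) - f x - t *\<^sub>R dir_deriv b f x) / \<bar>t\<bar>
            = cmod ((f (t *\<^sub>R b + x) - f x) /\<^sub>R t - dir_deriv b f x)" if "t \<noteq> 0" for t
        proof -
          have "(f (t *\<^sub>R b + x) - f x) /\<^sub>R t - dir_deriv b f x
              = (f (t *\<^sub>R b + x) - f x - t *\<^sub>R dir_deriv b f x) /\<^sub>R t"
            using that by (simp add: scaleR_diff_right)
          then show ?thesis
            by (simp add: divide_inverse mult.commute)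
        qed
        then show "\<forall>\<^sub>F t in at 0. cmod (f (t *\<^sub>R b + x) - f x - t *\<^sub>R dir_deriv b f x) / \<bar>t\<bar>
            = cmod ((f (t *\<^sub>R b + x) - f x) /\<^sub>R t - dir_deriv b f x)"
          by (simp add: eventually_at_filter)
      qed
      then have "((\<lambda>t. (f (t *\<^sub>R b + x) - f x) /\<^sub>R t) \<longlongrightarrow> dir_deriv b f x) (at 0)"
        by (simp add: Lim_null[of _ "dir_deriv b f x"] tendsto_norm_zero_iff)
      moreover have "filterlim h (at 0) sequentially"
        unfolding filterlim_at using h h_lim by (auto simp: less_imp_neq[symmetric])
      ultimately show "(\<lambda>n. q n x) \<longlonglongrightarrow> dir_deriv b f x"
        unfolding q_def by (rule filterlim_compose)
    qed
  qed (use bound in \<open>auto intro!: continuous_borel_measurable_lebesgue cont continuous_intros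
      continuous_on_compose2[OF f_cont] f_cont simp: q_def\<close>)
  moreover have "(\<integral>x. q n x \<partial>lebesgue) = 0" for n
  proof -
    have int: "integrable lebesgue f"
      using compactly_supported_integrable[OF f_cont K] .
    have "integrable lebesgue (\<lambda>x. f (h n *\<^sub>R b + x))"
    proof (rule compactly_supported_integrable[of _ "(+) (- (h n *\<^sub>R b)) ` K"])
      show "compact ((+) (- (h n *\<^sub>R b)) ` K)"
        using K(1) by (rule compact_translation)
      show "f (h n *\<^sub>R b + x) = 0" if "x \<notin> (+) (- (h n *\<^sub>R b)) ` K" for x
        using that by (intro K(2)) (metis add.assoc add.left_neutral add.left_inverse imageI)
    qed (auto intro!: continuous_intros continuous_on_compose2[OF f_cont])
    then show ?thesis
      unfolding q_def using int by (simp add: integral_lebesgue_translate[OF f_cont])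
  qed
  ultimately show ?thesis
    by (simp add: LIMSEQ_const_iff)
qed

lemma laplacian_eq_0:
  assumes "compact K" "\<And>x. x \<notin> K \<Longrightarrow> \<phi> x = 0" "x \<notin> K"
  shows "laplacian \<phi> x = 0"
  unfolding laplacian_def
  using dir_deriv_eq_0[OF compact_imp_closed[OF assms(1)] dir_deriv_eq_0[OF compact_imp_closed[OF assms(1)] assms(2)]] assms(3)
  by simp

lemma smooth_laplacian_continuous: "smooth \<phi> \<Longrightarrow> continuous_on UNIV (laplacian \<phi>)"
  unfolding laplacian_def by (intro continuous_on_sum smooth_continuous smooth_dir_deriv)

lemma test_functions_L2_fun:
  assumes "\<phi> \<in> test_functions D"
  shows "\<phi> \<in> L2_fun" "laplacian \<phi> \<in> L2_fun"
proof -
  obtain K where K: "smooth \<phi>" "compact K" "\<And>x. x \<notin> K \<Longrightarrow> \<phi> x = 0"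
    using assms by (metis test_functionsE)
  show "\<phi> \<in> L2_fun"
    using K by (intro compactly_supported_L2_fun[of _ K] smooth_continuous)
  show "laplacian \<phi> \<in> L2_fun"
    using K laplacian_eq_0[of K \<phi>, OF K(2) K(3)]
    by (intro compactly_supported_L2_fun[of _ K] smooth_laplacian_continuous)
qed

text \<open>Green's identity: the difference of the integrands is the sum over \<open>b\<close> of
  the derivatives of \<open>\<phi> * dir_deriv b \<psi> - dir_deriv b \<phi> * \<psi>\<close> in
  direction \<open>b\<close>. These functions vanish off the support of \<phi>, so each derivative
  integrates to zero. This is what identifies the classical Laplacian of a test function with its
  distributional one.\<close>

lemma laplacian_symmetric:
  assumes "\<phi> \<in> test_functions D" "\<psi> \<in> test_functions E"
  shows "(\<integral>x. \<phi> x * laplacian \<psi> x \<partial>lebesgue) = (\<integral>x. laplacian \<phi> x * \<psi> x \<partial>lebesgue)"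
proof -
  obtain K where K: "smooth \<phi>" "compact K" "\<And>x. x \<notin> K \<Longrightarrow> \<phi> x = 0"
    using assms by (metis test_functionsE)
  have \<psi>: "smooth \<psi>"
    using assms by (metis test_functionsE)
  note smooth = K(1) \<psi> smooth_dir_deriv[OF K(1)] smooth_dir_deriv[OF \<psi>]
    smooth_dir_deriv[OF smooth_dir_deriv[OF K(1)]] smooth_dir_deriv[OF smooth_dir_deriv[OF \<psi>]]
  have zero: "dir_deriv b \<phi> x = 0" "dir_deriv b (dir_deriv b \<phi>) x = 0" if "x \<notin> K" for b x
    using dir_deriv_eq_0[OF compact_imp_closed[OF K(2)]] K(3) that by metis+
  define F where "F b x = \<phi> x * dir_deriv b \<psi> x - dir_deriv b \<phi> x * \<psi> x" for b x
  have dF: "dir_deriv b (F b) x = \<phi> x * dir_deriv b (dir_deriv b \<psi>) x - dir_deriv b (dir_deriv b \<phi>) x * \<psi> x"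
    if "b \<in> Basis" for b x
    using smooth that unfolding F_def
    by (simp add: dir_deriv_diff dir_deriv_mult smooth_differentiable differentiable_mult)
  have int_F: "(\<integral>x. dir_deriv b (F b) x \<partial>lebesgue) = 0" if "b \<in> Basis" for b
  proof (rule integral_dir_deriv_eq_0[OF _ _ K(2)])
    show "F b differentiable (at x)" for x
      unfolding F_def using smooth that
      by (intro differentiable_diff differentiable_mult smooth_differentiable)
    show "continuous_on UNIV (dir_deriv b (F b))"
      unfolding dF[OF that] using smooth that
      by (intro continuous_intros smooth_continuous)
    show "F b x = 0" if "x \<notin> K" for x
      using that zero K(3) by (simp add: F_def)
  qed
  have "integrable lebesgue (dir_deriv b (F b))" if "b \<in> Basis" for b
    unfolding dF[OF that] using smooth that zero K
    by (intro compactly_supported_integrable[of _ K] continuous_intros smooth_continuous) auto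
  then have "(\<integral>x. (\<Sum>b\<in>Basis. dir_deriv b (F b) x) \<partial>lebesgue) = (\<Sum>b\<in>Basis. \<integral>x. dir_deriv b (F b) x \<partial>lebesgue)"
    by (intro Bochner_Integration.integral_sum) auto
  also have "\<dots> = 0"
    using int_F by simp
  also have "(\<lambda>x. \<Sum>b\<in>Basis. dir_deriv b (F b) x) = (\<lambda>x. \<phi> x * laplacian \<psi> x - laplacian \<phi> x * \<psi> x)"
    unfolding laplacian_def sum_distrib_left sum_distrib_right sum_subtractf[symmetric]
    by (intro ext sum.cong refl dF)
  finally have "(\<integral>x. \<phi> x * laplacian \<psi> x - laplacian \<phi> x * \<psi> x \<partial>lebesgue) = 0" .
  moreover have "integrable lebesgue (\<lambda>x. \<phi> x * laplacian \<psi> x)" "integrable lebesgue (\<lambda>x. laplacian \<phi> x * \<psi> x)"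
    using K laplacian_eq_0[of K \<phi>, OF K(2) K(3)]
    by (simp_all add: compactly_supported_integrable[OF _ K(2)] continuous_on_mult
        smooth_continuous[OF K(1)] smooth_continuous[OF \<psi>]
        smooth_laplacian_continuous[OF K(1)] smooth_laplacian_continuous[OF \<psi>])
  ultimately show ?thesis
    by simp
qed

section \<open>Construction of smooth bump functions\<close>

definition flat_exp :: "nat \<Rightarrow> real \<Rightarrow> real" where
  "flat_exp k t = (if 0 < t then (1 / t) ^ k * exp (- 1 / t) else 0)"

text \<open>The powers of \<open>1 / t\<close> are included in the family so that differentiation
  stays within its linear span. At the origin the right difference quotient is
  \<open>y ^ Suc k / exp y\<close> with \<open>y = 1 / t\<close> tending to infinity, and the left
  one is zero.\<close>

lemma flat_exp_has_derivative:
  "(flat_exp k has_real_derivative flat_exp (k + 2) t - real k * flat_exp (k + 1) t) (at t)"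
proof (cases t "0::real" rule: linorder_cases)
  case less
  have "((\<lambda>_. 0) has_real_derivative 0) (at t)"
    by simp
  then have "(flat_exp k has_real_derivative 0) (at t)"
    by (rule has_field_derivative_transform_within_open[of _ _ _ "{..<0}"])
      (use less in \<open>auto simp: flat_exp_def\<close>)
  then show ?thesis
    using less by (simp add: flat_exp_def)
next
  case greater
  have "((\<lambda>t. (1 / t) ^ k * exp (- 1 / t)) has_real_derivative
      (1 / t) ^ (k + 2) * exp (- 1 / t) - real k * ((1 / t) ^ (k + 1) * exp (- 1 / t))) (at t)"
  proof -
    have inv: "((\<lambda>t. 1 / t) has_real_derivative - ((1 / t) ^ 2)) (at t)"
      "((\<lambda>t. - 1 / t) has_real_derivative (1 / t) ^ 2) (at t)"
      using greater by (auto intro!: derivative_eq_intros simp: power2_eq_square)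
    have "((\<lambda>t. (1 / t) ^ k * exp (- 1 / t)) has_real_derivative
        real k * (- ((1 / t) ^ 2) * (1 / t) ^ (k - Suc 0)) * exp (- 1 / t)
        + exp (- 1 / t) * (1 / t) ^ 2 * (1 / t) ^ k) (at t)"
      by (rule DERIV_mult[OF DERIV_power[OF inv(1)] DERIV_fun_exp[OF inv(2)]])
    \<comment> \<open>For \<open>k = 0\<close> the truncated exponent \<open>k - Suc 0\<close> is
      harmless, because the factor \<open>real k\<close> vanishes.\<close>
    moreover have "real k * (- (y ^ 2) * y ^ (k - Suc 0)) * z + z * y ^ 2 * y ^ k
        = y ^ (k + 2) * z - real k * (y ^ (k + 1) * z)" for y z :: real
      by (cases k) (simp_all add: power2_eq_square algebra_simps)
    ultimately show ?thesis
      by (simp only:)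
  qed
  then have "(flat_exp k has_real_derivative
      (1 / t) ^ (k + 2) * exp (- 1 / t) - real k * ((1 / t) ^ (k + 1) * exp (- 1 / t))) (at t)"
    by (rule has_field_derivative_transform_within_open[of _ _ _ "{0<..}"])
      (use greater in \<open>auto simp: flat_exp_def\<close>)
  then show ?thesis
    using greater by (simp add: flat_exp_def)
next
  case equal
  have "((\<lambda>s. flat_exp k s / s) \<longlongrightarrow> 0) (at_right 0)"
  proof (rule Lim_transform_eventually)
    show "((\<lambda>s. inverse s ^ Suc k / exp (inverse s)) \<longlongrightarrow> (0::real)) (at_right 0)"
      by (rule filterlim_compose[OF tendsto_power_div_exp_0 filterlim_inverse_at_top_right])
    show "\<forall>\<^sub>F s in at_right 0. inverse s ^ Suc k / exp (inverse s) = flat_exp k s / s"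
      by (rule eventually_at_rightI[of 0 1]) (auto simp: flat_exp_def exp_minus field_simps)
  qed
  moreover have "((\<lambda>s. flat_exp k s / s) \<longlongrightarrow> 0) (at_left 0)"
    by (rule Lim_transform_eventually[OF tendsto_const])
      (auto simp: flat_exp_def intro!: eventually_at_leftI[of "-1"])
  ultimately have "((\<lambda>s. flat_exp k s / s) \<longlongrightarrow> 0) (at 0)"
    by (simp add: filterlim_at_split)
  then show ?thesis
    using equal by (simp add: DERIV_def flat_exp_def)
qed

lemma flat_exp_bounds: "0 \<le> flat_exp 0 t" "flat_exp 0 t \<le> 1"
  by (auto simp: flat_exp_def)

lemma flat_exp_limit:
  assumes "0 < t"
  shows "(\<lambda>n. flat_exp 0 (real (Suc n) * t)) \<longlonglongrightarrow> 1"
proof -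
  have "(\<lambda>n. exp (- (1 / real (Suc n)) * (1 / t))) \<longlonglongrightarrow> exp (- 0 * (1 / t))"
    by (intro tendsto_intros LIMSEQ_Suc[OF lim_1_over_n])
  then show ?thesis
    using assms by (simp add: flat_exp_def)
qed

text \<open>A class of functions closed under directional derivatives by the chain and product
  rules. Differentiability to all orders is then an induction on the list of directions, with no
  formula for the higher derivatives.\<close>

inductive_set flat_exp_algebra :: "('a::euclidean_space \<Rightarrow> complex) set" where
  gen: "(\<lambda>x. complex_of_real (flat_exp k (c * (x \<bullet> e) + d))) \<in> flat_exp_algebra"
| const: "(\<lambda>_. z) \<in> flat_exp_algebra"
| add: "f \<in> flat_exp_algebra \<Longrightarrow> g \<in> flat_exp_algebra \<Longrightarrow> (\<lambda>x. f x + g x) \<in> flat_exp_algebra"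
| mult: "f \<in> flat_exp_algebra \<Longrightarrow> g \<in> flat_exp_algebra \<Longrightarrow> (\<lambda>x. f x * g x) \<in> flat_exp_algebra"

lemma flat_exp_algebra_derivative:
  assumes "f \<in> flat_exp_algebra"
  shows "\<exists>f'. (\<forall>x. (f has_derivative f' x) (at x)) \<and> (\<forall>b. (\<lambda>x. f' x b) \<in> flat_exp_algebra)"
  using assms
proof induction
  case (gen k c e d)
  define g where "g x = flat_exp (k + 2) (c * (x \<bullet> e) + d) - real k * flat_exp (k + 1) (c * (x \<bullet> e) + d)"
    for x :: 'a
  show ?case
  proof (intro exI[of _ "\<lambda>x b. complex_of_real (g x * (c * (b \<bullet> e)))"] conjI allI)
    fix x :: 'a
    have "((\<lambda>x. c * (x \<bullet> e) + d) has_derivative (\<lambda>b. c * (b \<bullet> e))) (at x)"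
      by (auto intro!: derivative_eq_intros)
    then have "((\<lambda>x. flat_exp k (c * (x \<bullet> e) + d)) has_derivative (\<lambda>b. g x * (c * (b \<bullet> e)))) (at x)"
      unfolding g_def
      by (rule has_derivative_compose) (use flat_exp_has_derivative in \<open>simp add: has_field_derivative_def\<close>)
    then show "((\<lambda>x. complex_of_real (flat_exp k (c * (x \<bullet> e) + d))) has_derivative
        (\<lambda>b. complex_of_real (g x * (c * (b \<bullet> e))))) (at x)"
      by (rule has_derivative_of_real)
  next
    fix b
    have "(\<lambda>x. (complex_of_real (flat_exp (k + 2) (c * (x \<bullet> e) + d))
        + (- of_nat k) * complex_of_real (flat_exp (k + 1) (c * (x \<bullet> e) + d)))
        * complex_of_real (c * (b \<bullet> e))) \<in> flat_exp_algebra"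
      by (intro flat_exp_algebra.intros)
    then show "(\<lambda>x. complex_of_real (g x * (c * (b \<bullet> e)))) \<in> flat_exp_algebra"
      by (simp add: g_def)
  qed
next
  case (const z)
  show ?case
    by (rule exI[of _ "\<lambda>_ _. 0"]) (auto intro: flat_exp_algebra.const)
next
  case (add f g)
  then obtain f' g' where "\<And>x. (f has_derivative f' x) (at x)" "\<And>b. (\<lambda>x. f' x b) \<in> flat_exp_algebra"
    "\<And>x. (g has_derivative g' x) (at x)" "\<And>b. (\<lambda>x. g' x b) \<in> flat_exp_algebra"
    by blast
  then show ?case
    by (intro exI[of _ "\<lambda>x b. f' x b + g' x b"])
      (auto intro: has_derivative_add flat_exp_algebra.add)
next
  case (mult f g)
  then obtain f' g' where "\<And>x. (f has_derivative f' x) (at x)" "\<And>b. (\<lambda>x. f' x b) \<in> flat_exp_algebra"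
    "\<And>x. (g has_derivative g' x) (at x)" "\<And>b. (\<lambda>x. g' x b) \<in> flat_exp_algebra"
    by blast
  with mult.hyps show ?case
    by (intro exI[of _ "\<lambda>x b. f x * g' x b + f' x b * g x"])
      (auto intro!: has_derivative_mult flat_exp_algebra.add flat_exp_algebra.mult)
qed

lemma flat_exp_algebra_smooth:
  assumes "f \<in> flat_exp_algebra"
  shows "smooth f"
proof -
  have "foldr dir_deriv bs f \<in> flat_exp_algebra" for bs
  proof (induction bs)
    case (Cons b bs)
    obtain f' where f': "\<And>x. (foldr dir_deriv bs f has_derivative f' x) (at x)"
      "\<And>b. (\<lambda>x. f' x b) \<in> flat_exp_algebra"
      using flat_exp_algebra_derivative[OF Cons] by blast
    have "dir_deriv b (foldr dir_deriv bs f) = (\<lambda>x. f' x b)"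
      by (rule ext) (rule dir_deriv_eq[OF f'(1)])
    then show ?case
      using f'(2) by simp
  qed (use assms in simp)
  then show ?thesis
    unfolding smooth_def using flat_exp_algebra_derivative by (meson differentiableI)
qed

lemma flat_exp_algebra_prod:
  "(\<And>i. i \<in> I \<Longrightarrow> f i \<in> flat_exp_algebra) \<Longrightarrow> (\<lambda>x. \<Prod>i\<in>I. f i x) \<in> flat_exp_algebra"
  by (induction I rule: infinite_finite_induct) (auto intro: flat_exp_algebra.intros)

text \<open>Test functions that increase to the indicator of the open box as \<open>n \<rightarrow> \<infinity>\<close>.\<close>

definition box_bump :: "'a::euclidean_space \<Rightarrow> 'a \<Rightarrow> nat \<Rightarrow> 'a \<Rightarrow> complex" where
  "box_bump p q n x = complex_of_real (\<Prod>e\<in>Basis.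
     flat_exp 0 (real (Suc n) * ((x - p) \<bullet> e)) * flat_exp 0 (real (Suc n) * ((q - x) \<bullet> e)))"

lemma box_bump_smooth: "smooth (box_bump p q n)"
proof -
  have "(\<lambda>x. \<Prod>e\<in>Basis. complex_of_real (flat_exp 0 (real (Suc n) * (x \<bullet> e) + (- real (Suc n) * (p \<bullet> e))))
      * complex_of_real (flat_exp 0 (- real (Suc n) * (x \<bullet> e) + real (Suc n) * (q \<bullet> e)))) \<in> flat_exp_algebra"
    by (intro flat_exp_algebra_prod flat_exp_algebra.mult flat_exp_algebra.gen)
  moreover have "box_bump p q n = (\<lambda>x. \<Prod>e\<in>Basis.
      complex_of_real (flat_exp 0 (real (Suc n) * (x \<bullet> e) + (- real (Suc n) * (p \<bullet> e))))
      * complex_of_real (flat_exp 0 (- real (Suc n) * (x \<bullet> e) + real (Suc n) * (q \<bullet> e))))"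
    unfolding box_bump_def of_real_prod of_real_mult
    by (intro ext prod.cong refl arg_cong2[where f = times] arg_cong[where f = "\<lambda>t. complex_of_real (flat_exp 0 t)"])
      (simp_all add: inner_diff_left algebra_simps)
  ultimately show ?thesis
    by (metis flat_exp_algebra_smooth)
qed

lemma box_bump_eq_0:
  assumes "x \<notin> box p q"
  shows "box_bump p q n x = 0"
proof -
  obtain e where e: "e \<in> Basis" "x \<bullet> e \<le> p \<bullet> e \<or> q \<bullet> e \<le> x \<bullet> e"
    using assms by (auto simp: mem_box not_less)
  then have "(x - p) \<bullet> e \<le> 0 \<or> (q - x) \<bullet> e \<le> 0"
    by (auto simp: inner_diff_left)
  then have "flat_exp 0 (real (Suc n) * ((x - p) \<bullet> e)) * flat_exp 0 (real (Suc n) * ((q - x) \<bullet> e)) = 0"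
    by (auto simp: flat_exp_def zero_less_mult_iff)
  then show ?thesis
    unfolding box_bump_def using e(1) by (auto intro!: prod_zero bexI[of _ e])
qed

lemma box_bump_norm_le: "cmod (box_bump p q n x) \<le> 1"
  unfolding box_bump_def norm_of_real abs_prod
  by (intro prod_le_1) (auto simp: abs_mult flat_exp_bounds intro!: mult_le_one)

lemma box_bump_limit:
  "(\<lambda>n. box_bump p q n x) \<longlonglongrightarrow> indicator (box p q) x"
proof (cases "x \<in> box p q")
  case True
  then have "0 < (x - p) \<bullet> e" "0 < (q - x) \<bullet> e" if "e \<in> Basis" for e
    using that by (auto simp: mem_box inner_diff_left)
  then have "(\<lambda>n. box_bump p q n x) \<longlonglongrightarrow> complex_of_real (\<Prod>e\<in>(Basis::'a set). 1 * 1)"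
    unfolding box_bump_def by (intro tendsto_of_real tendsto_prod tendsto_mult flat_exp_limit)
  then show ?thesis
    using True by simp
qed (simp add: box_bump_eq_0)

lemma box_bump_test_function: "cbox p q \<subseteq> D \<Longrightarrow> box_bump p q n \<in> test_functions D"
  by (rule test_functionsI[OF box_bump_smooth, of "cbox p q"])
    (use box_subset_cbox[of p q] in \<open>auto intro!: box_bump_eq_0\<close>)

section \<open>The fundamental lemma of the calculus of variations\<close>

lemma rep_L2_set_integrable:
  assumes S: "S \<in> lmeasurable"
  shows "set_integrable lebesgue S (rep_L2 w)"
  unfolding set_integrable_def
proof (rule Bochner_Integration.integrable_bound)
  show "integrable lebesgue (\<lambda>x. (cmod (rep_L2 w x))\<^sup>2 + indicat_real S x)"
    using S rep_L2_square_integrable[of w] by (simp add: lmeasurable_iff_integrable)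
  show "AE x in lebesgue. norm (indicat_real S x *\<^sub>R rep_L2 w x) \<le> norm ((cmod (rep_L2 w x))\<^sup>2 + indicat_real S x)"
  proof (rule AE_I2)
    fix x
    \<comment> \<open>The constant 1 is integrable over \<open>S\<close>, which has finite measure,
      so this bound makes the square integrable function integrable there.\<close>
    have "cmod (rep_L2 w x) \<le> (cmod (rep_L2 w x))\<^sup>2 + 1"
      using sum_squares_bound[of "cmod (rep_L2 w x)" 1] norm_ge_zero[of "rep_L2 w x"] by (simp del: norm_ge_zero)
    then show "norm (indicat_real S x *\<^sub>R rep_L2 w x) \<le> norm ((cmod (rep_L2 w x))\<^sup>2 + indicat_real S x)"
      by (simp add: indicator_def)
  qed
  show "(\<lambda>x. indicat_real S x *\<^sub>R rep_L2 w x) \<in> borel_measurable lebesgue"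
    using S by (intro borel_measurable_scaleR borel_measurable_indicator) auto
qed

text \<open>The integral over every box in \<open>D\<close> vanishes, by approximation of the indicator; apply the
  Lebesgue differentiation theorem.\<close>

lemma fundamental_lemma_calculus_of_variations:
  fixes D :: "'a::euclidean_space set"
  assumes "open D" and zero: "\<And>\<phi>. \<phi> \<in> test_functions D \<Longrightarrow> (\<integral>x. rep_L2 w x * \<phi> x \<partial>lebesgue) = 0"
  shows "AE x in lebesgue. x \<in> D \<longrightarrow> rep_L2 w x = 0"
proof -
  have box_zero: "integral (cbox p q) (rep_L2 w) = 0" if pq: "cbox p q \<subseteq> D" for p q
  proof -
    have int: "set_integrable lebesgue (box p q) (rep_L2 w)"
      by (rule rep_L2_set_integrable) simp
    have "(\<lambda>n. \<integral>x. rep_L2 w x * box_bump p q n x \<partial>lebesgue)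
        \<longlonglongrightarrow> (\<integral>x. indicat_real (box p q) x *\<^sub>R rep_L2 w x \<partial>lebesgue)"
    proof (rule integral_dominated_convergence)
      show "integrable lebesgue (\<lambda>x. cmod (indicat_real (box p q) x *\<^sub>R rep_L2 w x))"
        using int unfolding set_integrable_def by (rule integrable_norm)
      show "AE x in lebesgue. (\<lambda>n. rep_L2 w x * box_bump p q n x)
          \<longlonglongrightarrow> indicat_real (box p q) x *\<^sub>R rep_L2 w x"
      proof (rule AE_I2)
        fix x
        have "(\<lambda>n. rep_L2 w x * box_bump p q n x) \<longlonglongrightarrow> rep_L2 w x * indicator (box p q) x"
          by (intro tendsto_mult tendsto_const box_bump_limit)
        then show "(\<lambda>n. rep_L2 w x * box_bump p q n x) \<longlonglongrightarrow> indicat_real (box p q) x *\<^sub>R rep_L2 w x"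
          by (cases "x \<in> box p q") simp_all
      qed
      show "AE x in lebesgue. norm (rep_L2 w x * box_bump p q n x)
          \<le> cmod (indicat_real (box p q) x *\<^sub>R rep_L2 w x)" for n
      proof (rule AE_I2)
        fix x
        show "norm (rep_L2 w x * box_bump p q n x) \<le> cmod (indicat_real (box p q) x *\<^sub>R rep_L2 w x)"
          using box_bump_norm_le[of p q n x]
          by (cases "x \<in> box p q") (auto simp: norm_mult mult_left_le box_bump_eq_0)
      qed
      show "(\<lambda>x. rep_L2 w x * box_bump p q n x) \<in> borel_measurable lebesgue" for n
        by (intro borel_measurable_times rep_L2_measurable continuous_borel_measurable_lebesgue
            smooth_continuous box_bump_smooth)
    qed (use int in \<open>auto simp: set_integrable_def\<close>)
    then have "(LINT x : box p q | lebesgue. rep_L2 w x) = 0"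
      by (simp add: zero box_bump_test_function[OF pq] LIMSEQ_const_iff set_lebesgue_integral_def)
    then show ?thesis
      using set_lebesgue_integral_eq_integral(2)[OF int] integral_open_interval by metis
  qed
  have "rep_L2 w integrable_on cbox p q" for p q
    by (intro set_lebesgue_integral_eq_integral(1) rep_L2_set_integrable) simp
  \<comment> \<open>Lebesgue differentiation along the cubes with lower corner \<open>x\<close>. If
    \<open>rep_L2 w x\<close> were nonzero, the choice \<open>e = norm (rep_L2 w x)\<close> would
    contradict the vanishing of the averages.\<close>
  then obtain N where N: "negligible N" "\<And>x e. x \<notin> N \<Longrightarrow> 0 < e \<Longrightarrow> \<exists>d>0. \<forall>h. 0 < h \<and> h < d \<longrightarrow>
      norm (integral (cbox x (x + h *\<^sub>R One)) (rep_L2 w) /\<^sub>R h ^ DIM('a) - rep_L2 w x) < e"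
    using integrable_ccontinuous_explicit by blast
  have "rep_L2 w x = 0" if x: "x \<in> D" "x \<notin> N" for x
  proof (rule ccontr)
    assume "rep_L2 w x \<noteq> 0"
    then obtain d where d: "0 < d" "\<And>h. 0 < h \<Longrightarrow> h < d \<Longrightarrow>
        norm (integral (cbox x (x + h *\<^sub>R One)) (rep_L2 w) /\<^sub>R h ^ DIM('a) - rep_L2 w x) < norm (rep_L2 w x)"
      using N(2)[OF x(2), of "norm (rep_L2 w x)"] by auto
    obtain r where r: "0 < r" "ball x r \<subseteq> D"
      using \<open>open D\<close> x(1) open_contains_ball by blast
    \<comment> \<open>The cube has to lie in the ball of radius \<open>r\<close>; its points differ
      from \<open>x\<close> by at most \<open>h * DIM('a)\<close> in the 1-norm. The halves make
      both inequalities strict.\<close>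
    define h where "h = min (d / 2) (r / (2 * DIM('a)))"
    have h: "0 < h" "h < d" "h * DIM('a) < r"
      using d(1) r(1) by (auto simp: h_def min_def field_simps)
    have "cbox x (x + h *\<^sub>R One) \<subseteq> D"
    proof
      fix y
      assume y: "y \<in> cbox x (x + h *\<^sub>R One)"
      have "norm (y - x) \<le> (\<Sum>e\<in>Basis. \<bar>(y - x) \<bullet> e\<bar>)"
        by (rule norm_le_l1)
      also have "\<dots> \<le> (\<Sum>e\<in>(Basis :: 'a set). h)"
        using y by (intro sum_mono) (auto simp: mem_box inner_diff_left inner_add_left)
      also have "\<dots> < r"
        using h(3) by (simp add: mult.commute)
      finally show "y \<in> D"
        using r(2) by (auto simp: dist_norm norm_minus_commute)
    qed
    then show False
      using d(2)[OF h(1,2)] box_zero by simp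
  qed
  moreover have "AE x in lebesgue. x \<notin> N"
    using N(1) by (simp add: AE_not_in negligible_iff_null_sets)
  ultimately show ?thesis
    by (auto elim!: eventually_mono)
qed

subsection \<open>The distributional Laplacian\<close>

text \<open>The graph embedding turns the norm of \<open>H\<^sup>2\<^sub>0(D) \<oplus> L\<^sup>2(D)\<close> into the norm of a Banach space.\<close>

definition graph_embed :: "'a::euclidean_space set \<Rightarrow> 'a L2 \<times> 'a L2 \<Rightarrow> 'a L2 \<times> 'a L2 \<times> 'a L2" where
  "graph_embed D = (\<lambda>(u, v). (u, lap D u, v))"

lemma H20_sum_norm_graph_embed: "H20_sum_norm D x = norm (graph_embed D x)"
  by (cases x) (simp add: H20_sum_norm_def H20_norm_def graph_embed_def norm_prod_def add.assoc)

lemma H20_norm_eq: "H20_norm D u = norm (u, lap D u)"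
  by (simp add: H20_norm_def norm_prod_def)

lemma inj_graph_embed: "inj (graph_embed D)"
  by (auto simp: inj_on_def graph_embed_def)

context
  fixes D :: "'a::euclidean_space set"
  assumes open_D: "open D"
begin

lemma D_lebesgue: "D \<in> sets lebesgue"
  using open_D by simp

text \<open>Gives a meaning to the definite description in \<open>lap\<close>. The difference
  annihilates all test functions, hence vanishes almost everywhere in \<open>D\<close>, and
  membership in \<open>L2_on D\<close> settles the complement.\<close>

lemma distr_laplacian_unique:
  assumes "is_distr_laplacian D v w" "is_distr_laplacian D v w'" "w \<in> L2_on D" "w' \<in> L2_on D"
  shows "w = w'"
proof -
  have "(\<integral>x. rep_L2 (w + (- 1) *\<^sub>C w') x * \<phi> x \<partial>lebesgue) = 0" if "\<phi> \<in> test_functions D" for \<phi>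
    using assms(1,2) that test_functions_L2_fun(1)[OF that]
    by (simp add: L2_pairing_add L2_pairing_scaleC is_distr_laplacian_def)
  then have "AE x in lebesgue. x \<in> D \<longrightarrow> rep_L2 (w + (- 1) *\<^sub>C w') x = 0"
    by (rule fundamental_lemma_calculus_of_variations[OF open_D])
  moreover have "AE x in lebesgue. x \<notin> D \<longrightarrow> rep_L2 (w + (- 1) *\<^sub>C w') x = 0"
    using L2_on_add[OF assms(3) L2_on_scaleC[OF assms(4)]] by (simp add: L2_on_def)
  ultimately have "AE x in lebesgue. rep_L2 (w + (- 1) *\<^sub>C w') x = rep_L2 0 x"
    using rep_L2_zero by eventually_elim auto
  then have "w + (- 1) *\<^sub>C w' = 0"
    by (rule L2_eqI)
  then show ?thesis
    by (simp add: scaleC_minus_left scaleC_one)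
qed

lemma lap_eqI: "w \<in> L2_on D \<Longrightarrow> is_distr_laplacian D v w \<Longrightarrow> lap D v = w"
  unfolding lap_def by (rule the_equality) (auto intro: distr_laplacian_unique)

lemma lap_dom_lap:
  assumes "v \<in> lap_dom D"
  shows "v \<in> L2_on D" "lap D v \<in> L2_on D" "is_distr_laplacian D v (lap D v)"
  using assms lap_eqI by (auto simp: lap_dom_def)

lemma lap_domI:
  assumes "v \<in> L2_on D" "w \<in> L2_on D" "is_distr_laplacian D v w"
  shows "v \<in> lap_dom D" "lap D v = w"
  using assms lap_eqI by (auto simp: lap_dom_def)

lemma lap_add:
  assumes "u \<in> lap_dom D" "v \<in> lap_dom D"
  shows "u + v \<in> lap_dom D" "lap D (u + v) = lap D u + lap D v"
proof -
  have "is_distr_laplacian D (u + v) (lap D u + lap D v)"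
    using lap_dom_lap(3)[OF assms(1)] lap_dom_lap(3)[OF assms(2)]
    by (simp add: is_distr_laplacian_def L2_pairing_add test_functions_L2_fun)
  note lap_domI[OF _ _ this]
  then show "u + v \<in> lap_dom D" "lap D (u + v) = lap D u + lap D v"
    using lap_dom_lap[OF assms(1)] lap_dom_lap[OF assms(2)] by (simp_all add: L2_on_add)
qed

lemma lap_scaleC:
  assumes "u \<in> lap_dom D"
  shows "c *\<^sub>C u \<in> lap_dom D" "lap D (c *\<^sub>C u) = c *\<^sub>C lap D u"
proof -
  have "is_distr_laplacian D (c *\<^sub>C u) (c *\<^sub>C lap D u)"
    using lap_dom_lap(3)[OF assms]
    by (simp add: is_distr_laplacian_def L2_pairing_scaleC test_functions_L2_fun)
  note lap_domI[OF _ _ this]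
  then show "c *\<^sub>C u \<in> lap_dom D" "lap D (c *\<^sub>C u) = c *\<^sub>C lap D u"
    using lap_dom_lap[OF assms] by (simp_all add: L2_on_scaleC)
qed

lemma lap_diff:
  assumes "u \<in> lap_dom D" "v \<in> lap_dom D"
  shows "u - v \<in> lap_dom D" "lap D (u - v) = lap D u - lap D v"
  using lap_add[OF assms(1) lap_scaleC(1)[OF assms(2), of "- 1"]] lap_scaleC(2)[OF assms(2), of "- 1"]
  by (simp_all add: scaleC_minus_left scaleC_one)

lemma lap_zero: "0 \<in> lap_dom D" "lap D 0 = 0"
proof -
  have "is_distr_laplacian D 0 0"
    unfolding is_distr_laplacian_def
    using L2_pairing_scaleC[OF test_functions_L2_fun(1), of _ D 0 0]
      L2_pairing_scaleC[OF test_functions_L2_fun(2), of _ D 0 0] by simp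
  then show "0 \<in> lap_dom D" "lap D 0 = 0"
    using lap_domI[OF L2_on_zero L2_on_zero] by simp_all
qed

text \<open>For each fixed test function both sides of the defining identity are continuous in
  \<open>L\<^sup>2\<close>, so the identity survives the limit.\<close>

lemma lap_closed:
  assumes u: "\<And>n. u n \<in> lap_dom D" "u \<longlonglongrightarrow> v" "(\<lambda>n. lap D (u n)) \<longlonglongrightarrow> w"
  shows "v \<in> lap_dom D" "lap D v = w"
proof -
  have L2: "v \<in> L2_on D" "w \<in> L2_on D"
    using closed_sequentially[OF closed_L2_on[OF D_lebesgue] _ u(2)]
      closed_sequentially[OF closed_L2_on[OF D_lebesgue] _ u(3)] lap_dom_lap[OF u(1)] by auto
  have "is_distr_laplacian D v w"
    unfolding is_distr_laplacian_def
  proof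
    fix \<phi>
    assume \<phi>: "\<phi> \<in> test_functions D"
    have "(\<lambda>n. \<integral>x. rep_L2 (u n) x * laplacian \<phi> x \<partial>lebesgue) \<longlonglongrightarrow> (\<integral>x. rep_L2 v x * laplacian \<phi> x \<partial>lebesgue)"
      by (intro tendsto_L2_pairing test_functions_L2_fun[OF \<phi>] u)
    moreover have "(\<lambda>n. \<integral>x. rep_L2 (lap D (u n)) x * \<phi> x \<partial>lebesgue) \<longlonglongrightarrow> (\<integral>x. rep_L2 w x * \<phi> x \<partial>lebesgue)"
      by (intro tendsto_L2_pairing test_functions_L2_fun[OF \<phi>] u)
    moreover have "(\<integral>x. rep_L2 (u n) x * laplacian \<phi> x \<partial>lebesgue) = (\<integral>x. rep_L2 (lap D (u n)) x * \<phi> x \<partial>lebesgue)" for n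
      using lap_dom_lap(3)[OF u(1)] \<phi> by (simp add: is_distr_laplacian_def)
    ultimately show "(\<integral>x. rep_L2 v x * laplacian \<phi> x \<partial>lebesgue) = (\<integral>x. rep_L2 w x * \<phi> x \<partial>lebesgue)"
      by (simp add: LIMSEQ_unique)
  qed
  then show "v \<in> lap_dom D" "lap D v = w"
    using lap_domI[OF L2] by simp_all
qed

text \<open>\<open>H20_norm\<close> applies \<open>lap\<close> to the difference of a test function
  and \<open>u\<close>. Linearity of \<open>lap\<close> is available only on
  \<open>lap_dom D\<close>, so the test functions must be known to lie there.\<close>

lemma test_function_lap_dom:
  assumes \<phi>: "\<phi> \<in> test_functions D"
  shows "abs_L2 \<phi> \<in> lap_dom D"
proof -
  obtain K where K: "compact K" "K \<subseteq> D" "\<And>x. x \<notin> K \<Longrightarrow> \<phi> x = 0"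
    by (rule test_functionsE[OF \<phi>]) blast
  have zero: "\<phi> x = 0" "laplacian \<phi> x = 0" if "x \<notin> D" for x
    using K(2,3) laplacian_eq_0[of K \<phi> x, OF K(1) K(3)] that by blast+
  have L2: "abs_L2 \<phi> \<in> L2_on D" "abs_L2 (laplacian \<phi>) \<in> L2_on D"
    using rep_abs_L2[OF test_functions_L2_fun(1)[OF \<phi>]]
    unfolding L2_on_def mem_Collect_eq by (eventually_elim; simp add: zero)
      (use rep_abs_L2[OF test_functions_L2_fun(2)[OF \<phi>]] in \<open>eventually_elim; simp add: zero\<close>)
  have "is_distr_laplacian D (abs_L2 \<phi>) (abs_L2 (laplacian \<phi>))"
    unfolding is_distr_laplacian_def
    using \<phi> by (auto simp: L2_pairing_abs test_functions_L2_fun intro: laplacian_symmetric)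
  then show ?thesis
    using lap_domI(1)[OF L2] by simp
qed

section \<open>Linearity and closedness of \<open>H20 D\<close>\<close>

lemma H20_iff:
  "u \<in> H20 D \<longleftrightarrow> u \<in> lap_dom D \<and>
     (\<forall>e>0. \<exists>\<phi>\<in>test_functions D. H20_norm D (abs_L2 \<phi> - u) < e)"
proof
  assume "u \<in> H20 D"
  then obtain \<phi> where \<phi>: "u \<in> lap_dom D" "\<And>k::nat. \<phi> k \<in> test_functions D"
    "(\<lambda>k. H20_norm D (abs_L2 (\<phi> k) - u)) \<longlonglongrightarrow> 0"
    by (auto simp: H20_def)
  have "\<exists>\<psi>\<in>test_functions D. H20_norm D (abs_L2 \<psi> - u) < e" if "0 < e" for e
    using order_tendstoD(2)[OF \<phi>(3) that] \<phi>(2) by (auto simp: eventually_sequentially)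
  then show "u \<in> lap_dom D \<and> (\<forall>e>0. \<exists>\<phi>\<in>test_functions D. H20_norm D (abs_L2 \<phi> - u) < e)"
    using \<phi>(1) by blast
next
  assume u: "u \<in> lap_dom D \<and> (\<forall>e>0. \<exists>\<phi>\<in>test_functions D. H20_norm D (abs_L2 \<phi> - u) < e)"
  have "\<exists>\<phi>. \<phi> \<in> test_functions D \<and> H20_norm D (abs_L2 \<phi> - u) < 1 / Suc k" for k :: nat
    using u[THEN conjunct2, rule_format, of "1 / Suc k"] by auto
  then obtain \<phi> where \<phi>: "\<And>k::nat. \<phi> k \<in> test_functions D" "\<And>k. H20_norm D (abs_L2 (\<phi> k) - u) < 1 / Suc k"
    by metis
  have "(\<lambda>k. H20_norm D (abs_L2 (\<phi> k) - u)) \<longlonglongrightarrow> 0"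
    by (rule tendsto_sandwich[OF _ _ tendsto_const LIMSEQ_Suc[OF lim_1_over_n]])
      (use \<phi>(2) in \<open>auto simp: H20_norm_def intro!: always_eventually less_imp_le\<close>)
  then show "u \<in> H20 D"
    using u \<phi>(1) by (auto simp: H20_def)
qed

lemma H20_lap_dom: "u \<in> H20 D \<Longrightarrow> u \<in> lap_dom D"
  by (simp add: H20_def)

lemma H20_norm_triangle:
  assumes "u \<in> lap_dom D" "v \<in> lap_dom D"
  shows "H20_norm D (u + v) \<le> H20_norm D u + H20_norm D v"
  using norm_triangle_ineq[of "(u, lap D u)" "(v, lap D v)"]
  by (simp add: H20_norm_eq lap_add[OF assms])

lemma H20_norm_scaleC:
  assumes "u \<in> lap_dom D"
  shows "H20_norm D (c *\<^sub>C u) = cmod c * H20_norm D u"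
  using norm_scaleC[of c "(u, lap D u)"]
  by (simp add: H20_norm_eq lap_scaleC[OF assms] scaleC_prod_def)

lemma H20_add:
  assumes "u \<in> H20 D" "v \<in> H20 D"
  shows "u + v \<in> H20 D"
  unfolding H20_iff
proof (intro conjI allI impI)
  have uv: "u \<in> lap_dom D" "v \<in> lap_dom D"
    using assms by (auto dest: H20_lap_dom)
  then show "u + v \<in> lap_dom D"
    by (rule lap_add(1))
  fix e :: real
  assume "0 < e"
  then obtain \<phi> \<psi> where \<phi>: "\<phi> \<in> test_functions D" "H20_norm D (abs_L2 \<phi> - u) < e / 2"
    and \<psi>: "\<psi> \<in> test_functions D" "H20_norm D (abs_L2 \<psi> - v) < e / 2"
    using assms unfolding H20_iff by (meson half_gt_zero)
  have "abs_L2 (\<lambda>x. \<phi> x + \<psi> x) - (u + v) = (abs_L2 \<phi> - u) + (abs_L2 \<psi> - v)"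
    using \<phi>(1) \<psi>(1) by (simp add: abs_L2_add test_functions_L2_fun)
  also have "H20_norm D \<dots> \<le> H20_norm D (abs_L2 \<phi> - u) + H20_norm D (abs_L2 \<psi> - v)"
    using uv \<phi>(1) \<psi>(1) by (intro H20_norm_triangle lap_diff test_function_lap_dom)
  also have "\<dots> < e"
    using \<phi>(2) \<psi>(2) by simp
  finally show "\<exists>\<phi>\<in>test_functions D. H20_norm D (abs_L2 \<phi> - (u + v)) < e"
    using test_functions_add[OF \<phi>(1) \<psi>(1)] by blast
qed

lemma H20_scaleC:
  assumes "u \<in> H20 D"
  shows "c *\<^sub>C u \<in> H20 D"
  unfolding H20_iff
proof (intro conjI allI impI)
  have u: "u \<in> lap_dom D"
    using assms by (rule H20_lap_dom)
  then show "c *\<^sub>C u \<in> lap_dom D"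
    by (rule lap_scaleC(1))
  fix e :: real
  assume "0 < e"
  then have "0 < e / (cmod c + 1)"
    by (simp add: add_nonneg_pos)
  then obtain \<phi> where \<phi>: "\<phi> \<in> test_functions D" "H20_norm D (abs_L2 \<phi> - u) < e / (cmod c + 1)"
    using assms unfolding H20_iff by meson
  have "abs_L2 (\<lambda>x. c * \<phi> x) - c *\<^sub>C u = c *\<^sub>C (abs_L2 \<phi> - u)"
    using \<phi>(1) by (simp add: abs_L2_scaleC test_functions_L2_fun scaleC_diff_right)
  then have "H20_norm D (abs_L2 (\<lambda>x. c * \<phi> x) - c *\<^sub>C u) = cmod c * H20_norm D (abs_L2 \<phi> - u)"
    using u \<phi>(1) by (simp add: H20_norm_scaleC lap_diff test_function_lap_dom)
  also have "\<dots> \<le> cmod c * (e / (cmod c + 1))"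
    using \<phi>(2) by (intro mult_left_mono) auto
  also have "\<dots> < e"
  proof -
    have "cmod c * e < e * (cmod c + 1)"
      using \<open>0 < e\<close> by (simp add: distrib_left mult.commute)
    then show ?thesis
      by (simp add: pos_divide_less_eq add_nonneg_pos)
  qed
  finally show "\<exists>\<phi>\<in>test_functions D. H20_norm D (abs_L2 \<phi> - c *\<^sub>C u) < e"
    using test_functions_cmult[OF \<phi>(1)] by blast
qed

text \<open>A diagonal argument: half of the tolerance goes into choosing \<open>u n\<close> near
  \<open>v\<close>, half into a test function near \<open>u n\<close>.\<close>

lemma H20_closed:
  assumes u: "\<And>n. u n \<in> H20 D" "u \<longlonglongrightarrow> v" "(\<lambda>n. lap D (u n)) \<longlonglongrightarrow> w"
  shows "v \<in> H20 D" "lap D v = w"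
proof -
  have u_dom: "u n \<in> lap_dom D" for n
    using u(1) by (rule H20_lap_dom)
  note v = lap_closed[OF u_dom u(2,3)]
  then show "lap D v = w"
    by simp
  show "v \<in> H20 D"
    unfolding H20_iff
  proof (intro conjI allI impI)
    fix e :: real
    assume "0 < e"
    have "(\<lambda>n. norm (u n - v, lap D (u n) - w)) \<longlonglongrightarrow> norm (v - v, w - w)"
      by (intro tendsto_intros u(2,3))
    then have "(\<lambda>n. H20_norm D (u n - v)) \<longlonglongrightarrow> 0"
      by (simp add: H20_norm_eq lap_diff[OF u_dom v(1)] v(2) zero_prod_def[symmetric])
    from order_tendstoD(2)[OF this half_gt_zero[OF \<open>0 < e\<close>]]
    obtain n where n: "H20_norm D (u n - v) < e / 2"
      by (auto simp: eventually_sequentially)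
    obtain \<phi> where \<phi>: "\<phi> \<in> test_functions D" "H20_norm D (abs_L2 \<phi> - u n) < e / 2"
      using u(1) half_gt_zero[OF \<open>0 < e\<close>] unfolding H20_iff by meson
    have "H20_norm D ((abs_L2 \<phi> - u n) + (u n - v)) \<le> H20_norm D (abs_L2 \<phi> - u n) + H20_norm D (u n - v)"
      using u_dom v \<phi>(1) by (intro H20_norm_triangle lap_diff test_function_lap_dom)
    then show "\<exists>\<phi>\<in>test_functions D. H20_norm D (abs_L2 \<phi> - v) < e"
      using n \<phi> by (intro bexI[of _ \<phi>]) auto
  qed (rule v(1))
qed

lemma H20_zero: "0 \<in> H20 D"
proof -
  have "(\<lambda>_. 0) \<in> test_functions D"
    using test_functionsI[of "\<lambda>_. 0" "{}" D] flat_exp_algebra_smooth[OF flat_exp_algebra.const[of 0]] by simp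
  then show ?thesis
    unfolding H20_iff by (auto simp: lap_zero abs_L2_zero H20_norm_eq intro!: bexI[of _ "\<lambda>_. 0"])
qed

text \<open>Ensures that an integral of embedded values is again the embedding of an element of
  \<open>H20_sum D\<close>. Convergence of the triples is joint convergence of \<open>u\<close>,
  \<open>lap D u\<close> and \<open>v\<close>, to which the closedness of \<open>H20 D\<close> and
  of \<open>L2_on D\<close> applies.\<close>

lemma closed_graph_embed_H20_sum: "closed (graph_embed D ` H20_sum D)"
  unfolding closed_sequential_limits
proof (intro allI impI, elim conjE)
  fix f and l :: "'a L2 \<times> 'a L2 \<times> 'a L2"
  assume f: "\<forall>n. f n \<in> graph_embed D ` H20_sum D" and lim: "f \<longlonglongrightarrow> l"
  obtain v w z where l: "l = (v, w, z)"
    by (rule prod_cases3)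
  have "\<exists>x. x \<in> H20_sum D \<and> f n = graph_embed D x" for n
    using f by blast
  then obtain g where g: "\<And>n. g n \<in> H20_sum D" "\<And>n. f n = graph_embed D (g n)"
    by metis
  have f': "fst (f n) \<in> H20 D" "fst (snd (f n)) = lap D (fst (f n))" "snd (snd (f n)) \<in> L2_on D" for n
    using g(1)[of n] unfolding g(2) by (auto simp: graph_embed_def H20_sum_def)
  have lims: "(\<lambda>n. fst (f n)) \<longlonglongrightarrow> v" "(\<lambda>n. lap D (fst (f n))) \<longlonglongrightarrow> w" "(\<lambda>n. snd (snd (f n))) \<longlonglongrightarrow> z"
    using tendsto_fst[OF lim] tendsto_fst[OF tendsto_snd[OF lim]] tendsto_snd[OF tendsto_snd[OF lim]]
    unfolding f'(2) l by simp_all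
  have "z \<in> L2_on D"
    by (rule closed_sequentially[OF closed_L2_on[OF D_lebesgue] _ lims(3)]) (rule f'(3))
  then show "l \<in> graph_embed D ` H20_sum D"
    using H20_closed[OF f'(1) lims(1,2)] l
    by (intro image_eqI[of _ _ "(v, z)"]) (auto simp: graph_embed_def H20_sum_def)
qed

lemma graph_embed_add:
  assumes "x \<in> H20_sum D" "y \<in> H20_sum D"
  shows "x + y \<in> H20_sum D" "graph_embed D (x + y) = graph_embed D x + graph_embed D y"
proof -
  have H20: "fst x \<in> H20 D" "fst y \<in> H20 D" and L2: "snd x \<in> L2_on D" "snd y \<in> L2_on D"
    using assms by (auto simp: H20_sum_def)
  show "x + y \<in> H20_sum D"
    using H20_add[OF H20] L2_on_add[OF L2] by (simp add: H20_sum_def mem_Times_iff)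
  show "graph_embed D (x + y) = graph_embed D x + graph_embed D y"
    using lap_add(2)[OF H20[THEN H20_lap_dom]] by (simp add: graph_embed_def split_beta)
qed

lemma graph_embed_scaleC:
  assumes "x \<in> H20_sum D"
  shows "c *\<^sub>C x \<in> H20_sum D" "graph_embed D (c *\<^sub>C x) = c *\<^sub>C graph_embed D x"
proof -
  have H20: "fst x \<in> H20 D" and L2: "snd x \<in> L2_on D"
    using assms by (auto simp: H20_sum_def)
  show "c *\<^sub>C x \<in> H20_sum D"
    using H20_scaleC[OF H20] L2_on_scaleC[OF L2] by (simp add: H20_sum_def scaleC_prod_def)
  show "graph_embed D (c *\<^sub>C x) = c *\<^sub>C graph_embed D x"
    using lap_scaleC(2)[OF H20[THEN H20_lap_dom]]
    by (simp add: graph_embed_def split_beta scaleC_prod_def)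
qed

lemma graph_embed_diff:
  assumes "x \<in> H20_sum D" "y \<in> H20_sum D"
  shows "x - y \<in> H20_sum D" "graph_embed D (x - y) = graph_embed D x - graph_embed D y"
  using graph_embed_add[OF assms(1) graph_embed_scaleC(1)[OF assms(2), of "- 1"]]
    graph_embed_scaleC(2)[OF assms(2), of "- 1"]
  by (simp_all add: scaleC_minus_left scaleC_one)

lemma graph_embed_sum:
  assumes "\<And>i. i \<in> I \<Longrightarrow> f i \<in> H20_sum D"
  shows "(\<Sum>i\<in>I. f i) \<in> H20_sum D \<and> graph_embed D (\<Sum>i\<in>I. f i) = (\<Sum>i\<in>I. graph_embed D (f i))"
proof -
  have zero: "0 \<in> H20_sum D" "graph_embed D 0 = 0"
    unfolding zero_prod_def H20_sum_def graph_embed_def using H20_zero L2_on_zero lap_zero(2) by auto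
  show ?thesis
    using assms
  proof (induction I rule: infinite_finite_induct)
    case (insert i I)
    then show ?case
      using graph_embed_add[of "f i" "\<Sum>i\<in>I. f i"] by simp
  qed (simp_all add: zero)
qed

subsection \<open>Perturbation of the resolvent\<close>

lemma L2_sum_add: "x \<in> L2_sum D \<Longrightarrow> y \<in> L2_sum D \<Longrightarrow> x + y \<in> L2_sum D"
  by (auto simp: L2_sum_def intro: L2_on_add)

lemma L2_sum_diff: "x \<in> L2_sum D \<Longrightarrow> y \<in> L2_sum D \<Longrightarrow> x - y \<in> L2_sum D"
  by (auto simp: L2_sum_def intro: L2_on_diff)

lemma L2_sum_scaleC: "x \<in> L2_sum D \<Longrightarrow> c *\<^sub>C x \<in> L2_sum D"
  by (auto simp: L2_sum_def scaleC_prod_def intro: L2_on_scaleC)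

lemma L2_sum_zero: "0 \<in> L2_sum D"
  by (simp add: L2_sum_def zero_prod_def L2_on_zero)

lemma complete_L2_sum: "complete (L2_sum D)"
  unfolding L2_sum_def complete_eq_closed
  by (intro closed_Times closed_L2_on D_lebesgue)

lemma B_dom_add: "x \<in> B_dom D \<Longrightarrow> y \<in> B_dom D \<Longrightarrow> x + y \<in> B_dom D"
  by (auto simp: B_dom_def intro: H20_add lap_add(1))

lemma B_dom_scaleC: "x \<in> B_dom D \<Longrightarrow> c *\<^sub>C x \<in> B_dom D"
  by (auto simp: B_dom_def scaleC_prod_def intro: H20_scaleC lap_scaleC(1))

lemma B_dom_diff: "x \<in> B_dom D \<Longrightarrow> y \<in> B_dom D \<Longrightarrow> x - y \<in> B_dom D"
  using B_dom_add[of x "(- 1) *\<^sub>C y"] B_dom_scaleC[of y "- 1"]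
  by (simp add: scaleC_minus_left scaleC_one)

lemma B_dom_subset_H20_sum: "B_dom D \<subseteq> H20_sum D"
  unfolding B_dom_def H20_sum_def by (intro Sigma_mono order_refl subsetI) (rule lap_dom_lap(1))

lemma B_dom_subset_L2_sum: "B_dom D \<subseteq> L2_sum D"
  unfolding B_dom_def L2_sum_def
  by (intro Sigma_mono subsetI) (auto intro: lap_dom_lap(1) H20_lap_dom)

text \<open>In both cases \<open>A\<^sub>p = C\<^sub>p\<^sup>-\<^sup>1 B\<^sub>p\<close>, with \<open>C\<^sub>p = 1\<close> or \<open>C\<^sub>p = I\<^sub>p\<close>, so that \<open>A\<^sub>p - z\<close> may be
  replaced by the pencil \<open>B\<^sub>p - z C\<^sub>p\<close>. The part of the pencil that depends on \<open>p\<close> and \<open>z\<close> is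
  bounded on \<open>L\<^sup>2\<close>.\<close>

definition C_op :: "operator_kind \<Rightarrow> ('a \<Rightarrow> complex) \<Rightarrow> 'a L2 \<times> 'a L2 \<Rightarrow> 'a L2 \<times> 'a L2" where
  "C_op k p = (case k of Op_B \<Rightarrow> id | Op_IB \<Rightarrow> I_op D p)"

definition lower_op ::
  "operator_kind \<Rightarrow> ('a \<Rightarrow> complex) \<Rightarrow> complex \<Rightarrow> 'a L2 \<times> 'a L2 \<Rightarrow> 'a L2 \<times> 'a L2" where
  "lower_op k p z x = (mult_L2 D p (snd x), 0) - z *\<^sub>C C_op k p x"

definition pencil ::
  "operator_kind \<Rightarrow> ('a \<Rightarrow> complex) \<Rightarrow> complex \<Rightarrow> 'a L2 \<times> 'a L2 \<Rightarrow> 'a L2 \<times> 'a L2" where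
  "pencil k p z x = (lap D (fst x), lap D (snd x)) + lower_op k p z x"

lemma pencil_eq: "pencil k p z x = B_op D p x - z *\<^sub>C C_op k p x"
  by (simp add: pencil_def lower_op_def B_op_def split_beta)

lemma ess_bound_one_plus: "ess_bound D p M \<Longrightarrow> ess_bound D (\<lambda>x. 1 + p x) (1 + M)"
  using ess_bound_add[OF ess_bound_const[of D 1], of p M] by simp

lemma norm_pair_le: "norm (u, v) \<le> norm u + norm v"
  using sqrt_sum_squares_le_sum_abs[of "norm u" "norm v"] by (simp add: norm_prod_def)

lemma norm_fst_snd_le: "norm (fst x) \<le> norm x" "norm (snd x) \<le> norm x"
  by (auto simp: norm_prod_def)

lemma C_op_linear:
  assumes "ess_bound D p M"
  shows "C_op k p (x + y) = C_op k p x + C_op k p y" "C_op k p (c *\<^sub>C x) = c *\<^sub>C C_op k p x"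
  by (cases k; simp add: C_op_def I_op_def split_beta scaleC_prod_def
      mult_L2_add[OF D_lebesgue ess_bound_one_plus[OF assms]]
      mult_L2_scaleC[OF D_lebesgue ess_bound_one_plus[OF assms]])+

lemma C_op_L2_sum:
  assumes "ess_bound D p M" "x \<in> L2_sum D"
  shows "C_op k p x \<in> L2_sum D"
  using assms(2) mult_L2_in_L2_on[OF D_lebesgue ess_bound_one_plus[OF assms(1)]]
  by (cases k) (auto simp: C_op_def I_op_def L2_sum_def)

text \<open>One constant for both kinds: multiplication by \<open>1 + p\<close> contributes
  \<open>1 + M\<close> and the unchanged second component another 1.\<close>

lemma norm_C_op_le:
  assumes "ess_bound D p M"
  shows "norm (C_op k p x) \<le> (2 + M) * norm x"
proof (cases k)
  case Op_B
  have "0 \<le> M"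
    using assms by (simp add: ess_bound_def)
  then show ?thesis
    using Op_B mult_right_mono[of 1 "2 + M" "norm x"] by (simp add: C_op_def)
next
  case Op_IB
  have "0 \<le> M"
    using assms by (simp add: ess_bound_def)
  have "norm (C_op k p x) \<le> norm (mult_L2 D (\<lambda>x. 1 + p x) (fst x)) + norm (snd x)"
    using Op_IB norm_pair_le by (simp add: C_op_def I_op_def split_beta)
  also have "\<dots> \<le> (1 + M) * norm x + norm x"
    using norm_fst_snd_le[of x] \<open>0 \<le> M\<close>
    by (intro add_mono order_trans[OF norm_mult_L2[OF D_lebesgue ess_bound_one_plus[OF assms]]] mult_left_mono) auto
  finally show ?thesis
    by (simp add: algebra_simps)
qed

lemma norm_mult_L2_diff_le:
  assumes "ess_bound D p M" "ess_bound D q N" "ess_bound D (\<lambda>x. p x - q x) r"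
  shows "norm (mult_L2 D p f - mult_L2 D q f) \<le> r * norm f"
proof -
  have "mult_L2 D p f = mult_L2 D (\<lambda>x. p x - q x) f + mult_L2 D q f"
    using mult_L2_add_left[OF D_lebesgue assms(3,2), of f] by simp
  then show ?thesis
    using norm_mult_L2[OF D_lebesgue assms(3), of f] by simp
qed

lemma norm_C_op_diff_le:
  assumes "ess_bound D p M" "ess_bound D q N" "ess_bound D (\<lambda>x. p x - q x) r"
  shows "norm (C_op k p x - C_op k q x) \<le> r * norm x"
proof (cases k)
  case Op_B
  then show ?thesis
    using assms(3) by (simp add: C_op_def ess_bound_def)
next
  case Op_IB
  have "ess_bound D (\<lambda>x. (1 + p x) - (1 + q x)) r"
    using assms(3) by simp
  then have "norm (C_op k p x - C_op k q x) \<le> r * norm (fst x)"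
    using Op_IB norm_mult_L2_diff_le[OF ess_bound_one_plus[OF assms(1)] ess_bound_one_plus[OF assms(2)]]
    by (simp add: C_op_def I_op_def split_beta norm_Pair)
  also have "\<dots> \<le> r * norm x"
    using assms(3) by (intro mult_left_mono norm_fst_snd_le) (simp add: ess_bound_def)
  finally show ?thesis .
qed

lemma lower_op_linear:
  assumes "ess_bound D p M"
  shows "lower_op k p z (x + y) = lower_op k p z x + lower_op k p z y"
    "lower_op k p z (c *\<^sub>C x) = c *\<^sub>C lower_op k p z x"
  using C_op_linear[OF assms, of k] mult_L2_add[OF D_lebesgue assms] mult_L2_scaleC[OF D_lebesgue assms]
  by (simp_all add: lower_op_def scaleC_add_right scaleC_diff_right scaleC_scaleC mult.commute)
    (simp_all add: scaleC_prod_def)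

lemma lower_op_L2_sum:
  assumes "ess_bound D p M" "x \<in> L2_sum D"
  shows "lower_op k p z x \<in> L2_sum D"
  unfolding lower_op_def
  using mult_L2_in_L2_on[OF D_lebesgue assms(1)] L2_on_zero
  by (intro L2_sum_diff L2_sum_scaleC C_op_L2_sum[OF assms]) (auto simp: L2_sum_def)

lemma norm_lower_op_le:
  assumes "ess_bound D p M"
  shows "norm (lower_op k p z x) \<le> (M + cmod z * (2 + M)) * norm x"
proof -
  have "0 \<le> M"
    using assms by (simp add: ess_bound_def)
  have "norm (lower_op k p z x) \<le> norm (mult_L2 D p (snd x), 0 :: 'a L2) + norm (z *\<^sub>C C_op k p x)"
    unfolding lower_op_def by (rule norm_triangle_ineq4)
  also have "\<dots> \<le> M * norm x + cmod z * ((2 + M) * norm x)"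
  proof (rule add_mono)
    show "norm (mult_L2 D p (snd x), 0 :: 'a L2) \<le> M * norm x"
      using order_trans[OF norm_mult_L2[OF D_lebesgue assms] mult_left_mono[OF norm_fst_snd_le(2) \<open>0 \<le> M\<close>]]
      by (simp add: norm_Pair)
    show "norm (z *\<^sub>C C_op k p x) \<le> cmod z * ((2 + M) * norm x)"
      unfolding norm_scaleC by (intro mult_left_mono norm_C_op_le[OF assms]) auto
  qed
  finally show ?thesis
    by (simp add: algebra_simps)
qed

lemma norm_lower_op_diff_le:
  assumes p: "ess_bound D p M" and q: "ess_bound D q N" and pq: "ess_bound D (\<lambda>x. p x - q x) r"
  shows "norm (lower_op k p z x - lower_op k q w x) \<le> (r + cmod (z - w) * (2 + M) + cmod w * r) * norm x"
proof -
  \<comment> \<open>The products are split by inserting \<open>w *\<^sub>C C_op k p x\<close>. In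
    this way only the bound of \<open>p\<close> and the modulus of \<open>w\<close> enter, besides
    the differences.\<close>
  have "lower_op k p z x - lower_op k q w x = (mult_L2 D p (snd x) - mult_L2 D q (snd x), 0)
      - ((z - w) *\<^sub>C C_op k p x + w *\<^sub>C (C_op k p x - C_op k q x))"
    by (simp add: lower_op_def scaleC_diff_left scaleC_diff_right)
  also have "norm \<dots> \<le> norm (mult_L2 D p (snd x) - mult_L2 D q (snd x), 0 :: 'a L2)
      + (norm ((z - w) *\<^sub>C C_op k p x) + norm (w *\<^sub>C (C_op k p x - C_op k q x)))"
    by (rule order_trans[OF norm_triangle_ineq4 add_left_mono[OF norm_triangle_ineq]])
  also have "\<dots> \<le> r * norm x + (cmod (z - w) * ((2 + M) * norm x) + cmod w * (r * norm x))"
  proof (intro add_mono)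
    have "0 \<le> r"
      using pq by (simp add: ess_bound_def)
    then show "norm (mult_L2 D p (snd x) - mult_L2 D q (snd x), 0 :: 'a L2) \<le> r * norm x"
      using order_trans[OF norm_mult_L2_diff_le[OF p q pq] mult_left_mono[OF norm_fst_snd_le(2)]]
      by (simp add: norm_Pair)
    show "norm ((z - w) *\<^sub>C C_op k p x) \<le> cmod (z - w) * ((2 + M) * norm x)"
      unfolding norm_scaleC by (intro mult_left_mono norm_C_op_le[OF p]) auto
    show "norm (w *\<^sub>C (C_op k p x - C_op k q x)) \<le> cmod w * (r * norm x)"
      unfolding norm_scaleC by (intro mult_left_mono norm_C_op_diff_le[OF p q pq]) auto
  qed
  finally show ?thesis
    by (simp add: algebra_simps)
qed

lemma pencil_linear:
  assumes p: "ess_bound D p M" and "x \<in> B_dom D" "y \<in> B_dom D"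
  shows "pencil k p z (x + y) = pencil k p z x + pencil k p z y"
    "pencil k p z (c *\<^sub>C x) = c *\<^sub>C pencil k p z x"
    "pencil k p z (x - y) = pencil k p z x - pencil k p z y"
proof -
  have dom: "fst x \<in> lap_dom D" "snd x \<in> lap_dom D" if "x \<in> B_dom D" for x
    using that H20_lap_dom by (auto simp: B_dom_def)
  have add: "pencil k p z (x + y) = pencil k p z x + pencil k p z y"
    if "x \<in> B_dom D" "y \<in> B_dom D" for x y
    using dom[OF that(1)] dom[OF that(2)] by (simp add: pencil_def lower_op_linear[OF p] lap_add)
  have scale: "pencil k p z (c *\<^sub>C x) = c *\<^sub>C pencil k p z x" if "x \<in> B_dom D" for c x
    using dom[OF that]
    by (simp add: pencil_def lower_op_linear[OF p] scaleC_add_right) (simp add: scaleC_prod_def lap_scaleC)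
  show "pencil k p z (x + y) = pencil k p z x + pencil k p z y" "pencil k p z (c *\<^sub>C x) = c *\<^sub>C pencil k p z x"
    using add scale assms(2,3) by auto
  show "pencil k p z (x - y) = pencil k p z x - pencil k p z y"
    using add[OF assms(2) B_dom_scaleC[OF assms(3), of "- 1"]] scale[OF assms(3), of "- 1"]
    by (simp add: scaleC_minus_left scaleC_one)
qed

lemma pencil_L2_sum:
  assumes p: "ess_bound D p M" and "x \<in> B_dom D"
  shows "pencil k p z x \<in> L2_sum D"
proof -
  have "(lap D (fst x), lap D (snd x)) \<in> L2_sum D"
    using assms(2) lap_dom_lap(2) H20_lap_dom by (auto simp: B_dom_def L2_sum_def)
  then show ?thesis
    unfolding pencil_def using B_dom_subset_L2_sum assms(2)
    by (intro L2_sum_add lower_op_L2_sum[OF p]) auto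
qed

text \<open>Of the three entries only \<open>lap D (fst x)\<close> is not controlled by
  \<open>norm x\<close>. It is the first component of
  \<open>pencil k p z x - lower_op k p z x\<close>, whose second term is bounded on
  \<open>L\<^sup>2\<close>.\<close>

lemma norm_graph_embed_le:
  assumes p: "ess_bound D p M"
  shows "norm (graph_embed D x) \<le> norm (pencil k p z x) + (1 + M + cmod z * (2 + M)) * norm x"
proof -
  have "norm (graph_embed D x) = norm ((fst x, 0, snd x) + (0, lap D (fst x), 0 :: 'a L2))"
    by (simp add: graph_embed_def split_beta)
  also have "\<dots> \<le> norm (fst x, 0 :: 'a L2, snd x) + norm (0 :: 'a L2, lap D (fst x), 0 :: 'a L2)"
    by (rule norm_triangle_ineq)
  also have "\<dots> = norm x + norm (fst (pencil k p z x - lower_op k p z x))"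
    by (cases x) (simp add: norm_prod_def pencil_def)
  also have "norm (fst (pencil k p z x - lower_op k p z x)) \<le> norm (pencil k p z x) + norm (lower_op k p z x)"
    by (rule order_trans[OF norm_fst_snd_le(1) norm_triangle_ineq4])
  also have "norm (lower_op k p z x) \<le> (M + cmod z * (2 + M)) * norm x"
    by (rule norm_lower_op_le[OF p])
  finally show ?thesis
    by (simp add: algebra_simps)
qed

section \<open>Stability of invertibility with a quantitative bound\<close>

definition regular_pencil :: "real \<Rightarrow> operator_kind \<Rightarrow> ('a \<Rightarrow> complex) \<Rightarrow> complex \<Rightarrow> bool" where
  "regular_pencil K k p z \<longleftrightarrow> bij_betw (pencil k p z) (B_dom D) (L2_sum D) \<and> 0 \<le> K \<and>
     (\<forall>x\<in>B_dom D. norm x \<le> K * norm (pencil k p z x))"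

lemma regular_pencil_mono: "regular_pencil K k p z \<Longrightarrow> K \<le> L \<Longrightarrow> regular_pencil L k p z"
  unfolding regular_pencil_def by (meson mult_right_mono norm_ge_zero order_trans)

text \<open>With \<open>G\<close> the inverse of the old pencil and \<open>S\<close> the
  perturbation, solving the new equation by \<open>x = G f\<close> means
  \<open>f = y - S (G f)\<close>, and the right-hand side contracts with factor
  \<open>K * s \<le> 1 / 2\<close>. The new constant is \<open>K / (1 - K * s)\<close> at
  worst.\<close>

lemma regular_pencil_perturb:
  assumes p: "ess_bound D p M" and q: "ess_bound D q N"
    and reg: "regular_pencil K k p z"
    and s: "\<And>x. norm (lower_op k q w x - lower_op k p z x) \<le> s * norm x" "K * s \<le> 1 / 2" "0 \<le> s"
  shows "regular_pencil (2 * K) k q w"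
proof -
  define S where "S x = lower_op k q w x - lower_op k p z x" for x
  have pencil_q: "pencil k q w x = pencil k p z x + S x" for x
    by (simp add: pencil_def S_def)
  have bij: "bij_betw (pencil k p z) (B_dom D) (L2_sum D)" and "0 \<le> K"
    and K: "\<And>x. x \<in> B_dom D \<Longrightarrow> norm x \<le> K * norm (pencil k p z x)"
    using reg by (auto simp: regular_pencil_def)
  \<comment> \<open>The perturbation costs at most half of \<open>norm x\<close>, which is absorbed
    on the left; this doubles the constant.\<close>
  have bound: "norm x \<le> 2 * K * norm (pencil k q w x)" if "x \<in> B_dom D" for x
  proof -
    have "norm (pencil k p z x) \<le> norm (pencil k q w x) + norm (S x)"
      using norm_triangle_ineq4[of "pencil k q w x" "S x"] by (simp add: pencil_q)
    then have "norm (pencil k p z x) \<le> norm (pencil k q w x) + s * norm x"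
      using s(1)[of x] by (simp add: S_def)
    then have "norm x \<le> K * (norm (pencil k q w x) + s * norm x)"
      using K[OF that] mult_left_mono[OF _ \<open>0 \<le> K\<close>] by (meson order_trans)
    also have "\<dots> \<le> K * norm (pencil k q w x) + 1 / 2 * norm x"
      using mult_right_mono[OF s(2) norm_ge_zero[of x]] by (simp add: algebra_simps)
    finally show ?thesis
      by simp
  qed
  have "inj_on (pencil k q w) (B_dom D)"
  proof (rule inj_onI)
    fix x y
    assume xy: "x \<in> B_dom D" "y \<in> B_dom D" "pencil k q w x = pencil k q w y"
    then have "norm (x - y) \<le> 0"
      using bound[OF B_dom_diff[OF xy(1,2)]] pencil_linear(3)[OF q xy(1,2)] by simp
    then show "x = y"
      by simp
  qed
  moreover have "pencil k q w ` B_dom D = L2_sum D"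
  proof
    show "pencil k q w ` B_dom D \<subseteq> L2_sum D"
      using pencil_L2_sum[OF q] by auto
    show "L2_sum D \<subseteq> pencil k q w ` B_dom D"
    proof
      fix y
      assume y: "y \<in> L2_sum D"
      define G where "G = inv_into (B_dom D) (pencil k p z)"
      have G: "G f \<in> B_dom D" "pencil k p z (G f) = f" if "f \<in> L2_sum D" for f
        using that bij unfolding G_def bij_betw_def by (auto simp: inv_into_into f_inv_into_f)
      \<comment> \<open>The iteration runs over right-hand sides and not over solutions in
        \<open>B_dom D\<close>, because \<open>L2_sum D\<close> is complete in the ambient
        norm.\<close>
      have "\<exists>!f\<in>L2_sum D. y - S (G f) = f"
      proof (rule Banach_fix)
        show "complete (L2_sum D)"
          by (rule complete_L2_sum)
        show "L2_sum D \<noteq> {}"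
          using L2_sum_zero by blast
        show "(\<lambda>f. y - S (G f)) ` L2_sum D \<subseteq> L2_sum D"
        proof (rule image_subsetI)
          fix f
          assume "f \<in> L2_sum D"
          then have "G f \<in> L2_sum D"
            using G(1) B_dom_subset_L2_sum by blast
          then show "y - S (G f) \<in> L2_sum D"
            unfolding S_def by (intro L2_sum_diff y lower_op_L2_sum[OF p] lower_op_L2_sum[OF q])
        qed
        fix f g
        assume fg: "f \<in> L2_sum D" "g \<in> L2_sum D"
        have "S (u + v) = S u + S v" for u v
          by (simp add: S_def lower_op_linear[OF p] lower_op_linear[OF q])
        from this[of "G f - G g" "G g"] have "dist (y - S (G f)) (y - S (G g)) = norm (S (G f - G g))"
          by (simp add: dist_norm norm_minus_commute)
        also have "\<dots> \<le> s * norm (G f - G g)"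
          using s(1) by (simp add: S_def)
        also have "\<dots> \<le> s * (K * norm (f - g))"
          using K[OF B_dom_diff[OF G(1)[OF fg(1)] G(1)[OF fg(2)]]]
            pencil_linear(3)[OF p G(1)[OF fg(1)] G(1)[OF fg(2)]] G(2)[OF fg(1)] G(2)[OF fg(2)] s(3)
          by (intro mult_left_mono) auto
        also have "\<dots> \<le> 1 / 2 * dist f g"
          using mult_right_mono[OF s(2) norm_ge_zero[of "f - g"]] by (simp add: dist_norm algebra_simps)
        finally show "dist (y - S (G f)) (y - S (G g)) \<le> 1 / 2 * dist f g" .
      qed auto
      then obtain f where f: "f \<in> L2_sum D" "y - S (G f) = f"
        by blast
      then have "y = pencil k q w (G f)"
        unfolding pencil_q by (simp add: G(2) algebra_simps)
      then show "y \<in> pencil k q w ` B_dom D"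
        using G(1)[OF f(1)] by blast
    qed
  qed
  ultimately show ?thesis
    using bound \<open>0 \<le> K\<close> by (auto simp: regular_pencil_def bij_betw_def)
qed

lemma regular_pencil_local:
  assumes m: "ess_bound D m M" and reg: "regular_pencil K k m z"
  obtains r where "0 < r" "\<And>p N w. ess_bound D p N \<Longrightarrow> ess_bound D (\<lambda>x. p x - m x) r \<Longrightarrow> cmod (w - z) < r \<Longrightarrow>
    regular_pencil (2 * K) k p w"
proof -
  have "0 \<le> M" "0 \<le> K"
    using m reg by (auto simp: ess_bound_def regular_pencil_def)
  \<comment> \<open>Collects the coefficients of \<open>r\<close> in the difference estimate: 1,
    then \<open>2 + M\<close> from \<open>cmod (z - w)\<close>, and \<open>cmod z + 1\<close> as a
    bound for \<open>cmod w\<close>, which is where \<open>r \<le> 1\<close> enters.\<close>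
  define c where "c = 4 + M + cmod z"
  have "0 < c"
    using \<open>0 \<le> M\<close> by (simp add: c_def add_pos_nonneg)
  \<comment> \<open>Chosen for \<open>K * (r * c) \<le> 1 / 2\<close>; \<open>K + 1\<close> replaces
    \<open>K\<close> because \<open>K\<close> may be zero.\<close>
  define r where "r = min 1 (1 / (2 * (K + 1) * c))"
  have r: "0 < r" "r \<le> 1" "r \<le> 1 / (2 * (K + 1) * c)"
    using \<open>0 \<le> K\<close> \<open>0 < c\<close> by (auto simp: r_def)
  have "K * (r * c) \<le> K * (1 / (2 * (K + 1) * c) * c)"
    using r(3) \<open>0 \<le> K\<close> \<open>0 < c\<close> by (intro mult_left_mono mult_right_mono) auto
  also have "\<dots> \<le> 1 / 2"
    using \<open>0 \<le> K\<close> \<open>0 < c\<close> by (simp add: divide_simps)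
  finally have Krc: "K * (r * c) \<le> 1 / 2" .
  show ?thesis
  proof (rule that[OF r(1)])
    fix p N w
    assume p: "ess_bound D p N" and pm: "ess_bound D (\<lambda>x. p x - m x) r" and w: "cmod (w - z) < r"
    \<comment> \<open>Subtracting in this order puts \<open>m\<close> first in the estimate, so that
      the bound of the fixed \<open>m\<close> enters it and the arbitrary bound \<open>N\<close> of
      \<open>p\<close> does not.\<close>
    have mp: "ess_bound D (\<lambda>x. m x - p x) r"
      using pm borel_measurable_uminus[of "\<lambda>x. p x - m x" "lebesgue_on D"]
      by (simp add: ess_bound_def norm_minus_commute)
    show "regular_pencil (2 * K) k p w"
    proof (rule regular_pencil_perturb[OF m p reg _ Krc])
      fix x
      have "norm (lower_op k p w x - lower_op k m z x) \<le> (r + cmod (z - w) * (2 + M) + cmod w * r) * norm x"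
        using norm_lower_op_diff_le[OF m p mp, of k z x w] by (simp add: norm_minus_commute)
      also have "\<dots> \<le> (r * c) * norm x"
      proof (rule mult_right_mono)
        have "cmod w \<le> cmod z + 1"
          using norm_triangle_ineq[of z "w - z"] w r(2) by simp
        then have "cmod w * r \<le> (cmod z + 1) * r"
          using r(1) by (intro mult_right_mono) auto
        moreover have "cmod (z - w) * (2 + M) \<le> r * (2 + M)"
          using w \<open>0 \<le> M\<close> by (intro mult_right_mono) (auto simp: norm_minus_commute)
        ultimately show "r + cmod (z - w) * (2 + M) + cmod w * r \<le> r * c"
          by (simp add: c_def algebra_simps)
      qed simp
      finally show "norm (lower_op k p w x - lower_op k m z x) \<le> (r * c) * norm x" .
    qed (use r(1) \<open>0 < c\<close> in simp)
  qed
qed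

text \<open>Local radii and constants at each point of \<Gamma> are reduced by a finite subcover to
  the smallest radius and the largest constant.\<close>

lemma regular_pencil_uniform:
  assumes m: "ess_bound D m M" and "compact \<Gamma>" and reg: "\<And>z. z \<in> \<Gamma> \<Longrightarrow> \<exists>K. regular_pencil K k m z"
  obtains r K where "0 < r" "\<And>p N z. z \<in> \<Gamma> \<Longrightarrow> ess_bound D p N \<Longrightarrow> ess_bound D (\<lambda>x. p x - m x) r \<Longrightarrow>
    regular_pencil K k p z"
proof -
  define Q where "Q z K r \<longleftrightarrow> 0 < r \<and> (\<forall>p N w. ess_bound D p N \<longrightarrow> ess_bound D (\<lambda>x. p x - m x) r \<longrightarrow>
      cmod (w - z) < r \<longrightarrow> regular_pencil K k p w)" for z K r
  have "\<exists>K r. Q z K r" if z: "z \<in> \<Gamma>" for z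
  proof -
    obtain K where "regular_pencil K k m z"
      using reg[OF z] by blast
    from regular_pencil_local[OF m this] show ?thesis
      unfolding Q_def by metis
  qed
  then obtain K r where "\<And>z. z \<in> \<Gamma> \<Longrightarrow> Q z (K z) (r z)"
    by metis
  then have Kr: "\<And>z. z \<in> \<Gamma> \<Longrightarrow> 0 < r z" "\<And>z p N w. z \<in> \<Gamma> \<Longrightarrow> ess_bound D p N \<Longrightarrow>
      ess_bound D (\<lambda>x. p x - m x) (r z) \<Longrightarrow> cmod (w - z) < r z \<Longrightarrow> regular_pencil (K z) k p w"
    unfolding Q_def by blast+
  have "\<Gamma> \<subseteq> (\<Union>z\<in>\<Gamma>. ball z (r z))"
    using Kr(1) by force
  then obtain F where F: "F \<subseteq> \<Gamma>" "finite F" "\<Gamma> \<subseteq> (\<Union>z\<in>F. ball z (r z))"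
    using compactE_image[OF \<open>compact \<Gamma>\<close>, of \<Gamma> "\<lambda>z. ball z (r z)"] by blast
  \<comment> \<open>The inserted elements 1 and 0 keep minimum and maximum meaningful when the
    subcover is empty.\<close>
  define r0 where "r0 = Min (insert 1 (r ` F))"
  define K0 where "K0 = Max (insert 0 (K ` F))"
  show ?thesis
  proof (rule that[of r0 K0])
    show "0 < r0"
      using F(1,2) Kr(1) by (auto simp: r0_def)
    fix p N z
    assume z: "z \<in> \<Gamma>" and p: "ess_bound D p N" "ess_bound D (\<lambda>x. p x - m x) r0"
    obtain y where y: "y \<in> F" "cmod (z - y) < r y"
      using F(3) z by (auto simp: dist_norm norm_minus_commute)
    have "r0 \<le> r y" "K y \<le> K0"
      using F(2) y(1) by (auto simp: r0_def K0_def)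
    then show "regular_pencil K0 k p z"
      using Kr(2)[OF _ p(1) ess_bound_mono[OF p(2)] y(2)] y(1) F(1) regular_pencil_mono by blast
  qed
qed

section \<open>From the pencil back to the resolvent\<close>

definition admissible :: "operator_kind \<Rightarrow> ('a \<Rightarrow> complex) \<Rightarrow> bool" where
  "admissible k p \<longleftrightarrow> (k = Op_IB \<longrightarrow> (\<exists>\<delta>>0. AE x in lebesgue_on D. Re (1 + p x) > \<delta>))"

text \<open>For \<open>Op_IB\<close> the inverse multiplies the first component by
  \<open>1 / (1 + p)\<close>, which is essentially bounded by \<open>1 / \<delta>\<close> since the
  modulus of \<open>1 + p\<close> is at least its real part; the second component adds 1 to the
  constant.\<close>

lemma C_op_bij:
  assumes p: "ess_bound D p M" and adm: "admissible k p"
  obtains L where "bij_betw (C_op k p) (L2_sum D) (L2_sum D)"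
    "\<And>x. x \<in> L2_sum D \<Longrightarrow> norm x \<le> L * norm (C_op k p x)"
proof (cases k)
  case Op_B
  show ?thesis
    by (rule that[of 1]) (simp_all add: Op_B C_op_def)
next
  case Op_IB
  then obtain \<delta> where \<delta>: "0 < \<delta>" "AE x in lebesgue_on D. Re (1 + p x) > \<delta>"
    using adm by (auto simp: admissible_def)
  define q where "q x = 1 / (1 + p x)" for x
  have AE_q: "AE x in lebesgue_on D. cmod (q x) \<le> 1 / \<delta>" "AE x in lebesgue_on D. q x * (1 + p x) = 1"
    "AE x in lebesgue_on D. (1 + p x) * q x = 1"
  proof -
    have "cmod (q x) \<le> 1 / \<delta> \<and> q x * (1 + p x) = 1" if "Re (1 + p x) > \<delta>" for x
    proof -
      have "\<delta> < cmod (1 + p x)"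
        using that complex_Re_le_cmod[of "1 + p x"] by (rule less_le_trans)
      then have "1 + p x \<noteq> 0"
        using \<delta>(1) by (metis less_asym norm_zero)
      with \<open>\<delta> < cmod (1 + p x)\<close> show ?thesis
        using \<delta>(1) by (simp add: q_def norm_divide frac_le)
    qed
    with \<delta>(2) show "AE x in lebesgue_on D. cmod (q x) \<le> 1 / \<delta>" "AE x in lebesgue_on D. q x * (1 + p x) = 1"
      "AE x in lebesgue_on D. (1 + p x) * q x = 1"
      by (auto elim!: eventually_mono simp: mult.commute)
  qed
  have q: "ess_bound D q (1 / \<delta>)"
    using AE_q(1) \<delta>(1) ess_bound_one_plus[OF p] unfolding ess_bound_def q_def by auto
  define J where "J x = (mult_L2 D q (fst x), snd x)" for x :: "'a L2 \<times> 'a L2"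
  have J: "J x \<in> L2_sum D" "J (C_op k p x) = x" "C_op k p (J x) = x" if "x \<in> L2_sum D" for x
    using that Op_IB mult_L2_in_L2_on[OF D_lebesgue q]
      mult_L2_mult_L2_cancel[OF D_lebesgue q ess_bound_one_plus[OF p] _ AE_q(2)]
      mult_L2_mult_L2_cancel[OF D_lebesgue ess_bound_one_plus[OF p] q _ AE_q(3)]
    by (auto simp: J_def C_op_def I_op_def L2_sum_def)
  have norm_J: "norm (J x) \<le> (1 / \<delta> + 1) * norm x" for x
  proof -
    have "norm (J x) \<le> norm (mult_L2 D q (fst x)) + norm (snd x)"
      unfolding J_def by (rule norm_pair_le)
    also have "\<dots> \<le> 1 / \<delta> * norm x + norm x"
      by (intro add_mono norm_fst_snd_le order_trans[OF norm_mult_L2[OF D_lebesgue q]] mult_left_mono)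
        (use \<delta>(1) in simp)
    finally show ?thesis
      by (simp add: distrib_right)
  qed
  show ?thesis
  proof (rule that[of "1 / \<delta> + 1"])
    show "bij_betw (C_op k p) (L2_sum D) (L2_sum D)"
      by (rule bij_betw_byWitness[of _ J]) (auto simp: J C_op_L2_sum[OF p])
    show "norm x \<le> (1 / \<delta> + 1) * norm (C_op k p x)" if "x \<in> L2_sum D" for x
      using norm_J[of "C_op k p x"] by (simp only: J(2)[OF that])
  qed
qed

lemma A_op_defined:
  assumes "p \<in> Linf D" "ess_bound D p M" "admissible k p"
  shows "A_op_defined k D p"
  using assms C_op_bij[OF assms(2,3)] by (cases k) (auto simp: C_op_def)

text \<open>Applying \<open>C_op\<close> cancels the \<open>inv_into\<close> in \<open>A_op\<close>,
  legitimately because \<open>B_op D p x\<close> lies in \<open>L2_sum D\<close>, the range of the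
  bijection; the term with \<open>z\<close> follows by linearity.\<close>

lemma C_op_A_op:
  assumes p: "ess_bound D p M" and adm: "admissible k p" and x: "x \<in> B_dom D"
  shows "A_op k D p x - z *\<^sub>C x \<in> L2_sum D" "C_op k p (A_op k D p x - z *\<^sub>C x) = pencil k p z x"
proof -
  obtain L where bij: "bij_betw (C_op k p) (L2_sum D) (L2_sum D)"
    using C_op_bij[OF p adm] by metis
  have x': "x \<in> L2_sum D"
    using x B_dom_subset_L2_sum by blast
  have "B_op D p x = pencil k p 0 x"
    by (simp add: pencil_eq)
  then have "B_op D p x \<in> L2_sum D"
    using pencil_L2_sum[OF p x] by simp
  then have A: "A_op k D p x \<in> L2_sum D" "C_op k p (A_op k D p x) = B_op D p x"
    using bij by (cases k; simp add: C_op_def bij_betw_def inv_into_into f_inv_into_f)+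
  show "A_op k D p x - z *\<^sub>C x \<in> L2_sum D"
    by (intro L2_sum_diff L2_sum_scaleC A x')
  have "C_op k p (A_op k D p x + (- z) *\<^sub>C x) = B_op D p x + (- z) *\<^sub>C C_op k p x"
    by (simp only: C_op_linear[OF p] A(2))
  then show "C_op k p (A_op k D p x - z *\<^sub>C x) = pencil k p z x"
    by (simp add: pencil_eq scaleC_minus_left)
qed

lemma bij_pencil_iff:
  assumes p: "ess_bound D p M" and adm: "admissible k p"
  shows "bij_betw (\<lambda>x. A_op k D p x - z *\<^sub>C x) (B_dom D) (L2_sum D) \<longleftrightarrow>
    bij_betw (pencil k p z) (B_dom D) (L2_sum D)"
proof -
  obtain L where "bij_betw (C_op k p) (L2_sum D) (L2_sum D)"
    using C_op_bij[OF p adm] by metis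
  moreover have "(\<lambda>x. A_op k D p x - z *\<^sub>C x) ` B_dom D \<subseteq> L2_sum D"
    using C_op_A_op(1)[OF p adm] by auto
  ultimately have "bij_betw (\<lambda>x. A_op k D p x - z *\<^sub>C x) (B_dom D) (L2_sum D) \<longleftrightarrow>
      bij_betw (C_op k p \<circ> (\<lambda>x. A_op k D p x - z *\<^sub>C x)) (B_dom D) (L2_sum D)"
    by (rule bij_betw_comp_iff2)
  also have "\<dots> \<longleftrightarrow> bij_betw (pencil k p z) (B_dom D) (L2_sum D)"
    by (rule bij_betw_cong) (simp add: C_op_A_op(2)[OF p adm])
  finally show ?thesis .
qed

text \<open>Replaces the \<open>inv_into\<close> in the resolvent by an equation for the pencil with
  right-hand side \<open>C_op k p y\<close>. The linearity, norm and difference estimates below all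
  rest on this equation.\<close>

lemma A_resolvent_solves:
  assumes p: "ess_bound D p M" and adm: "admissible k p"
    and bij: "bij_betw (pencil k p z) (B_dom D) (L2_sum D)" and y: "y \<in> L2_sum D"
  shows "A_resolvent k D p z y \<in> B_dom D" "pencil k p z (A_resolvent k D p z y) = C_op k p y"
proof -
  define f where "f x = A_op k D p x - z *\<^sub>C x" for x
  have y': "y \<in> f ` B_dom D"
    using bij y bij_pencil_iff[OF p adm, of z] unfolding bij_betw_def f_def by auto
  have eq: "A_resolvent k D p z y = inv_into (B_dom D) f y"
    using y by (simp add: A_resolvent_def resolvent_def f_def[abs_def])
  show dom: "A_resolvent k D p z y \<in> B_dom D"
    unfolding eq by (rule inv_into_into[OF y'])
  have "f (A_resolvent k D p z y) = y"
    unfolding eq by (rule f_inv_into_f[OF y'])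
  then show "pencil k p z (A_resolvent k D p z y) = C_op k p y"
    using C_op_A_op(2)[OF p adm dom, of z] by (simp add: f_def)
qed

text \<open>The inverses of \<open>A_op - z\<close> and of the pencil differ by \<open>C_op\<close>.
  The lower bound of \<open>C_op\<close> carries a resolvent bound to the pencil, and its upper
  bound \<open>2 + M\<close> carries it back.\<close>

lemma resolvent_set_iff_regular_pencil:
  assumes p: "ess_bound D p M" and adm: "admissible k p"
  shows "z \<in> resolvent_set (L2_sum D) (B_dom D) (A_op k D p) \<longleftrightarrow> (\<exists>K. regular_pencil K k p z)"
proof
  assume z: "z \<in> resolvent_set (L2_sum D) (B_dom D) (A_op k D p)"
  then have bij: "bij_betw (\<lambda>x. A_op k D p x - z *\<^sub>C x) (B_dom D) (L2_sum D)"
    by (simp add: resolvent_set_def)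
  obtain K where K: "\<And>y. y \<in> L2_sum D \<Longrightarrow> norm (A_resolvent k D p z y) \<le> K * norm y"
    using z by (auto simp: resolvent_set_def A_resolvent_def)
  obtain L where L: "\<And>x. x \<in> L2_sum D \<Longrightarrow> norm x \<le> L * norm (C_op k p x)"
    using C_op_bij[OF p adm] by metis
  \<comment> \<open>The signs of \<open>K\<close> and \<open>L\<close> are not known, whereas
    \<open>regular_pencil\<close> asks for a nonnegative constant.\<close>
  have "norm x \<le> \<bar>K\<bar> * \<bar>L\<bar> * norm (pencil k p z x)" if x: "x \<in> B_dom D" for x
  proof -
    define y where "y = A_op k D p x - z *\<^sub>C x"
    have y: "y \<in> L2_sum D" "C_op k p y = pencil k p z x"
      using C_op_A_op[OF p adm x] by (auto simp: y_def)
    have "A_resolvent k D p z y = x"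
      using inv_into_f_f[OF bij_betw_imp_inj_on[OF bij] x] y(1)
      by (simp add: A_resolvent_def resolvent_def y_def)
    then have "norm x \<le> \<bar>K\<bar> * norm y"
      using K[OF y(1)] by (meson abs_ge_self mult_right_mono norm_ge_zero order_trans)
    also have "\<dots> \<le> \<bar>K\<bar> * (\<bar>L\<bar> * norm (pencil k p z x))"
      using L[OF y(1)] unfolding y(2)
      by (intro mult_left_mono) (meson abs_ge_self mult_right_mono norm_ge_zero order_trans, simp)
    finally show ?thesis
      by (simp add: mult.assoc)
  qed
  then show "\<exists>K. regular_pencil K k p z"
    using bij unfolding bij_pencil_iff[OF p adm] regular_pencil_def
    by (intro exI[of _ "\<bar>K\<bar> * \<bar>L\<bar>"]) auto
next
  assume "\<exists>K. regular_pencil K k p z"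
  then obtain K where bij: "bij_betw (pencil k p z) (B_dom D) (L2_sum D)" and "0 \<le> K"
    and K: "\<And>x. x \<in> B_dom D \<Longrightarrow> norm x \<le> K * norm (pencil k p z x)"
    by (auto simp: regular_pencil_def)
  have "norm (A_resolvent k D p z y) \<le> K * (2 + M) * norm y" if y: "y \<in> L2_sum D" for y
    using order_trans[OF K[OF A_resolvent_solves(1)[OF p adm bij y]]]
      mult_left_mono[OF norm_C_op_le[OF p, of k y] \<open>0 \<le> K\<close>] A_resolvent_solves(2)[OF p adm bij y]
    by (simp add: mult.assoc)
  then show "z \<in> resolvent_set (L2_sum D) (B_dom D) (A_op k D p)"
    using bij unfolding resolvent_set_def bij_pencil_iff[OF p adm] A_resolvent_def by blast
qed

lemma norm_graph_embed_le_pencil: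
  assumes p: "ess_bound D p M" and reg: "regular_pencil K k p z" and z: "cmod z \<le> Z"
    and x: "x \<in> B_dom D"
  shows "norm (graph_embed D x) \<le> (1 + (1 + M + Z * (2 + M)) * K) * norm (pencil k p z x)"
proof -
  have "0 \<le> M"
    using p by (simp add: ess_bound_def)
  have "0 \<le> Z"
    using z norm_ge_zero order_trans by blast
  have K: "norm x \<le> K * norm (pencil k p z x)"
    using reg x by (simp add: regular_pencil_def)
  have "(1 + M + cmod z * (2 + M)) * norm x \<le> (1 + M + Z * (2 + M)) * (K * norm (pencil k p z x))"
    using \<open>0 \<le> M\<close> \<open>0 \<le> Z\<close> z K by (intro mult_mono add_left_mono mult_right_mono) auto
  then show ?thesis
    using norm_graph_embed_le[OF p, of x k z] by (simp add: algebra_simps)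
qed

lemma A_resolvent_linear:
  assumes p: "ess_bound D p M" and adm: "admissible k p" and reg: "regular_pencil K k p z"
    and x: "x \<in> L2_sum D" and y: "y \<in> L2_sum D"
  shows "A_resolvent k D p z (x + y) = A_resolvent k D p z x + A_resolvent k D p z y"
    "A_resolvent k D p z (c *\<^sub>C x) = c *\<^sub>C A_resolvent k D p z x"
proof -
  have bij: "bij_betw (pencil k p z) (B_dom D) (L2_sum D)"
    using reg by (simp add: regular_pencil_def)
  note R = A_resolvent_solves[OF p adm bij]
  have inj: "u = w" if "u \<in> B_dom D" "w \<in> B_dom D" "pencil k p z u = pencil k p z w" for u w
    using bij that by (auto simp: bij_betw_def dest: inj_onD)
  show "A_resolvent k D p z (x + y) = A_resolvent k D p z x + A_resolvent k D p z y"
    by (rule inj) (simp_all add: R B_dom_add L2_sum_add x y pencil_linear[OF p] C_op_linear[OF p])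
  show "A_resolvent k D p z (c *\<^sub>C x) = c *\<^sub>C A_resolvent k D p z x"
    by (rule inj) (simp_all add: R B_dom_scaleC L2_sum_scaleC x pencil_linear(2)[OF p R(1)[OF x] R(1)[OF x]] C_op_linear[OF p])
qed

lemma norm_A_resolvent_le:
  assumes p: "ess_bound D p M" and adm: "admissible k p" and reg: "regular_pencil K k p z"
    and z: "cmod z \<le> Z" and y: "y \<in> L2_sum D"
  shows "norm (graph_embed D (A_resolvent k D p z y)) \<le> (1 + (1 + M + Z * (2 + M)) * K) * (2 + M) * norm y"
proof -
  have "0 \<le> M" "0 \<le> K" and bij: "bij_betw (pencil k p z) (B_dom D) (L2_sum D)"
    using p reg by (auto simp: ess_bound_def regular_pencil_def)
  have "0 \<le> Z"
    using z norm_ge_zero order_trans by blast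
  note R = A_resolvent_solves[OF p adm bij y]
  have "norm (graph_embed D (A_resolvent k D p z y)) \<le> (1 + (1 + M + Z * (2 + M)) * K) * norm (C_op k p y)"
    using norm_graph_embed_le_pencil[OF p reg z R(1)] by (simp add: R(2))
  also have "\<dots> \<le> (1 + (1 + M + Z * (2 + M)) * K) * ((2 + M) * norm y)"
    using \<open>0 \<le> M\<close> \<open>0 \<le> K\<close> \<open>0 \<le> Z\<close> by (intro mult_left_mono norm_C_op_le[OF p]) auto
  finally show ?thesis
    by (simp add: mult.assoc)
qed

lemma A_resolvent_bounded_ops:
  assumes p: "ess_bound D p M" and adm: "admissible k p" and reg: "regular_pencil K k p z"
  shows "A_resolvent k D p z \<in> bounded_ops (L2_sum D) (H20_sum D) (H20_sum_norm D)"
proof -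
  have bij: "bij_betw (pencil k p z) (B_dom D) (L2_sum D)"
    using reg by (simp add: regular_pencil_def)
  have "A_resolvent k D p z \<in> L2_sum D \<rightarrow>\<^sub>E H20_sum D"
    using A_resolvent_solves(1)[OF p adm bij] B_dom_subset_H20_sum
    by (auto simp: A_resolvent_def resolvent_def)
  then show ?thesis
    unfolding bounded_ops_def H20_sum_norm_graph_embed
    using A_resolvent_linear[OF p adm reg] norm_A_resolvent_le[OF p adm reg order_refl] L2_sum_zero
    by blast
qed

text \<open>The pencil at \<open>(p, z)\<close> applied to the difference of the two solutions
  leaves only bounded terms: the Laplacians cancel, and what remains are differences of
  \<open>C_op\<close> on \<open>y\<close> and of \<open>lower_op\<close> on the second solution. The
  graph norm bound for the pencil finishes the estimate.\<close>

lemma norm_A_resolvent_diff_le: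
  assumes p: "ess_bound D p M" "admissible k p" "regular_pencil K k p z" "cmod z \<le> Z"
    and q: "ess_bound D q M" "admissible k q" "regular_pencil K k q w" "cmod w \<le> Z"
    and pq: "ess_bound D (\<lambda>x. p x - q x) r" and y: "y \<in> L2_sum D"
  shows "norm (graph_embed D (A_resolvent k D p z y) - graph_embed D (A_resolvent k D q w y))
    \<le> (1 + (1 + M + Z * (2 + M)) * K) * (1 + (3 + Z + M) * (K * (2 + M))) * (r + cmod (z - w)) * norm y"
proof -
  have nonneg: "0 \<le> M" "0 \<le> K" "0 \<le> r"
    using p q pq by (auto simp: ess_bound_def regular_pencil_def)
  have "0 \<le> Z"
    using p(4) norm_ge_zero order_trans by blast
  have bij: "bij_betw (pencil k p z) (B_dom D) (L2_sum D)" "bij_betw (pencil k q w) (B_dom D) (L2_sum D)"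
    using p q by (auto simp: regular_pencil_def)
  define x where "x = A_resolvent k D p z y"
  define x' where "x' = A_resolvent k D q w y"
  have x: "x \<in> B_dom D" "pencil k p z x = C_op k p y"
    using A_resolvent_solves[OF p(1,2) bij(1) y] by (auto simp: x_def)
  have x': "x' \<in> B_dom D" "pencil k q w x' = C_op k q y"
    using A_resolvent_solves[OF q(1,2) bij(2) y] by (auto simp: x'_def)
  have "norm x' \<le> K * norm (C_op k q y)"
    using q(3) x' by (auto simp: regular_pencil_def)
  also have "\<dots> \<le> K * ((2 + M) * norm y)"
    by (intro mult_left_mono norm_C_op_le[OF q(1)] nonneg)
  finally have norm_x': "norm x' \<le> K * (2 + M) * norm y"
    by (simp add: mult.assoc)
  have "pencil k p z (x - x') = (C_op k p y - C_op k q y) - (pencil k p z x' - pencil k q w x')"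
    by (simp add: pencil_linear(3)[OF p(1) x(1) x'(1)] x(2) x'(2))
  also have "pencil k p z x' - pencil k q w x' = lower_op k p z x' - lower_op k q w x'"
    by (simp add: pencil_def)
  finally have "norm (pencil k p z (x - x')) \<le> norm (C_op k p y - C_op k q y)
      + norm (lower_op k p z x' - lower_op k q w x')"
    by (metis norm_triangle_ineq4)
  also have "\<dots> \<le> r * norm y + (r + cmod (z - w) * (2 + M) + cmod w * r) * norm x'"
    by (intro add_mono norm_C_op_diff_le[OF p(1) q(1) pq] norm_lower_op_diff_le[OF p(1) q(1) pq])
  \<comment> \<open>The factor \<open>3 + Z + M\<close> adds up 1 and \<open>Z\<close>, the
    coefficients of \<open>r\<close>, and \<open>2 + M\<close>, the coefficient of
    \<open>cmod (z - w)\<close>.\<close>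
  also have "\<dots> \<le> (r + cmod (z - w)) * norm y + (r + cmod (z - w)) * (3 + Z + M) * (K * (2 + M) * norm y)"
  proof (intro add_mono mult_mono norm_x')
    have "cmod w * r \<le> r * Z"
      using mult_right_mono[OF q(4) nonneg(3)] by (simp add: mult.commute)
    moreover have "0 \<le> cmod (z - w) * Z" "0 \<le> r * M" "0 \<le> cmod (z - w)"
      using nonneg \<open>0 \<le> Z\<close> by auto
    ultimately show "r + cmod (z - w) * (2 + M) + cmod w * r \<le> (r + cmod (z - w)) * (3 + Z + M)"
      unfolding distrib_left distrib_right using nonneg by linarith
  qed (use nonneg \<open>0 \<le> Z\<close> in auto)
  also have "\<dots> = (1 + (3 + Z + M) * (K * (2 + M))) * (r + cmod (z - w)) * norm y"
    by (simp add: algebra_simps)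
  finally have "norm (pencil k p z (x - x')) \<le> (1 + (3 + Z + M) * (K * (2 + M))) * (r + cmod (z - w)) * norm y" .
  then have "(1 + (1 + M + Z * (2 + M)) * K) * norm (pencil k p z (x - x'))
      \<le> (1 + (1 + M + Z * (2 + M)) * K) * ((1 + (3 + Z + M) * (K * (2 + M))) * (r + cmod (z - w)) * norm y)"
    using nonneg \<open>0 \<le> Z\<close> by (intro mult_left_mono) auto
  then have "norm (graph_embed D (x - x'))
      \<le> (1 + (1 + M + Z * (2 + M)) * K) * ((1 + (3 + Z + M) * (K * (2 + M))) * (r + cmod (z - w)) * norm y)"
    using norm_graph_embed_le_pencil[OF p(1,3,4) B_dom_diff[OF x(1) x'(1)]] by (rule order_trans[rotated])
  moreover have "graph_embed D (x - x') = graph_embed D x - graph_embed D x'"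
    using x(1) x'(1) B_dom_subset_H20_sum by (intro graph_embed_diff(2)) auto
  ultimately show ?thesis
    by (simp add: x_def x'_def mult.assoc)
qed

subsection \<open>Curve integrals of operators\<close>

lemma op_norm_le:
  assumes "\<And>x. x \<in> L2_sum D \<Longrightarrow> norm x \<le> 1 \<Longrightarrow> N (T x) \<le> e"
  shows "op_norm (L2_sum D) N T \<le> e"
  unfolding op_norm_def
proof (rule cSUP_least)
  have "0 \<in> {x \<in> L2_sum D. norm x \<le> 1}"
    using L2_sum_zero by simp
  then show "{x \<in> L2_sum D. norm x \<le> 1} \<noteq> {}"
    by blast
qed (use assms in auto)

text \<open>The supremum is taken in the reals, so it dominates the values only once they are known
  to be bounded above; \<open>K\<close> provides this.\<close>

lemma le_op_norm:
  assumes "\<And>x. x \<in> L2_sum D \<Longrightarrow> norm x \<le> 1 \<Longrightarrow> N (T x) \<le> K" "x \<in> L2_sum D" "norm x \<le> 1"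
  shows "N (T x) \<le> op_norm (L2_sum D) N T"
  unfolding op_norm_def using assms by (intro cSUP_upper bdd_aboveI[of _ K]) auto

lemma graph_embed_rs_sum:
  assumes "\<And>x. x \<in> {a..b} \<Longrightarrow> f x \<in> H20_sum D" and P: "fine_partition a b \<delta> n t s"
  shows "rs_sum \<gamma> f n t s \<in> H20_sum D"
    "graph_embed D (rs_sum \<gamma> f n t s) = rs_sum \<gamma> (\<lambda>x. graph_embed D (f x)) n t s"
proof -
  have "(\<gamma> (t (Suc i)) - \<gamma> (t i)) *\<^sub>C f (s i) \<in> H20_sum D"
    "graph_embed D ((\<gamma> (t (Suc i)) - \<gamma> (t i)) *\<^sub>C f (s i)) = (\<gamma> (t (Suc i)) - \<gamma> (t i)) *\<^sub>C graph_embed D (f (s i))"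
    if "i < n" for i
    using graph_embed_scaleC[OF assms(1)[OF fine_partition_tag[OF P that]]] by auto
  then show "rs_sum \<gamma> f n t s \<in> H20_sum D"
    "graph_embed D (rs_sum \<gamma> f n t s) = rs_sum \<gamma> (\<lambda>x. graph_embed D (f x)) n t s"
    unfolding rs_sum_def
    using graph_embed_sum[of "{..<n}" "\<lambda>i. (\<gamma> (t (Suc i)) - \<gamma> (t i)) *\<^sub>C f (s i)"] by auto
qed

lemma bounded_opsD:
  assumes "T \<in> bounded_ops (L2_sum D) (H20_sum D) (H20_sum_norm D)" "x \<in> L2_sum D"
  shows "T x \<in> H20_sum D" "T (c *\<^sub>C x) = c *\<^sub>C T x"
    "y \<in> L2_sum D \<Longrightarrow> T (x + y) = T x + T y"
  using assms by (auto simp: bounded_ops_def)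

lemma has_curve_integral_iff:
  "has_curve_integral X Y N a b \<gamma> F J \<longleftrightarrow>
     (\<forall>z\<in>\<gamma> ` {a..b}. F z \<in> bounded_ops X Y N) \<and> J \<in> bounded_ops X Y N \<and>
     (\<forall>\<epsilon>>0. \<exists>\<delta>>0. \<forall>n t s. fine_partition a b \<delta> n t s \<longrightarrow>
        op_norm X N (\<lambda>x. rs_sum \<gamma> (\<lambda>t. F (\<gamma> t) x) n t s - J x) < \<epsilon>)"
  by (simp only: has_curve_integral_def fine_partition_def rs_sum_def)

text \<open>Evaluation at a point of the unit ball is dominated by \<open>op_norm\<close>. The bound
  \<open>B\<close> on the integrand serves to show that the supremum in \<open>op_norm\<close> is
  over a bounded set. Uniqueness of operator integrals reduces in this way to uniqueness of vector
  integrals.\<close>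

lemma has_curve_integral_pointwise:
  assumes v: "variation_majorant a b \<gamma> v" and "a \<le> b"
    and J: "has_curve_integral (L2_sum D) (H20_sum D) (H20_sum_norm D) a b \<gamma> F J"
    and B: "\<And>z y. z \<in> \<gamma> ` {a..b} \<Longrightarrow> y \<in> L2_sum D \<Longrightarrow> norm (graph_embed D (F z y)) \<le> B * norm y"
    and y: "y \<in> L2_sum D" "norm y \<le> 1"
  shows "has_rs_integral a b \<gamma> (\<lambda>t. graph_embed D (F (\<gamma> t) y)) (graph_embed D (J y))"
  unfolding has_rs_integral_def
proof (intro allI impI)
  have "\<forall>\<epsilon>>0. \<exists>\<delta>>0. \<forall>n t s. fine_partition a b \<delta> n t s \<longrightarrow>
      op_norm (L2_sum D) (H20_sum_norm D) (\<lambda>x. rs_sum \<gamma> (\<lambda>t. F (\<gamma> t) x) n t s - J x) < \<epsilon>"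
    using J unfolding has_curve_integral_iff by (elim conjE)
  moreover fix \<epsilon> :: real
  assume "0 < \<epsilon>"
  ultimately obtain \<delta> where \<delta>: "0 < \<delta>" "\<And>n t s. fine_partition a b \<delta> n t s \<Longrightarrow>
      op_norm (L2_sum D) (H20_sum_norm D) (\<lambda>x. rs_sum \<gamma> (\<lambda>t. F (\<gamma> t) x) n t s - J x) < \<epsilon>"
    by meson
  have F: "F (\<gamma> t) x \<in> H20_sum D" if "t \<in> {a..b}" "x \<in> L2_sum D" for t x
    using J that bounded_opsD(1) by (auto simp: has_curve_integral_def)
  have J': "J \<in> bounded_ops (L2_sum D) (H20_sum D) (H20_sum_norm D)"
    using J by (simp add: has_curve_integral_def)
  then obtain KJ where KJ: "\<And>x. x \<in> L2_sum D \<Longrightarrow> norm (graph_embed D (J x)) \<le> KJ * norm x"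
    unfolding bounded_ops_def H20_sum_norm_graph_embed by blast
  have "norm (rs_sum \<gamma> (\<lambda>t. graph_embed D (F (\<gamma> t) y)) n t s - graph_embed D (J y)) < \<epsilon>"
    if P: "fine_partition a b \<delta> n t s" for n t s
  proof -
    have eq: "H20_sum_norm D (rs_sum \<gamma> (\<lambda>t. F (\<gamma> t) x) n t s - J x)
        = norm (rs_sum \<gamma> (\<lambda>t. graph_embed D (F (\<gamma> t) x)) n t s - graph_embed D (J x))"
      if x: "x \<in> L2_sum D" for x
      using graph_embed_rs_sum[where f = "\<lambda>t. F (\<gamma> t) x" and \<gamma> = \<gamma>, OF F[OF _ x] P]
      by (simp add: H20_sum_norm_graph_embed graph_embed_diff(2) bounded_opsD(1)[OF J' x])
    have "H20_sum_norm D (rs_sum \<gamma> (\<lambda>t. F (\<gamma> t) y) n t s - J y)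
        \<le> op_norm (L2_sum D) (H20_sum_norm D) (\<lambda>x. rs_sum \<gamma> (\<lambda>t. F (\<gamma> t) x) n t s - J x)"
    proof (rule le_op_norm[OF _ y])
      fix x
      assume x: "x \<in> L2_sum D" "norm x \<le> 1"
      have "norm (rs_sum \<gamma> (\<lambda>t. graph_embed D (F (\<gamma> t) x)) n t s) \<le> (\<bar>B\<bar> * 1) * (v b - v a)"
      proof (rule norm_rs_sum_le[OF v P])
        fix t
        assume "t \<in> {a..b}"
        then have "norm (graph_embed D (F (\<gamma> t) x)) \<le> B * norm x"
          using B x by blast
        also have "\<dots> \<le> \<bar>B\<bar> * 1"
          using x by (intro mult_mono) auto
        finally show "norm (graph_embed D (F (\<gamma> t) x)) \<le> \<bar>B\<bar> * 1" .
      qed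
      moreover have "norm (graph_embed D (J x)) \<le> \<bar>KJ\<bar> * 1"
        using x by (intro order_trans[OF KJ] mult_mono) auto
      ultimately show "H20_sum_norm D (rs_sum \<gamma> (\<lambda>t. F (\<gamma> t) x) n t s - J x)
          \<le> (\<bar>B\<bar> * 1) * (v b - v a) + \<bar>KJ\<bar> * 1"
        unfolding eq[OF x(1)] by (rule order_trans[OF norm_triangle_ineq4 add_mono])
    qed
    then show ?thesis
      using \<delta>(2)[OF P] eq[OF y(1)] by simp
  qed
  then show "\<exists>\<delta>>0. \<forall>n t s. fine_partition a b \<delta> n t s \<longrightarrow>
      norm (rs_sum \<gamma> (\<lambda>t. graph_embed D (F (\<gamma> t) y)) n t s - graph_embed D (J y)) < \<epsilon>"
    using \<delta>(1) by blast
qed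

text \<open>The integral is built for each \<open>y\<close> separately in the graph space and
  inherits linearity from uniqueness. The Lipschitz hypothesis gives one modulus of continuity for
  all \<open>y\<close> in the unit ball, so \<open>has_rs_integral_error\<close> makes the
  convergence uniform, that is, convergence in \<open>op_norm\<close>.\<close>

lemma curve_integral_exists:
  fixes \<gamma> :: "real \<Rightarrow> complex" and F :: "complex \<Rightarrow> 'a L2 \<times> 'a L2 \<Rightarrow> 'a L2 \<times> 'a L2"
  assumes v: "variation_majorant a b \<gamma> v" and "a \<le> b" and \<gamma>: "continuous_on {a..b} \<gamma>"
    and F: "\<And>z. z \<in> \<gamma> ` {a..b} \<Longrightarrow> F z \<in> bounded_ops (L2_sum D) (H20_sum D) (H20_sum_norm D)"
    and B: "\<And>z y. z \<in> \<gamma> ` {a..b} \<Longrightarrow> y \<in> L2_sum D \<Longrightarrow> norm (graph_embed D (F z y)) \<le> B * norm y"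
    and lip: "\<And>z w y. z \<in> \<gamma> ` {a..b} \<Longrightarrow> w \<in> \<gamma> ` {a..b} \<Longrightarrow> y \<in> L2_sum D \<Longrightarrow>
      norm (graph_embed D (F z y) - graph_embed D (F w y)) \<le> c * cmod (z - w) * norm y"
  obtains J where "has_curve_integral (L2_sum D) (H20_sum D) (H20_sum_norm D) a b \<gamma> F J"
    "curve_integral (L2_sum D) (H20_sum D) (H20_sum_norm D) a b \<gamma> F = J"
    "\<And>y. y \<in> L2_sum D \<Longrightarrow> has_rs_integral a b \<gamma> (\<lambda>t. graph_embed D (F (\<gamma> t) y)) (graph_embed D (J y))"
proof -
  define f where "f y t = graph_embed D (F (\<gamma> t) y)" for y t
  have "0 \<le> v b - v a"
    using v \<open>a \<le> b\<close> unfolding variation_majorant_def by (meson norm_ge_zero order_refl order_trans)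
  have F_H20: "F (\<gamma> t) y \<in> H20_sum D" if "t \<in> {a..b}" "y \<in> L2_sum D" for t y
    using bounded_opsD(1)[OF F that(2)] that(1) by blast
  have cont: "continuous_on {a..b} (f y)" if y: "y \<in> L2_sum D" for y
    unfolding continuous_on_def
  proof
    fix t
    assume t: "t \<in> {a..b}"
    have "((\<lambda>s. c * cmod (\<gamma> s - \<gamma> t) * norm y) \<longlongrightarrow> c * cmod (\<gamma> t - \<gamma> t) * norm y) (at t within {a..b})"
      using \<gamma> t by (intro tendsto_intros) (auto simp: continuous_on_def)
    then have "((\<lambda>s. c * cmod (\<gamma> s - \<gamma> t) * norm y) \<longlongrightarrow> 0) (at t within {a..b})"
      by simp
    then have "((\<lambda>s. f y s - f y t) \<longlongrightarrow> 0) (at t within {a..b})"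
      by (rule Lim_null_comparison[rotated])
        (use lip[OF _ _ y] t in \<open>auto simp: f_def eventually_at_filter intro!: always_eventually\<close>)
    then show "(f y \<longlongrightarrow> f y t) (at t within {a..b})"
      by (simp add: LIM_zero_iff)
  qed
  have ex: "\<exists>x\<in>H20_sum D. has_rs_integral a b \<gamma> (f y) (graph_embed D x)" if y: "y \<in> L2_sum D" for y
  proof -
    obtain j where j: "has_rs_integral a b \<gamma> (f y) j"
      using has_rs_integral_exists[OF v \<open>a \<le> b\<close> cont[OF y]] by blast
    have "j \<in> graph_embed D ` H20_sum D"
    proof (rule has_rs_integral_closed[OF j \<open>a \<le> b\<close> closed_graph_embed_H20_sum])
      show "rs_sum \<gamma> (f y) n t s \<in> graph_embed D ` H20_sum D" if "fine_partition a b \<delta> n t s" for \<delta> n t s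
        using graph_embed_rs_sum[where f = "\<lambda>t. F (\<gamma> t) y" and \<gamma> = \<gamma>, OF F_H20[OF _ y] that] unfolding f_def by force
    qed
    with j show ?thesis
      by blast
  qed
  \<comment> \<open>The restriction makes \<open>J\<close> undefined off \<open>L2_sum D\<close>, as
    \<open>bounded_ops\<close> requires; the choice is in fact unique because
    \<open>graph_embed\<close> is injective.\<close>
  define J where "J = (\<lambda>y\<in>L2_sum D. SOME x. x \<in> H20_sum D \<and> has_rs_integral a b \<gamma> (f y) (graph_embed D x))"
  have J: "J y \<in> H20_sum D" "has_rs_integral a b \<gamma> (f y) (graph_embed D (J y))" if "y \<in> L2_sum D" for y
    using someI_ex[OF ex[OF that, unfolded Bex_def]] that by (simp_all add: J_def)
  have J_unique: "J y = x" if "y \<in> L2_sum D" "has_rs_integral a b \<gamma> (f y) (graph_embed D x)" for x y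
    using has_rs_integral_unique[OF J(2)[OF that(1)] that(2) \<open>a \<le> b\<close>] inj_graph_embed by (auto dest: injD)
  \<comment> \<open>The operators \<open>F z\<close> are controlled only for \<open>z\<close> on the
    curve, so the integrands agree only on \<open>[a, b]\<close>. This suffices, since all tags lie
    there.\<close>
  have transfer: "has_rs_integral a b \<gamma> g j"
    if "has_rs_integral a b \<gamma> h j" "\<And>t. t \<in> {a..b} \<Longrightarrow> g t = h t" for g h :: "real \<Rightarrow> 'a L2 \<times> 'a L2 \<times> 'a L2" and j
  proof -
    have "rs_sum \<gamma> g n t s = rs_sum \<gamma> h n t s" if "fine_partition a b \<delta> n t s" for \<delta> n t s
      unfolding rs_sum_def using fine_partition_tag[OF that] \<open>\<And>t. t \<in> {a..b} \<Longrightarrow> g t = h t\<close> by simp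
    then show ?thesis
      using that(1) unfolding has_rs_integral_def by metis
  qed
  have J_add: "J (x + y) = J x + J y" if xy: "x \<in> L2_sum D" "y \<in> L2_sum D" for x y
  proof (rule J_unique[OF L2_sum_add[OF xy]])
    have "has_rs_integral a b \<gamma> (\<lambda>t. f x t + f y t) (graph_embed D (J x + J y))"
      unfolding graph_embed_add(2)[OF J(1)[OF xy(1)] J(1)[OF xy(2)]]
      by (intro has_rs_integral_add J(2) xy)
    then show "has_rs_integral a b \<gamma> (f (x + y)) (graph_embed D (J x + J y))"
      by (rule transfer)
        (simp add: f_def bounded_opsD(3)[OF F xy] graph_embed_add(2) F_H20 xy)
  qed
  have J_scaleC: "J (d *\<^sub>C x) = d *\<^sub>C J x" if x: "x \<in> L2_sum D" for d x
  proof (rule J_unique[OF L2_sum_scaleC[OF x]])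
    have "has_rs_integral a b \<gamma> (\<lambda>t. d *\<^sub>C f x t) (graph_embed D (d *\<^sub>C J x))"
      unfolding graph_embed_scaleC(2)[OF J(1)[OF x]] by (intro has_rs_integral_scaleC J(2) x)
    then show "has_rs_integral a b \<gamma> (f (d *\<^sub>C x)) (graph_embed D (d *\<^sub>C J x))"
      by (rule transfer)
        (simp add: f_def bounded_opsD(2)[OF F x] graph_embed_scaleC(2) F_H20 x)
  qed
  have J_bound: "norm (graph_embed D (J y)) \<le> B * (v b - v a) * norm y" if y: "y \<in> L2_sum D" for y
    using has_rs_integral_bound[OF v J(2)[OF y] \<open>a \<le> b\<close>, of "B * norm y"] B[OF _ y]
    by (simp add: f_def mult_ac)
  have J_ops: "J \<in> bounded_ops (L2_sum D) (H20_sum D) (H20_sum_norm D)"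
  proof -
    have "J \<in> L2_sum D \<rightarrow>\<^sub>E H20_sum D"
      using J(1) by (auto simp: J_def)
    then show ?thesis
      unfolding bounded_ops_def H20_sum_norm_graph_embed using J_add J_scaleC J_bound by blast
  qed
  have J_has: "has_curve_integral (L2_sum D) (H20_sum D) (H20_sum_norm D) a b \<gamma> F J"
    unfolding has_curve_integral_iff
  proof (intro conjI ballI allI impI F J_ops)
    fix \<epsilon> :: real
    assume "0 < \<epsilon>"
    \<comment> \<open>Makes the error bound equal to \<open>\<epsilon> / 2\<close>, which leaves
      room for a strict inequality after the supremum; both summands 1 keep the factors
      positive.\<close>
    define \<eta> where "\<eta> = \<epsilon> / (2 * (\<bar>c\<bar> + 1) * (v b - v a + 1))"
    have pos: "0 < \<bar>c\<bar> + 1" "0 < v b - v a + 1"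
      using \<open>0 \<le> v b - v a\<close> by auto
    have \<eta>: "0 < \<eta>"
      using pos \<open>0 < \<epsilon>\<close> by (simp add: \<eta>_def)
    have "uniformly_continuous_on {a..b} \<gamma>"
      by (intro compact_uniformly_continuous \<gamma>) auto
    then obtain d where d: "0 < d" "\<And>x y. x \<in> {a..b} \<Longrightarrow> y \<in> {a..b} \<Longrightarrow> \<bar>x - y\<bar> < d \<Longrightarrow> cmod (\<gamma> x - \<gamma> y) < \<eta>"
      using \<eta> unfolding uniformly_continuous_on_def dist_norm real_norm_def by metis
    \<comment> \<open>Mesh \<open>d / 2\<close>, because the error bound involves the oscillation at
      twice the mesh.\<close>
    have "op_norm (L2_sum D) (H20_sum_norm D) (\<lambda>x. rs_sum \<gamma> (\<lambda>t. F (\<gamma> t) x) n t s - J x) < \<epsilon>"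
      if P: "fine_partition a b (d / 2) n t s" for n t s
    proof -
      have "op_norm (L2_sum D) (H20_sum_norm D) (\<lambda>x. rs_sum \<gamma> (\<lambda>t. F (\<gamma> t) x) n t s - J x) \<le> \<epsilon> / 2"
      proof (rule op_norm_le)
        fix y :: "'a L2 \<times> 'a L2"
        assume y: "y \<in> L2_sum D" "norm y \<le> 1"
        have "H20_sum_norm D (rs_sum \<gamma> (\<lambda>t. F (\<gamma> t) y) n t s - J y) = norm (rs_sum \<gamma> (f y) n t s - graph_embed D (J y))"
          using graph_embed_rs_sum[where f = "\<lambda>t. F (\<gamma> t) y" and \<gamma> = \<gamma>, OF F_H20[OF _ y(1)] P]
          by (simp add: H20_sum_norm_graph_embed graph_embed_diff(2) J(1) y(1) f_def[abs_def])
        also have "\<dots> \<le> ((\<bar>c\<bar> + 1) * \<eta>) * (v b - v a)"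
        proof (rule has_rs_integral_error[OF v J(2)[OF y(1)] \<open>a \<le> b\<close> P])
          fix x x'
          assume x: "x \<in> {a..b}" "x' \<in> {a..b}" "\<bar>x - x'\<bar> < 2 * (d / 2)"
          have "norm (f y x - f y x') \<le> c * cmod (\<gamma> x - \<gamma> x') * norm y"
            unfolding f_def using x y(1) by (intro lip) auto
          also have "\<dots> \<le> (\<bar>c\<bar> + 1) * \<eta> * 1"
            using d(2)[of x x'] x y(2) \<eta> by (intro mult_mono) auto
          finally show "norm (f y x - f y x') \<le> (\<bar>c\<bar> + 1) * \<eta>"
            by simp
        qed (use d(1) \<eta> pos in auto)
        also have "\<dots> \<le> (\<bar>c\<bar> + 1) * \<eta> * (v b - v a + 1)"
          using \<eta> pos by (intro mult_left_mono) auto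
        also have "\<dots> = \<epsilon> / 2"
        proof -
          have "x * (\<epsilon> / (2 * x * w)) * w = \<epsilon> / 2" if "0 < x" "0 < w" for x w :: real
            using that by simp
          from this[OF pos] show ?thesis
            by (simp only: \<eta>_def)
        qed
        finally show "H20_sum_norm D (rs_sum \<gamma> (\<lambda>t. F (\<gamma> t) y) n t s - J y) \<le> \<epsilon> / 2" .
      qed
      then show ?thesis
        using \<open>0 < \<epsilon>\<close> by simp
    qed
    then show "\<exists>\<delta>>0. \<forall>n t s. fine_partition a b \<delta> n t s \<longrightarrow>
        op_norm (L2_sum D) (H20_sum_norm D) (\<lambda>x. rs_sum \<gamma> (\<lambda>t. F (\<gamma> t) x) n t s - J x) < \<epsilon>"
      using d(1) by (intro exI[of _ "d / 2"]) auto
  qed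
  have unique: "J' = J" if J': "has_curve_integral (L2_sum D) (H20_sum D) (H20_sum_norm D) a b \<gamma> F J'" for J'
  proof
    fix y
    have ops: "J' \<in> bounded_ops (L2_sum D) (H20_sum D) (H20_sum_norm D)"
      using J' by (simp add: has_curve_integral_def)
    show "J' y = J y"
    proof (cases "y \<in> L2_sum D")
      case True
      \<comment> \<open>The pointwise statement is available only in the unit ball, so
        \<open>y\<close> is scaled into it; the summand 1 covers \<open>y = 0\<close>.\<close>
      define d where "d = complex_of_real (1 / (norm y + 1))"
      have pos: "0 < norm y + 1"
        by (simp add: add_nonneg_pos)
      have "norm (d *\<^sub>C y) = norm y / (norm y + 1)"
        using pos by (simp add: norm_scaleC d_def norm_divide)
      then have "norm (d *\<^sub>C y) \<le> 1"
        using pos by simp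
      then have "J (d *\<^sub>C y) = J' (d *\<^sub>C y)"
        using has_curve_integral_pointwise[OF v \<open>a \<le> b\<close> J' B L2_sum_scaleC[OF True]]
        by (intro J_unique L2_sum_scaleC True) (simp add: f_def[abs_def])
      then have "inverse d *\<^sub>C d *\<^sub>C J y = inverse d *\<^sub>C d *\<^sub>C J' y"
        using J_scaleC[OF True] bounded_opsD(2)[OF ops True] by simp
      moreover have "d \<noteq> 0"
        using pos unfolding d_def by (metis divide_eq_0_iff less_irrefl of_real_eq_0_iff zero_neq_one)
      ultimately show ?thesis
        by (simp add: scaleC_scaleC scaleC_one)
    next
      case False
      then show ?thesis
        using PiE_arb[of J' "L2_sum D"] PiE_arb[of J "L2_sum D"] ops J_ops
        unfolding bounded_ops_def by (metis (mono_tags, lifting) mem_Collect_eq)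
    qed
  qed
  show ?thesis
  proof (rule that[OF J_has])
    show "curve_integral (L2_sum D) (H20_sum D) (H20_sum_norm D) a b \<gamma> F = J"
      unfolding curve_integral_def using J_has unique by (rule the_equality)
  qed (use J(2) in \<open>simp add: f_def[abs_def]\<close>)
qed

text \<open>The third conclusion keeps the scalar factor under the integral sign, so that the
  difference of two projections can be estimated through the difference of their integrands.\<close>

lemma spectral_projection_rs:
  fixes \<gamma> :: "real \<Rightarrow> complex"
  assumes v: "variation_majorant a b \<gamma> v" and "a \<le> b" and \<gamma>: "continuous_on {a..b} \<gamma>"
    and p: "ess_bound D p M" and adm: "admissible k p"
    and reg: "\<forall>z\<in>\<gamma> ` {a..b}. regular_pencil K k p z"
    and Z: "\<forall>z\<in>\<gamma> ` {a..b}. cmod z \<le> Z"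
  shows "\<exists>J. has_curve_integral (L2_sum D) (H20_sum D) (H20_sum_norm D) a b \<gamma> (A_resolvent k D p) J"
    and "spectral_projection k D a b \<gamma> p \<in> bounded_ops (L2_sum D) (H20_sum D) (H20_sum_norm D)"
    and "\<And>y. y \<in> L2_sum D \<Longrightarrow> has_rs_integral a b \<gamma>
      (\<lambda>t. (1 / (2 * complex_of_real pi * \<i>)) *\<^sub>C graph_embed D (A_resolvent k D p (\<gamma> t) y))
      (graph_embed D (spectral_projection k D a b \<gamma> p y))"
proof -
  \<comment> \<open>Comparing \<open>p\<close> with itself at distance 0 turns the difference
    estimate into a Lipschitz bound in the spectral parameter alone.\<close>
  have p0: "ess_bound D (\<lambda>x. p x - p x) 0"
    using ess_bound_const[of D 0] by simp
  have ops: "A_resolvent k D p z \<in> bounded_ops (L2_sum D) (H20_sum D) (H20_sum_norm D)"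
    if "z \<in> \<gamma> ` {a..b}" for z
    by (rule A_resolvent_bounded_ops[OF p adm reg[rule_format, OF that]])
  have bound: "norm (graph_embed D (A_resolvent k D p z y)) \<le> (1 + (1 + M + Z * (2 + M)) * K) * (2 + M) * norm y"
    if "z \<in> \<gamma> ` {a..b}" "y \<in> L2_sum D" for z y
    by (rule norm_A_resolvent_le[OF p adm reg[rule_format, OF that(1)] Z[rule_format, OF that(1)] that(2)])
  have lip: "norm (graph_embed D (A_resolvent k D p z y) - graph_embed D (A_resolvent k D p w y))
    \<le> (1 + (1 + M + Z * (2 + M)) * K) * (1 + (3 + Z + M) * (K * (2 + M))) * cmod (z - w) * norm y"
    if "z \<in> \<gamma> ` {a..b}" "w \<in> \<gamma> ` {a..b}" "y \<in> L2_sum D" for z w y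
    using norm_A_resolvent_diff_le[OF p adm reg[rule_format, OF that(1)] Z[rule_format, OF that(1)]
      p adm reg[rule_format, OF that(2)] Z[rule_format, OF that(2)] p0 that(3)] by simp
  obtain J where J: "has_curve_integral (L2_sum D) (H20_sum D) (H20_sum_norm D) a b \<gamma> (A_resolvent k D p) J"
    "curve_integral (L2_sum D) (H20_sum D) (H20_sum_norm D) a b \<gamma> (A_resolvent k D p) = J"
    "\<And>y. y \<in> L2_sum D \<Longrightarrow>
      has_rs_integral a b \<gamma> (\<lambda>t. graph_embed D (A_resolvent k D p (\<gamma> t) y)) (graph_embed D (J y))"
    using curve_integral_exists[OF v \<open>a \<le> b\<close> \<gamma> ops bound lip] by blast
  then show "\<exists>J. has_curve_integral (L2_sum D) (H20_sum D) (H20_sum_norm D) a b \<gamma> (A_resolvent k D p) J"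
    by blast
  define c where "c = 1 / (2 * complex_of_real pi * \<i>)"
  have proj: "spectral_projection k D a b \<gamma> p = (\<lambda>x\<in>L2_sum D. c *\<^sub>C J x)"
    by (simp add: spectral_projection_def J(2) c_def)
  have J_ops: "J \<in> bounded_ops (L2_sum D) (H20_sum D) (H20_sum_norm D)"
    using J(1) by (simp add: has_curve_integral_def)
  note J_D = bounded_opsD[OF J_ops]
  obtain KJ where KJ: "\<And>x. x \<in> L2_sum D \<Longrightarrow> norm (graph_embed D (J x)) \<le> KJ * norm x"
    using J_ops unfolding bounded_ops_def H20_sum_norm_graph_embed by blast
  have "norm (graph_embed D (c *\<^sub>C J x)) \<le> (cmod c * KJ) * norm x" if "x \<in> L2_sum D" for x
    using mult_left_mono[OF KJ[OF that] norm_ge_zero[of c]] J_D(1)[OF that]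
    by (simp add: graph_embed_scaleC(2) norm_scaleC mult.assoc)
  then have "\<exists>K. \<forall>x\<in>L2_sum D. H20_sum_norm D ((\<lambda>x\<in>L2_sum D. c *\<^sub>C J x) x) \<le> K * norm x"
    by (intro exI[of _ "cmod c * KJ"] ballI) (simp add: H20_sum_norm_graph_embed)
  then show "spectral_projection k D a b \<gamma> p \<in> bounded_ops (L2_sum D) (H20_sum D) (H20_sum_norm D)"
    unfolding proj bounded_ops_def
    by (simp add: J_D graph_embed_scaleC(1) L2_sum_add L2_sum_scaleC scaleC_add_right scaleC_scaleC mult.commute)
  show "has_rs_integral a b \<gamma>
      (\<lambda>t. (1 / (2 * complex_of_real pi * \<i>)) *\<^sub>C graph_embed D (A_resolvent k D p (\<gamma> t) y))
      (graph_embed D (spectral_projection k D a b \<gamma> p y))" if y: "y \<in> L2_sum D" for y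
    using has_rs_integral_scaleC[OF J(3)[OF y], of c] y
    by (simp add: proj graph_embed_scaleC(2)[OF J_D(1)] flip: c_def)
qed

end

section \<open>Continuity of the spectral projection at \<open>m\<close>\<close>

theorem proposition5:
  fixes D :: "(real ^ 'n) set" and m :: "real ^ 'n \<Rightarrow> complex"
    and k :: operator_kind and \<gamma> :: "real \<Rightarrow> complex" and a b :: real
  assumes "open D" "connected D" "bounded D" "D \<noteq> {}"
    and "m \<in> Linf D"
    and "k = Op_IB \<Longrightarrow> \<exists>\<delta>>0. AE x in lebesgue_on D. Re (1 + m x) > \<delta>"
    and "a \<le> b" "rectifiable_curve a b \<gamma>"
    and "\<gamma> ` {a..b} \<inter> A_spectrum k D m = {}"
  shows "(\<exists>r>0. \<forall>p\<in>Linf D. Linf_norm D (\<lambda>x. p x - m x) < ereal r \<longrightarrow>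
            spectral_projection_defined k D a b \<gamma> p \<and>
            spectral_projection k D a b \<gamma> p
              \<in> bounded_ops (L2_sum D) (H20_sum D) (H20_sum_norm D)) \<and>
         (\<forall>\<epsilon>>0. \<exists>r>0. \<forall>p\<in>Linf D. Linf_norm D (\<lambda>x. p x - m x) < ereal r \<longrightarrow>
            op_norm (L2_sum D) (H20_sum_norm D)
              (\<lambda>x. spectral_projection k D a b \<gamma> p x - spectral_projection k D a b \<gamma> m x) < \<epsilon>)"
proof -
  note open_D = assms(1)
  obtain M0 where M0: "ess_bound D m M0"
    using Linf_ess_bound[OF assms(5)] by metis
  \<comment> \<open>The bound is enlarged by 1 so that it also serves every \<open>p\<close> at
    distance at most 1 from \<open>m\<close>.\<close>
  have m: "ess_bound D m (M0 + 1)"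
    by (rule ess_bound_mono[OF M0]) simp
  \<comment> \<open>For \<open>Op_B\<close> the second property is void and \<delta> = 1 will do,
    which lets both kinds share the radius below.\<close>
  obtain \<delta> where \<delta>: "0 < \<delta>" "k = Op_IB \<Longrightarrow> AE x in lebesgue_on D. Re (1 + m x) > \<delta>"
    using assms(6) zero_less_one by blast
  have adm: "admissible D k m"
    using \<delta> by (auto simp: admissible_def[OF open_D])
  have \<gamma>: "continuous_on {a..b} \<gamma>"
    using assms(8) by (simp add: rectifiable_curve_def)
  have compact: "compact (\<gamma> ` {a..b})"
    by (intro compact_continuous_image \<gamma>) simp
  obtain Z where Z: "\<forall>z\<in>\<gamma> ` {a..b}. cmod z \<le> Z"
    using compact_imp_bounded[OF compact] unfolding bounded_iff by blast
  obtain v where v: "variation_majorant a b \<gamma> v"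
    using rectifiable_curve_variation_majorant[OF assms(8)] .
  have "\<exists>K. regular_pencil D K k m z" if "z \<in> \<gamma> ` {a..b}" for z
    using that assms(9) resolvent_set_iff_regular_pencil[OF open_D m adm]
    by (auto simp: A_spectrum_def spectrum_on_def)
  then obtain r0 K where r0: "0 < r0" and K: "\<And>p N z. z \<in> \<gamma> ` {a..b} \<Longrightarrow> ess_bound D p N \<Longrightarrow>
      ess_bound D (\<lambda>x. p x - m x) r0 \<Longrightarrow> regular_pencil D K k p z"
    using regular_pencil_uniform[OF open_D m compact, of k] by metis
  \<comment> \<open>Three requirements: \<open>r0\<close> keeps the pencils regular, 1 keeps the
    common bound \<open>M0 + 1\<close>, and \<open>\<delta> / 2\<close> keeps the real part of
    \<open>1 + p\<close> above \<open>\<delta> / 2\<close>.\<close>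
  define r1 where "r1 = min r0 (min 1 (\<delta> / 2))"
  have r1: "0 < r1"
    using r0 \<delta>(1) by (simp add: r1_def)
  have near: "ess_bound D p (M0 + 1)" "admissible D k p" "\<forall>z\<in>\<gamma> ` {a..b}. regular_pencil D K k p z"
    if r: "r \<le> r1" and pm: "ess_bound D (\<lambda>x. p x - m x) r" for p r
  proof -
    have "ess_bound D (\<lambda>x. (p x - m x) + m x) (r + M0)"
      by (rule ess_bound_add[OF pm M0])
    then have "ess_bound D p (r + M0)"
      by simp
    then show p: "ess_bound D p (M0 + 1)"
      by (rule ess_bound_mono) (use r in \<open>simp add: r1_def\<close>)
    show "admissible D k p"
      unfolding admissible_def[OF open_D]
    proof (intro impI exI conjI)
      assume "k = Op_IB"
      moreover have "AE x in lebesgue_on D. cmod (p x - m x) \<le> r"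
        using pm by (simp add: ess_bound_def)
      ultimately have "AE x in lebesgue_on D. Re (1 + m x) > \<delta> \<and> cmod (p x - m x) \<le> r"
        using \<delta>(2) by simp
      then show "AE x in lebesgue_on D. Re (1 + p x) > \<delta> / 2"
      proof (rule eventually_mono)
        fix x
        assume "Re (1 + m x) > \<delta> \<and> cmod (p x - m x) \<le> r"
        moreover have "r \<le> \<delta> / 2"
          using r by (simp add: r1_def)
        ultimately show "Re (1 + p x) > \<delta> / 2"
          using abs_Re_le_cmod[of "p x - m x"] by (auto simp: abs_le_iff)
      qed
    qed (use \<delta>(1) in simp)
    show "\<forall>z\<in>\<gamma> ` {a..b}. regular_pencil D K k p z"
      using r by (intro ballI K[OF _ p] ess_bound_mono[OF pm]) (simp_all add: r1_def)
  qed
  have diff_bound: "ess_bound D (\<lambda>x. p x - m x) r"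
    if "p \<in> Linf D" "Linf_norm D (\<lambda>x. p x - m x) < ereal r" "0 < r" for p r
    using Linf_norm_less_ess_bound[OF borel_measurable_diff that(2)] that(1,3) assms(5)
    by (simp add: Linf_def)
  have part1: "spectral_projection_defined k D a b \<gamma> p \<and>
      spectral_projection k D a b \<gamma> p \<in> bounded_ops (L2_sum D) (H20_sum D) (H20_sum_norm D)"
    if p: "p \<in> Linf D" and pm: "ess_bound D (\<lambda>x. p x - m x) r1" for p
  proof -
    note near' = near[OF order_refl pm]
    have "\<gamma> ` {a..b} \<inter> A_spectrum k D p = {}"
      using near'(3) resolvent_set_iff_regular_pencil[OF open_D near'(1,2)]
      by (auto simp: A_spectrum_def spectrum_on_def)
    then show ?thesis
      unfolding spectral_projection_defined_def
      using A_op_defined[OF open_D p near'(1,2)]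
        spectral_projection_rs(1,2)[OF open_D v assms(7) \<gamma> near' Z] by blast
  qed
  \<comment> \<open>Lets \<open>near\<close> be used for \<open>m\<close> itself, so that both
    projections come with the same constants.\<close>
  have m0: "ess_bound D (\<lambda>x. m x - m x) r1"
    using ess_bound_mono[OF ess_bound_const[of D 0]] r1 by simp
  \<comment> \<open>The Lipschitz constant of \<open>norm_A_resolvent_diff_le\<close> for the common
    bound \<open>M0 + 1\<close>; its absolute value is used below because its sign is not
    tracked.\<close>
  define C where "C = (1 + (1 + (M0 + 1) + Z * (2 + (M0 + 1))) * K) * (1 + (3 + Z + (M0 + 1)) * (K * (2 + (M0 + 1))))"
  define c where "c = 1 / (2 * complex_of_real pi * \<i>)"
  have part2: "op_norm (L2_sum D) (H20_sum_norm D)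
      (\<lambda>x. spectral_projection k D a b \<gamma> p x - spectral_projection k D a b \<gamma> m x)
      \<le> (cmod c * (\<bar>C\<bar> * r)) * (v b - v a)"
    if r: "r \<le> r1" and pm: "ess_bound D (\<lambda>x. p x - m x) r" for p r
  proof (rule op_norm_le[OF open_D])
    fix y :: "(real ^ 'n) L2 \<times> (real ^ 'n) L2"
    assume y: "y \<in> L2_sum D" "norm y \<le> 1"
    have "0 \<le> r"
      using pm by (simp add: ess_bound_def)
    note p = near[OF r pm]
    note m' = near[OF order_refl m0]
    note Pp = spectral_projection_rs[OF open_D v assms(7) \<gamma> p Z]
    note Pm = spectral_projection_rs[OF open_D v assms(7) \<gamma> m' Z]
    have "H20_sum_norm D (spectral_projection k D a b \<gamma> p y - spectral_projection k D a b \<gamma> m y)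
        = norm (graph_embed D (spectral_projection k D a b \<gamma> p y) - graph_embed D (spectral_projection k D a b \<gamma> m y))"
      using bounded_opsD(1)[OF open_D Pp(2) y(1)] bounded_opsD(1)[OF open_D Pm(2) y(1)]
      by (simp add: H20_sum_norm_graph_embed graph_embed_diff(2)[OF open_D])
    also have "\<dots> \<le> (cmod c * (\<bar>C\<bar> * r)) * (v b - v a)"
    proof (rule has_rs_integral_bound[OF v has_rs_integral_diff[OF Pp(3)[OF y(1)] Pm(3)[OF y(1)]] assms(7)])
      fix t
      assume "t \<in> {a..b}"
      then have t: "\<gamma> t \<in> \<gamma> ` {a..b}"
        by simp
      have "norm (graph_embed D (A_resolvent k D p (\<gamma> t) y) - graph_embed D (A_resolvent k D m (\<gamma> t) y))
          \<le> C * r * norm y"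
        using norm_A_resolvent_diff_le[OF open_D
            p(1,2) p(3)[rule_format, OF t] Z[rule_format, OF t]
            m'(1,2) m'(3)[rule_format, OF t] Z[rule_format, OF t] pm y(1)]
        by (simp add: C_def)
      also have "\<dots> \<le> \<bar>C\<bar> * r * 1"
        using \<open>0 \<le> r\<close> y(2) by (intro mult_mono mult_nonneg_nonneg) auto
      finally show "norm ((1 / (2 * complex_of_real pi * \<i>)) *\<^sub>C graph_embed D (A_resolvent k D p (\<gamma> t) y)
          - (1 / (2 * complex_of_real pi * \<i>)) *\<^sub>C graph_embed D (A_resolvent k D m (\<gamma> t) y)) \<le> cmod c * (\<bar>C\<bar> * r)"
        unfolding scaleC_diff_right[symmetric] norm_scaleC c_def[symmetric] by (simp add: mult_left_mono)
    qed
    finally show "H20_sum_norm D (spectral_projection k D a b \<gamma> p y - spectral_projection k D a b \<gamma> m y)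
        \<le> (cmod c * (\<bar>C\<bar> * r)) * (v b - v a)" .
  qed
  have "0 \<le> v b - v a"
    using v assms(7) unfolding variation_majorant_def by (meson norm_ge_zero order_refl order_trans)
  define L where "L = cmod c * \<bar>C\<bar> * (v b - v a)"
  have "0 \<le> L"
    using \<open>0 \<le> v b - v a\<close> by (simp add: L_def)
  have "\<exists>r>0. \<forall>p\<in>Linf D. Linf_norm D (\<lambda>x. p x - m x) < ereal r \<longrightarrow>
      op_norm (L2_sum D) (H20_sum_norm D)
        (\<lambda>x. spectral_projection k D a b \<gamma> p x - spectral_projection k D a b \<gamma> m x) < \<epsilon>" if "0 < \<epsilon>" for \<epsilon>
  proof (intro exI conjI ballI impI)
    \<comment> \<open>Since \<open>L * (\<epsilon> / (L + 1)) < \<epsilon>\<close>, also when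
      \<open>L = 0\<close>.\<close>
    define r where "r = min r1 (\<epsilon> / (L + 1))"
    show "0 < r"
      using r1 \<open>0 < \<epsilon>\<close> \<open>0 \<le> L\<close> by (simp add: r_def)
    fix p
    assume "p \<in> Linf D" "Linf_norm D (\<lambda>x. p x - m x) < ereal r"
    then have "op_norm (L2_sum D) (H20_sum_norm D)
        (\<lambda>x. spectral_projection k D a b \<gamma> p x - spectral_projection k D a b \<gamma> m x) \<le> L * r"
      using part2[of r p] diff_bound[of p r] \<open>0 < r\<close> by (simp add: r_def L_def mult_ac)
    also have "L * r \<le> L * (\<epsilon> / (L + 1))"
      using \<open>0 \<le> L\<close> by (intro mult_left_mono) (auto simp: r_def)
    also have "\<dots> < \<epsilon>"
      using \<open>0 \<le> L\<close> \<open>0 < \<epsilon>\<close> by (simp add: field_simps)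
    finally show "op_norm (L2_sum D) (H20_sum_norm D)
        (\<lambda>x. spectral_projection k D a b \<gamma> p x - spectral_projection k D a b \<gamma> m x) < \<epsilon>" .
  qed
  moreover have "\<exists>r>0. \<forall>p\<in>Linf D. Linf_norm D (\<lambda>x. p x - m x) < ereal r \<longrightarrow>
      spectral_projection_defined k D a b \<gamma> p \<and>
      spectral_projection k D a b \<gamma> p \<in> bounded_ops (L2_sum D) (H20_sum D) (H20_sum_norm D)"
    using part1 diff_bound r1 by blast
  ultimately show ?thesis
    by blast
qed

end
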